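(* Let $d\ge 1$, let $f\in C(\mathbb{R};\mathbb{R}^d)$ satisfy $|f(\lambda)|\le C(1+|\lambda|)$ for all $\lambda\in\mathbb{R}$ and some $C>0$, and let $u_0\in L^1(\mathbb{T}^d)$. Suppose that $(\nu,m_1,m_2)$ and $(\sigma,\overline m_1,\overline m_2)$ are two measure-valued entropy solutions with concentration (in the sense defined in the context) of the conservation law $\partial_t u+\operatorname{div}_x f(u)=0$ on $\mathbb{T}^d\times\mathbb{R}_+$, both with the same initial datum $\nu_{(x,0)}=\sigma_{(x,0)}=\delta_{\{u_0(x)\}}$. Then there exists a function $w\in L^\infty(\mathbb{R}_+;L^1(\mathbb{T}^d))$ such that $$\nu_{(x,t)}=\sigma_{(x,t)}=\delta_{\{w(x,t)\}}\quad\text{for almost every }(x,t)\in\mathbb{T}^d\times\mathbb{R}_+,$$ and $m_i=\overline m_i=0$ for $i=1,2$.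
   Context: Notation: $\mathbb{R}_+=[0,+\infty)$, $\mathbb{T}^d=(\mathbb{R}/2\pi\mathbb{Z})^d$; $\mathrm{Prob}(\mathbb{R})$ is the set of Borel probability measures on $\mathbb{R}$; $\langle\mu,g(\lambda)\rangle=\int_{\mathbb{R}}g(\lambda)\,\mathrm{d}\mu(\lambda)$. A map $\nu:(x,t)\mapsto\nu_{(x,t)}\in\mathrm{Prob}(\mathbb{R})$ is measurable if $(x,t)\mapsto\langle\nu_{(x,t)},g\rangle$ is measurable for every $g\in C_0(\mathbb{R})$. For $\lambda,k\in\mathbb{R}$ put $q(\lambda,k)=\operatorname{sgn}(\lambda-k)(f(\lambda)-f(k))\in\mathbb{R}^d$. Generated triple: a triple $(\nu,m_1,m_2)$ consists of a measurable map $\nu:\mathbb{T}^d\times\mathbb{R}_+\to\mathrm{Prob}(\mathbb{R})$ (a Young measure), a non-negative Radon measure $m_1$ on $\mathbb{T}^d\times\mathbb{R}_+$ and an $\mathbb{R}^d$-valued Radon measure $m_2$ on $\mathbb{T}^d\times\mathbb{R}_+$ (the concentration measures). It is generated by a sequence $(u_j)$ of functions $u_j:\mathbb{T}^d\times\mathbb{R}_+\to\mathbb{R}$ with $\sup_j\|u_j(\cdot,t)\|_{L^1(\mathbb{T}^d)}\le C$ for almost every $t\in\mathbb{R}_+$ (with $C$ independent of $t$) if $g(u_j)\rightharpoonup^*\langle\nu,g\rangle$ in $L^\infty(\mathbb{T}^d\times\mathbb{R}_+)$ for all $g\in C_0(\mathbb{R})$ and, for every $k\in\mathbb{R}$, weakly-$*$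 in the sense of Radon measures on $\mathbb{T}^d\times\mathbb{R}_+$, $$|u_j-k|\,\mathrm{d}x\mathrm{d}t\rightharpoonup^*\langle\nu_{(x,t)},|\lambda-k|\rangle\,\mathrm{d}x\mathrm{d}t+m_1,\qquad q(u_j,k)\,\mathrm{d}x\mathrm{d}t\rightharpoonup^*\langle\nu_{(x,t)},q(\lambda,k)\rangle\,\mathrm{d}x\mathrm{d}t+m_2 .$$ Measure-valued entropy solution with concentration: a triple $(\nu,m_1,m_2)$ generated by such a sequence is a measure-valued entropy solution with concentration of $\partial_t u+\operatorname{div}_x f(u)=0$, $u(x,0)=u_0(x)$, if the following hold. (i) For every $k\in\mathbb{R}$, $$\partial_t\big(\langle\nu,|\lambda-k|\rangle+m_1\big)+\operatorname{div}_x\big(\langle\nu,\operatorname{sgn}(\lambda-k)(f(\lambda)-f(k))\rangle+m_2\big)\le 0$$ in the sense of distributions, i.e. for every non-negative $\varphi\in C_c^\infty(\mathbb{T}^d\times(0,\infty))$, $$\int\langle\nu_{(x,t)},|\lambda-k|\rangle\,\partial_t\varphi\,\mathrm{d}x\mathrm{d}t+\int\partial_t\varphi\,m_1(\mathrm{d}x\mathrm{d}t)+\int\langle\nu_{(x,t)},q(\lambda,k)\rangle\cdot\nabla_x\varphi\,\mathrm{d}x\mathrm{d}t+\int\nabla_x\varphi\cdot m_2(\mathrm{d}x\mathrm{d}t)\ge 0 .$$ (ii) The initial condition $\nu_{(x,0)}=\delta_{\{u_0(x)\}}$ is attained in the sense that $$\lim_{T\to0^+}\Big\{\frac1T\int_0^T\!\!\int_{\mathbb{T}^d}\langle\nu_{(x,t)},|\lambda-u_0(x)|\rangle\,\mathrm{d}x\mathrm{d}t+\frac1T\int_{\mathbb{T}^d\times[0,T]}m_1(\mathrm{d}x\mathrm{d}t)\Big\}=0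 .$$ (iii) Standing assumption: there is $C>0$ such that $|m_2|(\mathbb{T}^d\times A)\le C\,m_1(\mathbb{T}^d\times A)$ for every Borel set $A\subset\mathbb{R}_+$. *)

theory Defs
  imports "HOL-Probability.Probability"
begin

text \<open>
  The torus \<open>(\<real>/2\<pi>\<int>)\<^sup>d\<close> is identified, as a measurable space, with the half-open cell
  \<open>[0,2\<pi>)\<^sup>d\<close>; the dimension \<open>d\<close> is \<open>CARD('d)\<close>. Its topology and smooth structure enter only
  through test functions, which are \<open>2\<pi>\<close>-periodic in every space direction.
  Points of space-time are pairs \<open>(x, t)\<close>.
\<close>

definition torus :: "(real ^ 'd) set" where
  "torus = {x. \<forall>i. 0 \<le> x $ i \<and> x $ i < 2 * pi}"

definition spacetime :: "((real ^ 'd) \<times> real) set" where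
  "spacetime = torus \<times> {0..}"

definition borel_spacetime :: "((real ^ 'd) \<times> real) measure" where
  "borel_spacetime = restrict_space borel spacetime"

definition x_periodic :: "((real ^ 'd) \<times> real \<Rightarrow> real) \<Rightarrow> bool" where
  "x_periodic \<phi> \<longleftrightarrow> (\<forall>x t i. \<phi> (x + (2 * pi) *\<^sub>R axis i 1, t) = \<phi> (x, t))"


subsection \<open>Test functions\<close>

text \<open>\<open>C\<^sub>0(\<real>)\<close>: continuous functions vanishing at infinity.\<close>

definition C0_real :: "(real \<Rightarrow> real) set" where
  "C0_real = {g. continuous_on UNIV g \<and> (g \<longlongrightarrow> 0) at_infinity}"

text \<open>
  \<open>C\<^sub>c(\<T>\<^sup>d \<times> \<real>\<^sub>+)\<close>, where \<open>\<real>\<^sub>+ = [0,\<infinity>)\<close>: a test function need not vanish at \<open>t = 0\<close>.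
  Values at negative times are irrelevant.
\<close>

definition Cc_spacetime :: "((real ^ 'd) \<times> real \<Rightarrow> real) set" where
  "Cc_spacetime = {\<phi>. continuous_on (UNIV \<times> {0..}) \<phi> \<and> x_periodic \<phi> \<and>
     (\<exists>T. \<forall>x t. t > T \<longrightarrow> \<phi> (x, t) = 0)}"

primrec Ck :: "nat \<Rightarrow> ('a::euclidean_space \<Rightarrow> real) \<Rightarrow> bool" where
  "Ck 0 \<phi> \<longleftrightarrow> continuous_on UNIV \<phi>"
| "Ck (Suc n) \<phi> \<longleftrightarrow> (\<forall>z. \<phi> differentiable (at z)) \<and>
     (\<forall>v. Ck n (\<lambda>z. frechet_derivative \<phi> (at z) v))"

text \<open>
  \<open>C\<^sub>c\<^sup>\<infinity>(\<T>\<^sup>d \<times> (0,\<infinity>))\<close>; its elements are extended by zero to \<open>t \<le> 0\<close>.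
\<close>

definition Cc_smooth :: "((real ^ 'd) \<times> real \<Rightarrow> real) set" where
  "Cc_smooth = {\<phi>. (\<forall>n. Ck n \<phi>) \<and> x_periodic \<phi> \<and>
     (\<exists>a b. 0 < a \<and> (\<forall>x t. t \<notin> {a..b} \<longrightarrow> \<phi> (x, t) = 0))}"

definition dt :: "((real ^ 'd) \<times> real \<Rightarrow> real) \<Rightarrow> (real ^ 'd) \<times> real \<Rightarrow> real" where
  "dt \<phi> z = frechet_derivative \<phi> (at z) (0, 1)"

definition grad_x :: "((real ^ 'd) \<times> real \<Rightarrow> real) \<Rightarrow> (real ^ 'd) \<times> real \<Rightarrow> real ^ 'd" where
  "grad_x \<phi> z = (\<chi> i. frechet_derivative \<phi> (at z) (axis i 1, 0))"


subsection \<open>Radon measures\<close>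

text \<open>Relatively compact Borel subsets of \<open>\<T>\<^sup>d \<times> \<real>\<^sub>+\<close>.\<close>

definition bounded_borel :: "((real ^ 'd) \<times> real) set set" where
  "bounded_borel = {A \<in> sets borel_spacetime. \<exists>T. A \<subseteq> torus \<times> {0..T}}"

text \<open>
  Since \<open>\<T>\<^sup>d \<times> \<real>\<^sub>+\<close> is locally compact and second countable, a non-negative Radon measure is a
  Borel measure that is finite on compact sets.
\<close>

definition radon_measure :: "((real ^ 'd) \<times> real) measure \<Rightarrow> bool" where
  "radon_measure m \<longleftrightarrow> sets m = sets borel_spacetime \<and>
     (\<forall>T. emeasure m (torus \<times> {0..T}) < \<infinity>)"

text \<open>
  An \<open>\<real>\<^sup>d\<close>-valued Radon measure is a set function on the relatively compact Borel sets that is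
  countably additive on the Borel subsets of every compact set; it need not have finite total
  mass, so it is in general undefined on unbounded sets, and values there are ignored.
\<close>

definition vector_radon_measure :: "(((real ^ 'd) \<times> real) set \<Rightarrow> real ^ 'd) \<Rightarrow> bool" where
  "vector_radon_measure m \<longleftrightarrow>
     (\<forall>A :: nat \<Rightarrow> _. disjoint_family A \<longrightarrow> (\<forall>n. A n \<in> bounded_borel) \<longrightarrow>
        (\<Union>n. A n) \<in> bounded_borel \<longrightarrow> (\<lambda>n. m (A n)) sums m (\<Union>n. A n))"

definition total_variation ::
    "(((real ^ 'd) \<times> real) set \<Rightarrow> real ^ 'd) \<Rightarrow> ((real ^ 'd) \<times> real) set \<Rightarrow> ennreal" where
  "total_variation m A =
     (SUP B \<in> {B :: nat \<Rightarrow> _. disjoint_family B \<and> (\<forall>n. B n \<in> bounded_borel \<and> B n \<subseteq> A)}.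
        \<Sum>n. ennreal (norm (m (B n))))"

text \<open>
  Jordan decomposition of the \<open>i\<close>-th component, \<open>\<mu>\<^sup>+(A) = sup {\<mu>(B) | B \<subseteq> A}\<close> and
  \<open>\<mu>\<^sup>- = (-\<mu>)\<^sup>+\<close>. The map \<open>ennreal\<close> sends negative numbers to \<open>0\<close>, which does not affect the
  supremum because \<open>B = {}\<close> is admissible.
\<close>

definition pos_part ::
    "(((real ^ 'd) \<times> real) set \<Rightarrow> real ^ 'd) \<Rightarrow> 'd \<Rightarrow> ((real ^ 'd) \<times> real) measure" where
  "pos_part m i = measure_of spacetime (sets borel_spacetime)
     (\<lambda>A. SUP B \<in> {B \<in> bounded_borel. B \<subseteq> A}. ennreal (m B $ i))"

definition neg_part ::
    "(((real ^ 'd) \<times> real) set \<Rightarrow> real ^ 'd) \<Rightarrow> 'd \<Rightarrow> ((real ^ 'd) \<times> real) measure" where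
  "neg_part m i = pos_part (\<lambda>A. - m A) i"

text \<open>\<open>\<integral> \<phi> dm \<in> \<real>\<^sup>d\<close> for scalar \<open>\<phi>\<close>, and \<open>\<integral> \<Phi> \<cdot> dm \<in> \<real>\<close> for vector-valued \<open>\<Phi>\<close>.\<close>

definition vector_integral ::
    "(((real ^ 'd) \<times> real) set \<Rightarrow> real ^ 'd) \<Rightarrow> ((real ^ 'd) \<times> real \<Rightarrow> real) \<Rightarrow> real ^ 'd" where
  "vector_integral m \<phi> =
     (\<chi> i. (\<integral>z. \<phi> z \<partial>pos_part m i) - (\<integral>z. \<phi> z \<partial>neg_part m i))"

definition dot_integral ::
    "(((real ^ 'd) \<times> real) set \<Rightarrow> real ^ 'd) \<Rightarrow> ((real ^ 'd) \<times> real \<Rightarrow> real ^ 'd) \<Rightarrow> real" where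
  "dot_integral m \<Phi> = (\<Sum>i\<in>UNIV. vector_integral m (\<lambda>z. \<Phi> z $ i) $ i)"


subsection \<open>Young measures and generated triples\<close>

definition young_measure :: "((real ^ 'd) \<times> real \<Rightarrow> real measure) \<Rightarrow> bool" where
  "young_measure \<nu> \<longleftrightarrow>
     (\<forall>z\<in>spacetime. prob_space (\<nu> z) \<and> sets (\<nu> z) = sets borel) \<and>
     (\<forall>g\<in>C0_real. (\<lambda>z. \<integral>l. g l \<partial>\<nu> z) \<in> borel_measurable (lebesgue_on spacetime))"

text \<open>
  Functions bounded in \<open>L\<^sup>1(\<T>\<^sup>d)\<close> uniformly in time: membership in
  \<open>L\<^sup>\<infinity>(\<real>\<^sub>+; L\<^sup>1(\<T>\<^sup>d))\<close> with norm at most \<open>C\<close>, for all members of a family simultaneously.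
\<close>

definition Linf_L1_bounded :: "('j \<Rightarrow> (real ^ 'd) \<times> real \<Rightarrow> real) \<Rightarrow> real \<Rightarrow> bool" where
  "Linf_L1_bounded u C \<longleftrightarrow>
     (\<forall>j. u j \<in> borel_measurable (lebesgue_on spacetime)) \<and>
     (AE t in lebesgue_on {0..}. \<forall>j.
        integrable (lebesgue_on torus) (\<lambda>x. u j (x, t)) \<and>
        (\<integral>x. \<bar>u j (x, t)\<bar> \<partial>lebesgue_on torus) \<le> C)"

definition Linf_L1 :: "((real ^ 'd) \<times> real \<Rightarrow> real) set" where
  "Linf_L1 = {w. \<exists>C. Linf_L1_bounded (\<lambda>_::unit. w) C}"

definition entropy_flux :: "(real \<Rightarrow> real ^ 'd) \<Rightarrow> real \<Rightarrow> real \<Rightarrow> real ^ 'd" where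
  "entropy_flux f l k = sgn (l - k) *\<^sub>R (f l - f k)"

text \<open>
  The finiteness clause says that \<open>\<langle>\<nu>,|\<lambda> - k|\<rangle> dxdt\<close> is itself a Radon measure, which is
  implicit in its appearance in the weak-* limit; it excludes the convention that the Bochner
  integral of a non-integrable function is \<open>0\<close>.
\<close>

definition generates ::
    "(real \<Rightarrow> real ^ 'd) \<Rightarrow> (nat \<Rightarrow> (real ^ 'd) \<times> real \<Rightarrow> real) \<Rightarrow>
     ((real ^ 'd) \<times> real \<Rightarrow> real measure) \<Rightarrow> ((real ^ 'd) \<times> real) measure \<Rightarrow>
     (((real ^ 'd) \<times> real) set \<Rightarrow> real ^ 'd) \<Rightarrow> bool" where
  "generates f u \<nu> m1 m2 \<longleftrightarrow>
     (\<exists>C. Linf_L1_bounded u C) \<and>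
     (\<forall>g\<in>C0_real. \<forall>h. integrable (lebesgue_on spacetime) h \<longrightarrow>
        (\<lambda>j. \<integral>z. g (u j z) * h z \<partial>lebesgue_on spacetime)
          \<longlonglongrightarrow> (\<integral>z. (\<integral>l. g l \<partial>\<nu> z) * h z \<partial>lebesgue_on spacetime)) \<and>
     (\<forall>k T. (\<integral>\<^sup>+z\<in>torus \<times> {0..T}. (\<integral>\<^sup>+l. ennreal \<bar>l - k\<bar> \<partial>\<nu> z) \<partial>lebesgue) < \<infinity>) \<and>
     (\<forall>k. \<forall>\<phi>\<in>Cc_spacetime.
        (\<lambda>j. \<integral>z. \<bar>u j z - k\<bar> * \<phi> z \<partial>lebesgue_on spacetime)
          \<longlonglongrightarrow> (\<integral>z. (\<integral>l. \<bar>l - k\<bar> \<partial>\<nu> z) * \<phi> z \<partial>lebesgue_on spacetime)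
              + (\<integral>z. \<phi> z \<partial>m1)) \<and>
     (\<forall>k. \<forall>\<phi>\<in>Cc_spacetime.
        (\<lambda>j. \<integral>z. \<phi> z *\<^sub>R entropy_flux f (u j z) k \<partial>lebesgue_on spacetime)
          \<longlonglongrightarrow> (\<integral>z. \<phi> z *\<^sub>R (\<integral>l. entropy_flux f l k \<partial>\<nu> z) \<partial>lebesgue_on spacetime)
              + vector_integral m2 \<phi>)"


subsection \<open>Measure-valued entropy solutions with concentration\<close>

definition entropy_inequality ::
    "(real \<Rightarrow> real ^ 'd) \<Rightarrow> ((real ^ 'd) \<times> real \<Rightarrow> real measure) \<Rightarrow>
     ((real ^ 'd) \<times> real) measure \<Rightarrow> (((real ^ 'd) \<times> real) set \<Rightarrow> real ^ 'd) \<Rightarrow> bool" where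
  "entropy_inequality f \<nu> m1 m2 \<longleftrightarrow>
     (\<forall>k. \<forall>\<phi>\<in>Cc_smooth. (\<forall>z. 0 \<le> \<phi> z) \<longrightarrow>
        (\<integral>z. (\<integral>l. \<bar>l - k\<bar> \<partial>\<nu> z) * dt \<phi> z \<partial>lebesgue_on spacetime)
        + (\<integral>z. dt \<phi> z \<partial>m1)
        + (\<integral>z. (\<integral>l. entropy_flux f l k \<partial>\<nu> z) \<bullet> grad_x \<phi> z \<partial>lebesgue_on spacetime)
        + dot_integral m2 (grad_x \<phi>) \<ge> 0)"

definition initial_condition ::
    "(real ^ 'd \<Rightarrow> real) \<Rightarrow> ((real ^ 'd) \<times> real \<Rightarrow> real measure) \<Rightarrow>
     ((real ^ 'd) \<times> real) measure \<Rightarrow> bool" where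
  "initial_condition u0 \<nu> m1 \<longleftrightarrow>
     ((\<lambda>T. 1 / T * (LINT z:torus \<times> {0..T}|lebesgue. (\<integral>l. \<bar>l - u0 (fst z)\<bar> \<partial>\<nu> z))
         + 1 / T * measure m1 (torus \<times> {0..T})) \<longlongrightarrow> 0) (at_right 0)"

definition mv_entropy_solution ::
    "(real \<Rightarrow> real ^ 'd) \<Rightarrow> (real ^ 'd \<Rightarrow> real) \<Rightarrow> ((real ^ 'd) \<times> real \<Rightarrow> real measure) \<Rightarrow>
     ((real ^ 'd) \<times> real) measure \<Rightarrow> (((real ^ 'd) \<times> real) set \<Rightarrow> real ^ 'd) \<Rightarrow> bool" where
  "mv_entropy_solution f u0 \<nu> m1 m2 \<longleftrightarrow>
     young_measure \<nu> \<and> radon_measure m1 \<and> vector_radon_measure m2 \<and>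
     (\<exists>u. generates f u \<nu> m1 m2) \<and>
     entropy_inequality f \<nu> m1 m2 \<and>
     initial_condition u0 \<nu> m1 \<and>
     (\<exists>C>0. \<forall>A\<in>sets borel. A \<subseteq> {0..} \<longrightarrow>
        total_variation m2 (torus \<times> A) \<le> ennreal C * emeasure m1 (torus \<times> A))"

end

theory Submission
  imports Defs "HOL-Computational_Algebra.Polynomial" "HOL-Real_Asymp.Real_Asymp"
begin

text \<open>
  Two solutions are compared by Kruzhkov's doubling of variables. The entropy inequality of
  \<open>\<nu>\<close> is tested with \<open>\<chi>(t) \<omega>(s - t) \<rho>(x - y)\<close> and averaged over \<open>(y, s)\<close> and over the level
  \<open>k\<close>, distributed according to \<open>\<sigma>\<close> at \<open>(y, s)\<close>; the inequality of \<open>\<sigma>\<close> is treated in the same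
  way, and the two are added. Every flux term disappears. The fluxes of the Young measures cancel,
  because the entropy flux is symmetric in its two states whereas the gradients of \<open>\<rho>(x - y)\<close> in
  \<open>x\<close> and in \<open>y\<close> are opposite. The concentration measures \<open>m2\<close> and \<open>m2'\<close> are integrated
  against the mean of a gradient over the torus, which is zero. What is left (\<open>doubling\<close>) says
  that the distance between \<open>\<nu>\<close> and \<open>\<sigma>\<close>, smoothed by \<open>\<omega>\<close> and \<open>\<rho>\<close>, plus the masses of \<open>m1\<close> and
  \<open>m1'\<close> does not increase in time.

  The masses have the same sign as the distance, so the estimate controls them as well. On the
  initial layer everything is small: the states of both solutions are compared with \<open>u0\<close>,
  at the price of the oscillation \<open>|u0(x) - u0(y)|\<close> averaged with \<open>\<rho>(x - y)\<close>
  (\<open>initial_layer_bound\<close>, \<open>energy_estimate\<close>). When first the time scale and then the width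
  of \<open>\<rho>\<close> tend to zero, the right-hand side vanishes by the initial condition and by the
  continuity of translations in \<open>L\<^sup>1\<close> (\<open>contraction_limit\<close>). The mass of \<open>m1\<close> at later times does
  not depend on these parameters, hence it is zero, and the initial condition excludes mass
  at time zero (\<open>concentration_vanishes\<close>); then \<open>m2\<close> vanishes because \<open>m1\<close> dominates it.

  The same limit makes the smoothed distance of \<open>\<nu>\<close> and \<open>\<sigma>\<close> tend to zero. The distance \<open>|l - k|\<close>
  dominates a squared chordal distance, which is a finite sum of products of \<open>C\<^sub>0\<close>
  functions of \<open>l\<close> and of \<open>k\<close>; for it, the diagonal \<open>(y, s) = (x, t)\<close> is reached with the help of
  the \<open>L\<^sup>1\<close> convergence of mollified bounded functions (\<open>diagonal_limit\<close>). So at almost every point the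
  product of \<open>\<nu>\<close> and \<open>\<sigma>\<close> is carried by the diagonal, and both are the same point mass
  (\<open>dirac\<close>). The bound on the resulting function is inherited from the generating sequence, because
  the integral of \<open>|l|\<close> against the Young measure is at most the weak limit of the absolute values
  (\<open>dirac_bounded\<close>).
\<close>

section \<open>Smooth functions\<close>

definition smooth :: "('a::euclidean_space \<Rightarrow> real) \<Rightarrow> bool" where
  "smooth \<phi> \<longleftrightarrow> (\<forall>n. Ck n \<phi>)"

lemma Ck_SucI:
  assumes "\<And>z. (\<phi> has_derivative \<phi>' z) (at z)" and "\<And>v. Ck n (\<lambda>z. \<phi>' z v)"
  shows "Ck (Suc n) \<phi>"
proof -
  have "frechet_derivative \<phi> (at z) = \<phi>' z" for z
    using frechet_derivative_at[OF assms(1)[of z]] by simp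
  then show ?thesis using assms by (auto simp: differentiable_def)
qed

lemma Ck_SucD:
  assumes "Ck (Suc n) \<phi>"
  shows "(\<phi> has_derivative frechet_derivative \<phi> (at z)) (at z)"
    and "Ck n (\<lambda>z. frechet_derivative \<phi> (at z) v)"
  using assms by (auto simp: frechet_derivative_works[symmetric])

lemma Ck_Suc_imp_Ck: "Ck (Suc n) \<phi> \<Longrightarrow> Ck n \<phi>"
proof (induction n arbitrary: \<phi>)
  case 0
  then show ?case
    by (auto simp: continuous_on_eq_continuous_within differentiable_imp_continuous_within)
next
  case (Suc n)
  show ?case
    by (rule Ck_SucI[OF Ck_SucD(1)[OF Suc.prems] Suc.IH[OF Ck_SucD(2)[OF Suc.prems]]])
qed

lemma Ck_const: "Ck n (\<lambda>_. c)"
proof (induction n arbitrary: c)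
  case (Suc n)
  show ?case by (rule Ck_SucI[where \<phi>'="\<lambda>_ _. 0"]) (auto intro: Suc)
qed auto

lemma Ck_bounded_linear:
  assumes "bounded_linear l" shows "Ck n l"
proof (cases n)
  case 0
  then show ?thesis using linear_continuous_on[OF assms] by simp
next
  case (Suc m)
  show ?thesis unfolding Suc
    by (rule Ck_SucI[where \<phi>'="\<lambda>_. l"]) (auto intro: Ck_const bounded_linear_imp_has_derivative assms)
qed

lemma Ck_add: "Ck n \<phi> \<Longrightarrow> Ck n \<psi> \<Longrightarrow> Ck n (\<lambda>z. \<phi> z + \<psi> z)"
proof (induction n arbitrary: \<phi> \<psi>)
  case 0
  then show ?case by (simp add: continuous_on_add continuous_on_mult)
next
  case (Suc n)
  show ?case
    by (rule Ck_SucI[OF has_derivative_add[OF Ck_SucD(1)[OF Suc.prems(1)] Ck_SucD(1)[OF Suc.prems(2)]]])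
      (rule Suc.IH[OF Ck_SucD(2)[OF Suc.prems(1)] Ck_SucD(2)[OF Suc.prems(2)]])
qed

lemma Ck_mult: "Ck n \<phi> \<Longrightarrow> Ck n \<psi> \<Longrightarrow> Ck n (\<lambda>z. \<phi> z * \<psi> z)"
proof (induction n arbitrary: \<phi> \<psi>)
  case 0
  then show ?case by (simp add: continuous_on_add continuous_on_mult)
next
  case (Suc n)
  show ?case
    by (rule Ck_SucI[OF has_derivative_mult[OF Ck_SucD(1)[OF Suc.prems(1)] Ck_SucD(1)[OF Suc.prems(2)]]])
      (intro Ck_add Suc.IH Ck_SucD(2)[OF Suc.prems(1)] Ck_SucD(2)[OF Suc.prems(2)]
        Ck_Suc_imp_Ck[OF Suc.prems(1)] Ck_Suc_imp_Ck[OF Suc.prems(2)])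
qed

lemma real_has_derivative_1:
  fixes D :: "real \<Rightarrow> real"
  assumes "(h has_derivative D) (at y)" shows "D c = c * D 1"
  using linear_scale[OF has_derivative_linear[OF assms], of c 1] by simp

lemma Ck_compose:
  fixes h :: "real \<Rightarrow> real"
  shows "Ck n h \<Longrightarrow> Ck n \<phi> \<Longrightarrow> Ck n (\<lambda>z. h (\<phi> z))"
proof (induction n arbitrary: h \<phi>)
  case 0
  then show ?case unfolding Ck.simps by (rule continuous_on_compose2) simp
next
  case (Suc n)
  note h = Ck_SucD[OF Suc.prems(1)] and p = Ck_SucD[OF Suc.prems(2)]
  show ?case
  proof (rule Ck_SucI)
    show "((\<lambda>z. h (\<phi> z)) has_derivative
        (\<lambda>v. frechet_derivative \<phi> (at z) v * frechet_derivative h (at (\<phi> z)) 1)) (at z)" for z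
      using has_derivative_compose[OF p(1)[of z] h(1)[of "\<phi> z"]]
      by (subst real_has_derivative_1[OF h(1), symmetric])
    show "Ck n (\<lambda>z. frechet_derivative \<phi> (at z) v * frechet_derivative h (at (\<phi> z)) 1)" for v
      by (intro Ck_mult p(2) Suc.IH[OF h(2)] Ck_Suc_imp_Ck[OF Suc.prems(2)])
  qed
qed

lemma Ck_inverse:
  assumes "\<And>z. \<phi> z \<noteq> 0" shows "Ck n \<phi> \<Longrightarrow> Ck n (\<lambda>z. inverse (\<phi> z))"
proof (induction n)
  case 0
  then show ?case unfolding Ck.simps by (rule continuous_on_inverse) (simp add: assms)
next
  case (Suc n)
  note p = Ck_SucD[OF Suc.prems]
  have "Ck n \<phi>" using Suc.prems by (rule Ck_Suc_imp_Ck)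
  note i = Suc.IH[OF this]
  show ?case
  proof (rule Ck_SucI)
    show "((\<lambda>z. inverse (\<phi> z)) has_derivative (\<lambda>v. (- 1) * (inverse (\<phi> z) *
        (frechet_derivative \<phi> (at z) v * inverse (\<phi> z))))) (at z)" for z
      using Deriv.has_derivative_inverse[OF assms p(1)[of z]] by (simp add: mult.assoc)
  qed (intro Ck_mult Ck_const i p(2))
qed

lemma Ck_real_SucI:
  fixes h :: "real \<Rightarrow> real"
  assumes "\<And>x. (h has_real_derivative h' x) (at x)" and "Ck n h'"
  shows "Ck (Suc n) h"
  by (rule Ck_SucI[OF assms(1)[unfolded has_field_derivative_def] Ck_mult[OF assms(2) Ck_const]])

lemma Ck_real_deriv:
  fixes h :: "real \<Rightarrow> real"
  assumes "\<And>x. (h has_real_derivative h' x) (at x)" and "Ck (Suc n) h"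
  shows "Ck n h'"
proof -
  have "frechet_derivative h (at x) = (*) (h' x)" for x
    by (rule frechet_derivative_at[symmetric, OF assms(1)[unfolded has_field_derivative_def]])
  then show ?thesis using Ck_SucD(2)[OF assms(2), of 1] by (simp only: mult_1_right)
qed

lemma smooth_const: "smooth (\<lambda>_. c)"
  unfolding smooth_def by (intro allI Ck_const)

lemma smooth_bounded_linear: "bounded_linear l \<Longrightarrow> smooth l"
  unfolding smooth_def by (intro allI Ck_bounded_linear)

lemma smooth_add: "smooth \<phi> \<Longrightarrow> smooth \<psi> \<Longrightarrow> smooth (\<lambda>z. \<phi> z + \<psi> z)"
  unfolding smooth_def by (intro allI Ck_add) auto

lemma smooth_mult: "smooth \<phi> \<Longrightarrow> smooth \<psi> \<Longrightarrow> smooth (\<lambda>z. \<phi> z * \<psi> z)"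
  unfolding smooth_def by (rule allI, rule Ck_mult) auto

lemma smooth_inverse: "(\<And>z. \<phi> z \<noteq> 0) \<Longrightarrow> smooth \<phi> \<Longrightarrow> smooth (\<lambda>z. inverse (\<phi> z))"
  unfolding smooth_def by (rule allI, rule Ck_inverse) auto

lemma smooth_compose: "smooth h \<Longrightarrow> smooth \<phi> \<Longrightarrow> smooth (\<lambda>z. h (\<phi> z))" for h :: "real \<Rightarrow> real"
  unfolding smooth_def by (rule allI, rule Ck_compose) auto

lemma smooth_diff: "smooth \<phi> \<Longrightarrow> smooth \<psi> \<Longrightarrow> smooth (\<lambda>z. \<phi> z - \<psi> z)"
  using smooth_add[OF _ smooth_mult[OF smooth_const[of "- 1"]], of \<phi> \<psi>] by simp

lemma smooth_sum: "(\<And>i. i \<in> I \<Longrightarrow> smooth (\<phi> i)) \<Longrightarrow> smooth (\<lambda>z. \<Sum>i\<in>I. \<phi> i z)"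
  by (induction I rule: infinite_finite_induct) (simp_all add: smooth_const smooth_add)

lemma smooth_real_deriv:
  fixes h :: "real \<Rightarrow> real"
  assumes "\<And>x. (h has_real_derivative h' x) (at x)" and "smooth h"
  shows "smooth h'"
  unfolding smooth_def by (intro allI Ck_real_deriv[OF assms(1)] assms(2)[unfolded smooth_def, rule_format])

lemma smooth_continuous: "smooth \<phi> \<Longrightarrow> continuous_on UNIV \<phi>"
  unfolding smooth_def using Ck.simps(1)[of \<phi>] by blast

lemma smooth_differentiable: "smooth \<phi> \<Longrightarrow> (\<phi> has_derivative frechet_derivative \<phi> (at z)) (at z)"
  using Ck_SucD(1)[of 0 \<phi> z] unfolding smooth_def by blast

lemma smooth_cos: "smooth (cos :: real \<Rightarrow> real)"
proof -
  have "Ck n (sin :: real \<Rightarrow> real) \<and> Ck n (cos :: real \<Rightarrow> real)" for n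
  proof (induction n)
    case 0
    then show ?case by (simp add: continuous_on_sin continuous_on_cos continuous_on_id)
  next
    case (Suc n)
    then have "Ck n (\<lambda>x::real. (- 1) * sin x)" by (intro Ck_mult Ck_const) auto
    then have "Ck (Suc n) (cos :: real \<Rightarrow> real)"
      by (rule Ck_real_SucI[rotated]) (auto intro!: DERIV_cos[THEN DERIV_cong])
    moreover have "Ck (Suc n) (sin :: real \<Rightarrow> real)"
      using Suc by (intro Ck_real_SucI[OF DERIV_sin]) auto
    ultimately show ?case by blast
  qed
  then show ?thesis by (simp add: smooth_def)
qed

subsection \<open>Bump functions\<close>

text \<open>
  The functions \<open>p(1/x) exp(-1/x)\<close>, extended by zero to \<open>x \<le> 0\<close>. Differentiation maps this family to
  itself, so an induction on the order that is uniform in \<open>p\<close> gives smoothness of all of them.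
\<close>

definition poly_exp_inverse :: "real poly \<Rightarrow> real \<Rightarrow> real" where
  "poly_exp_inverse p x = (if x \<le> 0 then 0 else poly p (1 / x) * exp (- (1 / x)))"

lemma poly_exp_inverse_tendsto_0: "(poly_exp_inverse p \<longlongrightarrow> 0) (at 0)"
proof -
  have "((\<lambda>y. \<Sum>i\<le>degree p. coeff p i * (y ^ i / exp y)) \<longlongrightarrow> (\<Sum>i\<le>degree p. coeff p i * 0)) at_top"
    by (intro tendsto_sum tendsto_mult_left tendsto_power_div_exp_0)
  moreover have "poly p y * exp (- y) = (\<Sum>i\<le>degree p. coeff p i * (y ^ i / exp y))" for y
    unfolding poly_altdef sum_distrib_right exp_minus
    by (intro sum.cong refl) (simp add: divide_inverse)
  ultimately have "((\<lambda>y. poly p y * exp (- y)) \<longlongrightarrow> 0) at_top" by simp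
  from filterlim_compose[OF this filterlim_inverse_at_top_right]
  have "((\<lambda>x. poly p (1 / x) * exp (- (1 / x))) \<longlongrightarrow> 0) (at_right 0)"
    by (simp add: inverse_eq_divide)
  then have "(poly_exp_inverse p \<longlongrightarrow> 0) (at_right 0)"
    by (rule tendsto_cong[THEN iffD1, rotated])
      (auto simp: poly_exp_inverse_def eventually_at_filter)
  moreover have "(poly_exp_inverse p \<longlongrightarrow> 0) (at_left 0)"
    by (rule tendsto_eventually) (auto simp: poly_exp_inverse_def eventually_at_filter)
  ultimately show ?thesis by (simp add: filterlim_split_at_real)
qed

text \<open>
  At \<open>0\<close> the difference quotient is the member of the family with polynomial \<open>x p(x)\<close>, so the previous
  limit is all that has to be known there.
\<close>

lemma poly_exp_inverse_has_derivative:
  "(poly_exp_inverse p has_real_derivative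
     poly_exp_inverse (pCons 0 (pCons 0 (p - pderiv p))) x) (at x)"
proof -
  consider "x < 0" | "x = 0" | "x > 0" by linarith
  then show ?thesis
  proof cases
    case 1
    have "((\<lambda>_. 0) has_real_derivative 0) (at x)" by simp
    then have "(poly_exp_inverse p has_real_derivative 0) (at x)"
      by (rule has_field_derivative_transform_within_open[where S="{..<0}"])
        (use 1 in \<open>auto simp: poly_exp_inverse_def\<close>)
    then show ?thesis using 1 by (simp add: poly_exp_inverse_def)
  next
    case 2
    have eq: "poly_exp_inverse p h / h = poly_exp_inverse (pCons 0 p) h" for h
      by (auto simp: poly_exp_inverse_def)
    show ?thesis
      unfolding 2 DERIV_def using poly_exp_inverse_tendsto_0[of "pCons 0 p"]
      by (simp add: eq poly_exp_inverse_def[of _ 0])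
  next
    case 3
    have "((\<lambda>x. poly p (1 / x) * exp (- (1 / x))) has_real_derivative
        poly_exp_inverse (pCons 0 (pCons 0 (p - pderiv p))) x) (at x)"
      using 3 by (auto intro!: derivative_eq_intros DERIV_chain'[OF _ poly_DERIV]
          simp: poly_exp_inverse_def field_simps power2_eq_square)
    then show ?thesis
      by (rule has_field_derivative_transform_within_open[where S="{0<..}"])
        (use 3 in \<open>auto simp: poly_exp_inverse_def\<close>)
  qed
qed

lemma smooth_poly_exp_inverse: "smooth (poly_exp_inverse p)"
proof -
  have "Ck n (poly_exp_inverse p)" for n
  proof (induction n arbitrary: p)
    case 0
    then show ?case
      using DERIV_isCont[OF poly_exp_inverse_has_derivative] by (simp add: continuous_on_eq_continuous_at)
  next
    case (Suc n)
    show ?case by (rule Ck_real_SucI[OF poly_exp_inverse_has_derivative Suc])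
  qed
  then show ?thesis by (simp add: smooth_def)
qed

text \<open>
  The flat function \<open>exp(-1/x)\<close> for \<open>x > 0\<close>.
\<close>

definition soft_plus :: "real \<Rightarrow> real" where
  "soft_plus = poly_exp_inverse 1"

definition soft_plus_deriv :: "real \<Rightarrow> real" where
  "soft_plus_deriv = poly_exp_inverse [:0, 0, 1:]"

lemma soft_plus_simps:
  "x \<le> 0 \<Longrightarrow> soft_plus x = 0" "x > 0 \<Longrightarrow> soft_plus x > 0" "soft_plus x \<ge> 0"
  "x \<le> 0 \<Longrightarrow> soft_plus_deriv x = 0" "x > 0 \<Longrightarrow> soft_plus_deriv x > 0" "soft_plus_deriv x \<ge> 0"
  by (auto simp: soft_plus_def soft_plus_deriv_def poly_exp_inverse_def)

lemma soft_plus_has_derivative: "(soft_plus has_real_derivative soft_plus_deriv x) (at x)"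
  using poly_exp_inverse_has_derivative[of 1 x] by (simp add: soft_plus_def soft_plus_deriv_def one_pCons)

lemma smooth_soft_plus: "smooth soft_plus" and smooth_soft_plus_deriv: "smooth soft_plus_deriv"
  by (auto simp: soft_plus_def soft_plus_deriv_def smooth_poly_exp_inverse)

text \<open>
  The bump is obtained as the derivative of a smooth step, so that its mass is \<open>1\<close> by the
  fundamental theorem of calculus and mass computations need no normalising constant.
\<close>

definition smooth_step :: "real \<Rightarrow> real" where
  "smooth_step x = soft_plus x * inverse (soft_plus x + soft_plus (1 - x))"

definition bump :: "real \<Rightarrow> real" where
  "bump x = (soft_plus_deriv x * soft_plus (1 - x) + soft_plus x * soft_plus_deriv (1 - x))
     / (soft_plus x + soft_plus (1 - x))\<^sup>2"

lemma soft_plus_denominator_pos: "soft_plus x + soft_plus (1 - x) > 0"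
  using soft_plus_simps(2)[of x] soft_plus_simps(2)[of "1 - x"] soft_plus_simps(3)[of x]
    soft_plus_simps(3)[of "1 - x"]
  by (cases "x > 0") (auto intro: add_pos_nonneg add_nonneg_pos)

lemma smooth_step_0: "x \<le> 0 \<Longrightarrow> smooth_step x = 0"
  and smooth_step_1: "x \<ge> 1 \<Longrightarrow> smooth_step x = 1"
  and smooth_step_nonneg: "smooth_step x \<ge> 0"
  and smooth_step_le_1: "smooth_step x \<le> 1"
  using soft_plus_denominator_pos[of x] soft_plus_simps(1)[of x] soft_plus_simps(3)[of x]
    soft_plus_simps(1)[of "1 - x"] soft_plus_simps(3)[of "1 - x"]
  by (auto simp: smooth_step_def field_simps)

lemma smooth_step_has_derivative: "(smooth_step has_real_derivative bump x) (at x)"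
proof -
  have *: "((\<lambda>x. soft_plus (1 - x)) has_real_derivative soft_plus_deriv (1 - x) * (0 - 1)) (at x)"
    by (rule DERIV_chain'[OF DERIV_diff[OF DERIV_const DERIV_ident] soft_plus_has_derivative])
  show ?thesis
    unfolding smooth_step_def[abs_def] divide_inverse[symmetric] bump_def
    using soft_plus_denominator_pos[of x]
    by (intro DERIV_cong[OF DERIV_divide[OF soft_plus_has_derivative
            DERIV_add[OF soft_plus_has_derivative *]]])
      (auto simp: power2_eq_square algebra_simps)
qed

lemma smooth_step_smooth: "smooth smooth_step"
proof -
  have "soft_plus x + soft_plus (1 - x) \<noteq> 0" for x
    using soft_plus_denominator_pos[of x] by simp
  then show ?thesis
    unfolding smooth_step_def[abs_def]
    by (intro smooth_mult smooth_inverse smooth_add smooth_soft_plus smooth_compose[OF smooth_soft_plus]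
        smooth_diff smooth_const smooth_bounded_linear bounded_linear_ident) auto
qed

lemma smooth_bump: "smooth bump"
  by (rule smooth_real_deriv[OF smooth_step_has_derivative smooth_step_smooth])

lemma bump_nonneg: "bump x \<ge> 0"
  by (simp add: bump_def soft_plus_simps)

lemma bump_pos: "0 < x \<Longrightarrow> x < 1 \<Longrightarrow> bump x > 0"
  using soft_plus_denominator_pos[of x] unfolding bump_def
  by (intro divide_pos_pos add_pos_pos mult_pos_pos soft_plus_simps zero_less_power) auto

lemma bump_eq_0: "x \<le> 0 \<or> x \<ge> 1 \<Longrightarrow> bump x = 0"
  by (auto simp: bump_def soft_plus_simps)

lemma continuous_on_bump: "continuous_on A bump"
  using smooth_continuous[OF smooth_bump] continuous_on_subset by blast

lemma bump_bounded: obtains B where "B > 0" "\<And>x. bump x \<le> B"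
proof -
  have "compact (bump ` {0..1})" by (intro compact_continuous_image continuous_on_bump) simp
  then obtain b where b: "\<And>x. x \<in> {0..1} \<Longrightarrow> norm (bump x) \<le> b"
    using compact_imp_bounded bounded_iff by (metis imageI)
  have "bump x \<le> max 1 b" for x
    using b[of x] bump_eq_0[of x] by (cases "x \<in> {0..1}") auto
  then show ?thesis by (intro that[of "max 1 b"]) auto
qed

section \<open>Integration against a measurable family of probability measures\<close>

locale markov_kernel = sigma_finite_measure M for M :: "'a measure" +
  fixes K :: "'a \<Rightarrow> real measure"
  assumes kernel_measurable [measurable]: "K \<in> M \<rightarrow>\<^sub>M subprob_algebra borel"
    and kernel_prob: "\<And>z. z \<in> space M \<Longrightarrow> prob_space (K z)"
    and space_nonempty: "space M \<noteq> {}"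
begin

text \<open>
  The measure \<open>K z (dl) M(dz)\<close> on pairs. It turns iterated integrals against the kernel into
  integrals for a single sigma-finite measure, so that exchanging the order of integration is always
  Fubini's theorem for product measures.
\<close>

definition joint :: "('a \<times> real) measure" where
  "joint = M \<bind> (\<lambda>z. distr (K z) (M \<Otimes>\<^sub>M borel) (Pair z))"

lemma kernel_sets [simp]: "z \<in> space M \<Longrightarrow> sets (K z) = sets borel"
  and kernel_space [simp]: "z \<in> space M \<Longrightarrow> space (K z) = UNIV"
  using sets_kernel[OF kernel_measurable] sets_eq_imp_space_eq[of "K z" borel] by auto

lemma kernel_emeasure_UNIV: "z \<in> space M \<Longrightarrow> emeasure (K z) UNIV = 1"
  using prob_space.emeasure_space_1[OF kernel_prob] by force

lemma sets_joint [simp, measurable_cong]: "sets joint = sets (M \<Otimes>\<^sub>M borel)"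
  and space_joint: "space joint = space M \<times> UNIV"
proof -
  show "sets joint = sets (M \<Otimes>\<^sub>M borel)"
    unfolding joint_def by (rule sets_bind) (auto simp: space_nonempty)
  from sets_eq_imp_space_eq[OF this] show "space joint = space M \<times> UNIV"
    by (simp add: space_pair_measure)
qed

lemma section_measurable:
  assumes "f \<in> borel_measurable (M \<Otimes>\<^sub>M borel)" "z \<in> space M"
  shows "(\<lambda>l. f (z, l)) \<in> borel_measurable (K z)"
proof -
  have "(\<lambda>l. f (z, l)) \<in> borel_measurable borel"
    using assms by (auto intro: measurable_compose[OF measurable_Pair1'])
  then show ?thesis using assms(2) by (simp cong: measurable_cong_sets)
qed

lemma nn_integral_joint:
  assumes f[measurable]: "f \<in> borel_measurable (M \<Otimes>\<^sub>M borel)"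
  shows "(\<integral>\<^sup>+p. f p \<partial>joint) = (\<integral>\<^sup>+z. \<integral>\<^sup>+l. f (z, l) \<partial>K z \<partial>M)"
proof -
  note measurable_distr2[measurable]
  have "(\<integral>\<^sup>+p. f p \<partial>joint)
      = (\<integral>\<^sup>+z. \<integral>\<^sup>+p. f p \<partial>distr (K z) (M \<Otimes>\<^sub>M borel) (Pair z) \<partial>M)"
    unfolding joint_def by (rule nn_integral_bind[OF f]) measurable
  also have "\<dots> = (\<integral>\<^sup>+z. \<integral>\<^sup>+l. f (z, l) \<partial>K z \<partial>M)"
  proof (rule nn_integral_cong)
    fix z assume z: "z \<in> space M"
    have "Pair z \<in> K z \<rightarrow>\<^sub>M M \<Otimes>\<^sub>M borel"
      using z by (auto simp: measurable_Pair1' cong: measurable_cong_sets)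
    then show "(\<integral>\<^sup>+p. f p \<partial>distr (K z) (M \<Otimes>\<^sub>M borel) (Pair z)) = (\<integral>\<^sup>+l. f (z, l) \<partial>K z)"
      by (rule nn_integral_distr) simp
  qed
  finally show ?thesis .
qed

lemma nn_integral_kernel_measurable [measurable]:
  assumes [measurable]: "f \<in> borel_measurable (M \<Otimes>\<^sub>M borel)"
  shows "(\<lambda>z. \<integral>\<^sup>+l. f (z, l) \<partial>K z) \<in> borel_measurable M"
  by (rule nn_integral_measurable_subprob_algebra2[where N=borel]) auto

lemma nn_integral_joint_fst:
  assumes [measurable]: "f \<in> borel_measurable M"
  shows "(\<integral>\<^sup>+p. f (fst p) \<partial>joint) = (\<integral>\<^sup>+z. f z \<partial>M)"
proof -
  have "(\<integral>\<^sup>+p. f (fst p) \<partial>joint) = (\<integral>\<^sup>+z. \<integral>\<^sup>+l. f z \<partial>K z \<partial>M)"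
    by (subst nn_integral_joint) auto
  also have "\<dots> = (\<integral>\<^sup>+z. f z \<partial>M)"
    by (intro nn_integral_cong) (simp add: kernel_emeasure_UNIV)
  finally show ?thesis .
qed

lemma distr_joint_fst: "distr joint M fst = M"
proof (rule measure_eqI)
  fix A assume "A \<in> sets (distr joint M fst)"
  then have A[measurable]: "A \<in> sets M" by simp
  have "emeasure (distr joint M fst) A = (\<integral>\<^sup>+p. indicator A (fst p) \<partial>joint)"
    by (simp add: nn_integral_distr flip: nn_integral_indicator)
  then show "emeasure (distr joint M fst) A = emeasure M A"
    by (simp add: nn_integral_joint_fst)
qed simp

lemma integrable_joint_fst:
  fixes f :: "'a \<Rightarrow> real"
  shows "integrable M f \<Longrightarrow> integrable joint (\<lambda>p. f (fst p))"
  and "f \<in> borel_measurable M \<Longrightarrow> (\<integral>p. f (fst p) \<partial>joint) = (\<integral>z. f z \<partial>M)"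
proof -
  show "integrable joint (\<lambda>p. f (fst p))" if "integrable M f"
    by (rule integrable_distr[of fst joint M f]) (simp_all add: distr_joint_fst that)
  show "(\<integral>p. f (fst p) \<partial>joint) = (\<integral>z. f z \<partial>M)" if "f \<in> borel_measurable M"
    using integral_distr[of fst joint M f] that by (simp add: distr_joint_fst)
qed

lemma sigma_finite_joint: "sigma_finite_measure joint"
proof -
  obtain A :: "nat \<Rightarrow> 'a set" where A: "range A \<subseteq> sets M" "(\<Union>i. A i) = space M"
      "\<And>i. emeasure M (A i) \<noteq> \<infinity>"
    using sigma_finite by blast
  have [measurable]: "A i \<in> sets M" for i using A by auto
  have "emeasure joint (A i \<times> UNIV) = emeasure M (A i)" for i
  proof -
    have "emeasure joint (A i \<times> UNIV) = (\<integral>\<^sup>+p. indicator (A i \<times> UNIV) p \<partial>joint)" by simp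
    also have "\<dots> = (\<integral>\<^sup>+p. indicator (A i) (fst p) \<partial>joint)"
      by (intro nn_integral_cong) (auto split: split_indicator)
    finally show ?thesis by (simp add: nn_integral_joint_fst)
  qed
  then show ?thesis
    using A by (intro sigma_finite_measure.intro exI[of _ "range (\<lambda>i. A i \<times> UNIV)"] conjI)
      (auto simp: space_joint)
qed

text \<open>
  Splitting into positive and negative parts reduces this to nonnegative functions. Fibres on which
  \<open>f\<close> is not integrable form a null set, and there the Bochner integral is \<open>0\<close>; this makes the fibre
  integral a measurable function.
\<close>

lemma
  fixes f :: "'a \<times> real \<Rightarrow> real"
  assumes f: "integrable joint f"
  shows AE_integrable_joint: "AE z in M. integrable (K z) (\<lambda>l. f (z, l))"
    and integrable_integral_joint: "integrable M (\<lambda>z. \<integral>l. f (z, l) \<partial>K z)"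
    and integral_joint: "(\<integral>p. f p \<partial>joint) = (\<integral>z. \<integral>l. f (z, l) \<partial>K z \<partial>M)"
proof -
  have [measurable]: "f \<in> borel_measurable (M \<Otimes>\<^sub>M borel)"
    using borel_measurable_integrable[OF f] by (simp cong: measurable_cong_sets)
  define p where "p z = (\<integral>\<^sup>+l. ennreal (f (z, l)) \<partial>K z)" for z
  define n where "n z = (\<integral>\<^sup>+l. ennreal (- f (z, l)) \<partial>K z)" for z
  have [measurable]: "p \<in> borel_measurable M" "n \<in> borel_measurable M"
    unfolding p_def n_def by measurable
  have P: "(\<integral>\<^sup>+x. ennreal (f x) \<partial>joint) = (\<integral>\<^sup>+z. p z \<partial>M)"
    and N: "(\<integral>\<^sup>+x. ennreal (- f x) \<partial>joint) = (\<integral>\<^sup>+z. n z \<partial>M)"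
    unfolding p_def n_def by (auto intro!: nn_integral_joint)
  have fin: "(\<integral>\<^sup>+z. p z \<partial>M) \<noteq> \<infinity>" "(\<integral>\<^sup>+z. n z \<partial>M) \<noteq> \<infinity>"
    using f unfolding real_integrable_def by (simp_all add: P N)
  have ae: "AE z in M. p z \<noteq> \<infinity> \<and> n z \<noteq> \<infinity> \<and> z \<in> space M"
    using nn_integral_PInf_AE[OF _ fin(1)] nn_integral_PInf_AE[OF _ fin(2)] AE_space by auto
  have fibre: "integrable (K z) (\<lambda>l. f (z, l)) \<and>
      (\<integral>l. f (z, l) \<partial>K z) = enn2real (p z) - enn2real (n z)"
    if "p z \<noteq> \<infinity> \<and> n z \<noteq> \<infinity> \<and> z \<in> space M" for z
  proof -
    have "integrable (K z) (\<lambda>l. f (z, l))"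
      using that section_measurable[of f z] by (simp add: real_integrable_def p_def n_def)
    then show ?thesis by (simp add: real_lebesgue_integral_def p_def n_def)
  qed
  have "(\<integral>l. f (z, l) \<partial>K z) = (if p z \<noteq> \<infinity> \<and> n z \<noteq> \<infinity> then enn2real (p z) - enn2real (n z) else 0)"
    if "z \<in> space M" for z
  proof (cases "p z \<noteq> \<infinity> \<and> n z \<noteq> \<infinity>")
    case False
    then have "\<not> integrable (K z) (\<lambda>l. f (z, l))" by (simp add: real_integrable_def p_def n_def)
    with False show ?thesis by (auto simp: not_integrable_integral_eq)
  qed (use fibre that in auto)
  then have "(\<lambda>z. \<integral>l. f (z, l) \<partial>K z) \<in> borel_measurable M \<longleftrightarrow>
      (\<lambda>z. if p z \<noteq> \<infinity> \<and> n z \<noteq> \<infinity> then enn2real (p z) - enn2real (n z) else 0) \<in> borel_measurable M"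
    by (rule measurable_cong)
  then have [measurable]: "(\<lambda>z. \<integral>l. f (z, l) \<partial>K z) \<in> borel_measurable M" by simp
  show "AE z in M. integrable (K z) (\<lambda>l. f (z, l))"
    using ae by eventually_elim (use fibre in blast)
  have real: "integrable M (\<lambda>z. enn2real (g z))
      \<and> (\<integral>z. enn2real (g z) \<partial>M) = enn2real (\<integral>\<^sup>+z. g z \<partial>M)"
    if [measurable]: "g \<in> borel_measurable M" and g: "(\<integral>\<^sup>+z. g z \<partial>M) \<noteq> \<infinity>" for g
  proof -
    have *: "(\<integral>\<^sup>+z. ennreal (enn2real (g z)) \<partial>M) = (\<integral>\<^sup>+z. g z \<partial>M)"
      using nn_integral_PInf_AE[OF _ g] by (intro nn_integral_cong_AE) (auto simp: top.not_eq_extremum)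
    then have "integrable M (\<lambda>z. enn2real (g z))"
      using g by (intro integrableI_nonneg) (auto simp: top.not_eq_extremum)
    then show ?thesis using * by (simp add: integral_eq_nn_integral)
  qed
  note rp = real[OF _ fin(1)] and rn = real[OF _ fin(2)]
  have int: "integrable M (\<lambda>z. enn2real (p z) - enn2real (n z))" using rp rn by auto
  have ae2: "AE z in M. (\<integral>l. f (z, l) \<partial>K z) = enn2real (p z) - enn2real (n z)"
    using ae by eventually_elim (use fibre in blast)
  show "integrable M (\<lambda>z. \<integral>l. f (z, l) \<partial>K z)"
    using int by (rule integrable_cong_AE_imp) (use ae2 in auto)
  have "(\<integral>z. \<integral>l. f (z, l) \<partial>K z \<partial>M) = (\<integral>z. enn2real (p z) - enn2real (n z) \<partial>M)"
    using ae2 by (intro integral_cong_AE) auto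
  also have "\<dots> = (\<integral>x. f x \<partial>joint)"
    using rp rn by (simp add: real_lebesgue_integral_def[OF f] P N)
  finally show "(\<integral>p. f p \<partial>joint) = (\<integral>z. \<integral>l. f (z, l) \<partial>K z \<partial>M)" by simp
qed

end

text \<open>
  A Young measure is measurable against \<open>C\<^sub>0\<close> functions by definition. Half-lines generate the Borel sets, and
  their indicators are bounded limits of \<open>C\<^sub>0\<close> functions, so it is a measurable kernel.
\<close>

lemma atMost_indicator_limit_C0:
  obtains g :: "nat \<Rightarrow> real \<Rightarrow> real" where "\<And>n. g n \<in> C0_real" "\<And>n x. \<bar>g n x\<bar> \<le> 1"
    "\<And>x. (\<lambda>n. g n x) \<longlonglongrightarrow> indicator {..a} x"
proof -
  define g where "g n x = max 0 (1 - real n * max 0 (x - a)) * max 0 (1 - max 0 (\<bar>x\<bar> - real n))" for n x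
  show ?thesis
  proof
    show "g n \<in> C0_real" for n
    proof -
      have "eventually (\<lambda>x. g n x = 0) at_infinity"
        unfolding eventually_at_infinity by (rule exI[of _ "real n + 1"]) (auto simp: g_def)
      moreover have "continuous_on UNIV (g n)"
        unfolding g_def by (intro continuous_intros)
      ultimately show ?thesis by (simp add: C0_real_def tendsto_eventually)
    qed
    show "\<bar>g n x\<bar> \<le> 1" for n x
      unfolding g_def abs_mult by (rule mult_le_one) auto
    show "(\<lambda>n. g n x) \<longlonglongrightarrow> indicator {..a} x" for x
    proof (rule tendsto_eventually)
      obtain m where m: "real m \<ge> \<bar>x\<bar>" using real_arch_simple by blast
      obtain m' where m': "x > a \<Longrightarrow> real m' * (x - a) \<ge> 1"
        using reals_Archimedean3[of "x - a"] by (metis diff_gt_0_iff_gt less_eq_real_def)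
      show "\<forall>\<^sub>F n in sequentially. g n x = indicator {..a} x"
        using eventually_ge_at_top[of m] eventually_ge_at_top[of m']
      proof eventually_elim
        case (elim n)
        have "real n * (x - a) \<ge> 1" if "x > a"
        proof -
          have "real m' * (x - a) \<le> real n * (x - a)"
            using elim that by (intro mult_right_mono) auto
          with m'[OF that] show ?thesis by linarith
        qed
        with elim m show ?case by (auto simp: g_def split: split_indicator)
      qed
    qed
  qed
qed

lemma young_measure_kernel:
  fixes \<nu> :: "(real ^ 'd) \<times> real \<Rightarrow> real measure"
  assumes "young_measure \<nu>"
  shows "\<nu> \<in> lebesgue_on spacetime \<rightarrow>\<^sub>M subprob_algebra borel"
proof (rule measurable_subprob_algebra_generated[where \<Omega>=UNIV and G="range (\<lambda>a::real. {..a})"])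
  let ?L = "lebesgue_on spacetime :: ((real ^ 'd) \<times> real) measure"
  have \<nu>: "prob_space (\<nu> z)" "sets (\<nu> z) = sets borel" if "z \<in> space ?L" for z
    using assms that by (auto simp: young_measure_def)
  have [simp]: "space (\<nu> z) = UNIV" if "z \<in> space ?L" for z
    using sets_eq_imp_space_eq[OF \<nu>(2)[OF that]] by simp
  show "sets (borel :: real measure) = sigma_sets UNIV (range (\<lambda>a::real. {..a}))"
    by (simp add: borel_eq_atMost)
  show "Int_stable (range (\<lambda>a::real. {..a}))"
    by (auto simp: Int_stable_def intro!: image_eqI[of _ _ "min _ _"])
  show "subprob_space (\<nu> z)" "sets (\<nu> z) = sets borel" if "z \<in> space ?L" for z
    using \<nu>[OF that] by (auto intro: prob_space_imp_subprob_space)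
  have one: "emeasure (\<nu> z) UNIV = 1" if "z \<in> space ?L" for z
    using prob_space.emeasure_space_1[OF \<nu>(1)[OF that]] that by force
  show "(\<lambda>z. emeasure (\<nu> z) UNIV) \<in> borel_measurable ?L"
    by (subst measurable_cong[OF one]) auto
  fix A assume "A \<in> range (\<lambda>a::real. {..a})"
  then obtain a where A: "A = {..a}" by auto
  obtain g where g: "\<And>n. g n \<in> C0_real" "\<And>n x. \<bar>g n x\<bar> \<le> (1::real)"
    "\<And>x. (\<lambda>n. g n x) \<longlonglongrightarrow> indicator {..a} x"
    using atMost_indicator_limit_C0[of a] by blast
  have [measurable]: "g n \<in> borel_measurable borel" for n
    using g(1)[of n] by (auto simp: C0_real_def intro: borel_measurable_continuous_onI)
  have "(\<lambda>z. measure (\<nu> z) A) \<in> borel_measurable ?L"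
  proof (rule borel_measurable_LIMSEQ_real)
    show "(\<lambda>z. \<integral>l. g n l \<partial>\<nu> z) \<in> borel_measurable ?L" for n
      using assms g(1)[of n] by (auto simp: young_measure_def)
    fix z assume z: "z \<in> space ?L"
    interpret prob_space "\<nu> z" using \<nu>(1)[OF z] .
    note [measurable_cong] = \<nu>(2)[OF z]
    have "(\<lambda>n. \<integral>l. g n l \<partial>\<nu> z) \<longlonglongrightarrow> (\<integral>l. indicator A l \<partial>\<nu> z)"
      by (rule integral_dominated_convergence[where w="\<lambda>_. 1"])
        (use g(2,3) in \<open>auto simp: A\<close>)
    then show "(\<lambda>n. \<integral>l. g n l \<partial>\<nu> z) \<longlonglongrightarrow> measure (\<nu> z) A"
      using z by (simp add: A)
  qed
  then have "(\<lambda>z. ennreal (measure (\<nu> z) A)) \<in> borel_measurable ?L" by simp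
  moreover have "ennreal (measure (\<nu> z) A) = emeasure (\<nu> z) A" if "z \<in> space ?L" for z
  proof -
    interpret prob_space "\<nu> z" using \<nu>(1)[OF that] .
    show ?thesis by (simp add: emeasure_eq_measure)
  qed
  ultimately show "(\<lambda>z. emeasure (\<nu> z) A) \<in> borel_measurable ?L"
    by (rule measurable_cong[THEN iffD1, rotated])
qed auto

lemma torus_borel [measurable]: "torus \<in> sets borel"
proof -
  have "torus = (\<Inter>i. {x :: real ^ 'd. 0 \<le> x $ i} \<inter> {x. x $ i < 2 * pi})" by (auto simp: torus_def)
  also have "\<dots> \<in> sets borel"
    by (intro sets.countable_INT'' sets.Int borel_closed borel_open
        closed_halfspace_component_ge_cart open_halfspace_component_lt_cart) simp_all
  finally show ?thesis .
qed

lemma spacetime_borel [measurable]: "spacetime \<in> sets borel"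
  unfolding spacetime_def by (intro borel_Times) auto

lemma torus_bounded: "bounded torus" "torus \<subseteq> cbox 0 (\<chi> i. 2 * pi)"
proof -
  show "torus \<subseteq> cbox 0 (\<chi> i. 2 * pi)" by (auto simp: torus_def mem_box_cart less_imp_le)
  then show "bounded torus" by (rule bounded_subset[OF bounded_cbox])
qed

lemma sigma_finite_lebesgue_on:
  "S \<in> sets lebesgue \<Longrightarrow> sigma_finite_measure (lebesgue_on S)" for S :: "'a::euclidean_space set"
proof (rule sigma_finite_measure_restrict_space)
  show "sigma_finite_measure (lebesgue :: 'a measure)"
  proof (intro sigma_finite_measure.intro exI[of _ "range (\<lambda>n. cball (0 :: 'a) (real n))"] conjI)
    show "\<Union> (range (\<lambda>n. cball (0 :: 'a) (real n))) = space lebesgue"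
      by (simp add: set_eq_iff real_arch_simple)
    show "\<forall>a\<in>range (\<lambda>n. cball (0 :: 'a) (real n)). emeasure lebesgue a \<noteq> \<infinity>"
      using emeasure_bounded_finite[OF bounded_cball[of "0::'a"]] by (simp add: less_top)
    show "countable (range (\<lambda>n. cball (0 :: 'a) (real n)))" by simp
    show "range (\<lambda>n. cball (0 :: 'a) (real n)) \<subseteq> sets lebesgue"
      by (rule image_subsetI) simp
  qed
qed

lemma young_measure_markov_kernel:
  fixes \<nu> :: "(real ^ 'd) \<times> real \<Rightarrow> real measure"
  assumes "young_measure \<nu>"
  shows "markov_kernel (lebesgue_on spacetime) \<nu>"
proof -
  have "(0, 0) \<in> (spacetime :: ((real ^ 'd) \<times> real) set)"
    by (simp add: spacetime_def torus_def)
  then have ne: "space (lebesgue_on spacetime :: ((real ^ 'd) \<times> real) measure) \<noteq> {}"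
    by (simp only: space_lebesgue_on) blast
  have "prob_space (\<nu> z)" if "z \<in> space (lebesgue_on spacetime)" for z
    using assms that unfolding young_measure_def space_lebesgue_on by blast
  moreover have "sigma_finite_measure (lebesgue_on spacetime :: ((real ^ 'd) \<times> real) measure)"
    by (rule sigma_finite_lebesgue_on) simp
  ultimately show ?thesis
    by (intro markov_kernel.intro markov_kernel_axioms.intro young_measure_kernel[OF assms] ne)
qed

section \<open>Approximate identities\<close>

lemma borel_measurable_lebesgue_on:
  "f \<in> borel_measurable borel \<Longrightarrow> f \<in> borel_measurable (lebesgue_on S)"
  by (intro measurable_restrict_space1 measurable_completion) simp

text \<open>
  After a truncation the function is bounded. A bounded measurable function is almost everywhere the limit
  of continuous ones, and clipping these to the same bound makes dominated convergence applicable on the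
  set of finite measure.
\<close>

lemma L1_continuous_approx:
  fixes b :: "'a::euclidean_space \<Rightarrow> real"
  assumes X: "X \<in> sets lebesgue" "emeasure lebesgue X < \<infinity>"
    and b: "integrable (lebesgue_on X) b" and e: "e > 0"
  obtains v B where "continuous_on UNIV v" "\<And>x. \<bar>v x\<bar> \<le> B"
    "(\<integral>\<^sup>+x. ennreal \<bar>b x - v x\<bar> \<partial>lebesgue_on X) < ennreal e"
proof -
  let ?L = "lebesgue_on X"
  interpret finite_measure ?L
    using X by (intro finite_measureI) (simp add: emeasure_restrict_space)
  define clip :: "real \<Rightarrow> real \<Rightarrow> real" where "clip m x = max (- m) (min m x)" for m x
  have clip_le: "\<bar>clip m x\<bar> \<le> m" if "m \<ge> 0" for m x using that by (auto simp: clip_def)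
  have clip_mono: "\<bar>clip m x\<bar> \<le> \<bar>x\<bar>" if "m \<ge> 0" for m x using that by (auto simp: clip_def)
  have clip_cont: "continuous_on UNIV (clip m)" for m
    unfolding clip_def by (intro continuous_intros)
  have [measurable]: "clip m \<in> borel_measurable borel" for m
    by (intro borel_measurable_continuous_onI clip_cont)
  note [measurable] = borel_measurable_integrable[OF b]
  have "(\<lambda>m. \<integral>x. \<bar>b x - clip (real m) (b x)\<bar> \<partial>?L) \<longlonglongrightarrow> (\<integral>x. 0 \<partial>?L)"
  proof (rule integral_dominated_convergence[where w="\<lambda>x. 2 * \<bar>b x\<bar>"])
    show "AE x in ?L. (\<lambda>m. \<bar>b x - clip (real m) (b x)\<bar>) \<longlonglongrightarrow> 0"
    proof (rule AE_I2, rule tendsto_eventually)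
      fix x
      obtain m where "real m \<ge> \<bar>b x\<bar>" using real_arch_simple by blast
      then show "\<forall>\<^sub>F m in sequentially. \<bar>b x - clip (real m) (b x)\<bar> = 0"
        by (intro eventually_sequentiallyI[of m]) (auto simp: clip_def)
    qed
    show "AE x in ?L. norm \<bar>b x - clip (real m) (b x)\<bar> \<le> 2 * \<bar>b x\<bar>" for m
      by (rule AE_I2) (use clip_mono[of "real m"] in \<open>smt (verit) of_nat_0_le_iff real_norm_def\<close>)
  qed (use b in auto)
  then have "\<forall>\<^sub>F m in sequentially. (\<integral>x. \<bar>b x - clip (real m) (b x)\<bar> \<partial>?L) < e / 2"
    by (rule order_tendstoD) (use e in simp)
  then obtain m :: nat where m: "(\<integral>x. \<bar>b x - clip (real m) (b x)\<bar> \<partial>?L) < e / 2"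
    using eventually_happens'[OF sequentially_bot] by blast
  define c where "c x = clip (real m) (b x)" for x
  have [measurable]: "c \<in> borel_measurable ?L" unfolding c_def by measurable
  then have "c measurable_on X" using X by (simp add: measurable_on_iff_borel_measurable)
  then obtain N g where N: "negligible N" and g: "\<And>n. continuous_on UNIV (g n)"
      "\<And>x. x \<notin> N \<Longrightarrow> (\<lambda>n. g n x) \<longlonglongrightarrow> (if x \<in> X then c x else 0)"
    unfolding measurable_on_def by blast
  define v where "v n x = clip (real m) (g n x)" for n x
  have v_cont: "continuous_on UNIV (v n)" for n
    unfolding v_def using continuous_on_compose2[OF clip_cont g(1)] by simp
  then have [measurable]: "v n \<in> borel_measurable ?L" for n
    by (intro borel_measurable_lebesgue_on borel_measurable_continuous_onI)
  have "N \<in> null_sets lebesgue" using N by (simp add: negligible_iff_null_sets)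
  then have "AE x in lebesgue. x \<notin> N" by (rule AE_not_in)
  then have ae: "AE x in ?L. x \<notin> N \<and> x \<in> X"
    using X(1) by (simp add: AE_restrict_space_iff) (auto elim: eventually_mono)
  have "(\<lambda>n. \<integral>x. \<bar>c x - v n x\<bar> \<partial>?L) \<longlonglongrightarrow> (\<integral>x. 0 \<partial>?L)"
  proof (rule integral_dominated_convergence[where w="\<lambda>x. 2 * real m"])
    show "AE x in ?L. (\<lambda>n. \<bar>c x - v n x\<bar>) \<longlonglongrightarrow> 0"
      using ae
    proof eventually_elim
      case (elim x)
      have "(\<lambda>n. \<bar>c x - v n x\<bar>) \<longlonglongrightarrow> \<bar>c x - clip (real m) (c x)\<bar>"
        unfolding v_def using elim g(2)[of x]
        by (intro tendsto_intros continuous_on_tendsto_compose[OF clip_cont]) auto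
      also have "clip (real m) (c x) = c x" by (auto simp: c_def clip_def)
      finally show ?case by simp
    qed
    show "AE x in ?L. norm \<bar>c x - v n x\<bar> \<le> 2 * real m" for n
    proof (rule AE_I2)
      fix x
      show "norm \<bar>c x - v n x\<bar> \<le> 2 * real m"
        using clip_le[of "real m" "b x"] clip_le[of "real m" "g n x"] by (simp add: c_def v_def)
    qed
  qed auto
  then have "\<forall>\<^sub>F n in sequentially. (\<integral>x. \<bar>c x - v n x\<bar> \<partial>?L) < e / 2"
    by (rule order_tendstoD) (use e in simp)
  then obtain n where n: "(\<integral>x. \<bar>c x - v n x\<bar> \<partial>?L) < e / 2"
    using eventually_happens'[OF sequentially_bot] by blast
  have vi: "integrable ?L (v n)"
    by (rule integrable_const_bound[where B="real m"]) (auto simp: v_def clip_le)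
  have ci: "integrable ?L c"
    by (rule integrable_const_bound[where B="real m"]) (auto simp: c_def clip_le)
  have "(\<integral>x. \<bar>b x - v n x\<bar> \<partial>?L) \<le> (\<integral>x. \<bar>b x - c x\<bar> + \<bar>c x - v n x\<bar> \<partial>?L)"
    using vi ci b by (intro integral_mono) auto
  also have "\<dots> = (\<integral>x. \<bar>b x - c x\<bar> \<partial>?L) + (\<integral>x. \<bar>c x - v n x\<bar> \<partial>?L)"
    using vi ci b by (intro Bochner_Integration.integral_add) auto
  also have "\<dots> < e" using m n by (simp add: c_def)
  finally have "(\<integral>x. \<bar>b x - v n x\<bar> \<partial>?L) < e" .
  then have "(\<integral>\<^sup>+x. ennreal \<bar>b x - v n x\<bar> \<partial>?L) < ennreal e"
    using vi b e by (subst nn_integral_eq_integral) (auto intro!: ennreal_lessI)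
  then show ?thesis
    by (intro that[of "v n" "real m"] v_cont) (auto simp: v_def clip_le)
qed

lemma tendsto_0_ennrealI:
  fixes F :: "nat \<Rightarrow> ennreal"
  assumes "\<And>e::real. e > 0 \<Longrightarrow> \<forall>\<^sub>F n in sequentially. F n \<le> ennreal e"
  shows "F \<longlonglongrightarrow> 0"
proof (rule order_tendstoI)
  fix a :: ennreal assume a: "0 < a"
  obtain c where c: "0 < c" "c < a" using dense[OF a] by blast
  then obtain e where e: "c = ennreal e" "e > 0"
    by (cases c) (auto simp: ennreal_less_zero_iff)
  show "\<forall>\<^sub>F n in sequentially. F n < a"
    using assms[OF e(2)] by eventually_elim (use c e in \<open>metis le_less_trans\<close>)
qed simp

text \<open>
  For continuous bounded \<open>b\<close> the inner integral tends to zero pointwise; the two mass bounds let the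
  error of an \<open>L\<^sup>1\<close> approximation of \<open>b\<close> pass through the kernel. Concentration is asked for almost
  every \<open>z\<close> and only towards points of \<open>X\<close>: in this form a periodic kernel satisfies it on the half-open
  cell, since an interior point of the cell is close modulo periods only to nearby points of the cell.
\<close>

lemma approximate_identity_L1:
  fixes K :: "nat \<Rightarrow> 'a::euclidean_space \<Rightarrow> 'a \<Rightarrow> ennreal"
  assumes X: "X \<in> sets lebesgue" "emeasure lebesgue X < \<infinity>"
    and K [measurable]: "\<And>n. (\<lambda>(z, w). K n z w) \<in> borel_measurable (lebesgue_on X \<Otimes>\<^sub>M lebesgue_on X)"
    and K1: "\<And>n z. z \<in> X \<Longrightarrow> (\<integral>\<^sup>+w. K n z w \<partial>lebesgue_on X) \<le> 1"
    and K2: "\<And>n w. w \<in> X \<Longrightarrow> (\<integral>\<^sup>+z. K n z w \<partial>lebesgue_on X) \<le> 1"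
    and conc: "AE z in lebesgue_on X. \<forall>r>0. \<forall>\<^sub>F n in sequentially. \<forall>w\<in>X. K n z w \<noteq> 0 \<longrightarrow> dist z w < r"
    and b: "integrable (lebesgue_on X) b"
  shows "(\<lambda>n. \<integral>\<^sup>+z. \<integral>\<^sup>+w. K n z w * ennreal \<bar>b z - b w\<bar> \<partial>lebesgue_on X \<partial>lebesgue_on X) \<longlonglongrightarrow> 0"
proof (rule tendsto_0_ennrealI)
  fix e :: real assume e: "e > 0"
  let ?L = "lebesgue_on X"
  interpret finite_measure ?L
    using X by (intro finite_measureI) (simp add: emeasure_restrict_space)
  interpret P: pair_sigma_finite ?L ?L ..
  note [measurable] = borel_measurable_integrable[OF b]
  obtain v B where v: "continuous_on UNIV v" "\<And>x. \<bar>v x\<bar> \<le> B"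
    "(\<integral>\<^sup>+x. ennreal \<bar>b x - v x\<bar> \<partial>?L) < ennreal (e / 3)"
    using L1_continuous_approx[OF X b, of "e / 3"] e by auto
  have [measurable]: "v \<in> borel_measurable ?L"
    by (intro borel_measurable_lebesgue_on borel_measurable_continuous_onI v)
  have [measurable]: "(\<lambda>w. K n z w) \<in> borel_measurable ?L" if "z \<in> space ?L" for n z
    using measurable_Pair2[OF K that, of n] by simp
  have [measurable]: "(\<lambda>z. K n z w) \<in> borel_measurable ?L" if "w \<in> space ?L" for n w
    using measurable_Pair1[OF K that, of n] by simp
  define F where "F n z = (\<integral>\<^sup>+w. K n z w * ennreal \<bar>v z - v w\<bar> \<partial>?L)" for n z
  have [measurable]: "F n \<in> borel_measurable ?L" for n
    unfolding F_def by measurable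
  have B: "0 \<le> B" using v(2)[of undefined] by simp
  have F_le: "F n z \<le> ennreal (2 * B)" if "z \<in> X" for n z
  proof -
    have "F n z \<le> (\<integral>\<^sup>+w. K n z w * ennreal (2 * B) \<partial>?L)"
      unfolding F_def
    proof (intro nn_integral_mono mult_left_mono ennreal_leI)
      fix w show "\<bar>v z - v w\<bar> \<le> 2 * B" using v(2)[of z] v(2)[of w] by linarith
    qed simp
    also have "\<dots> = (\<integral>\<^sup>+w. K n z w \<partial>?L) * ennreal (2 * B)"
      using that by (intro nn_integral_multc) auto
    also have "\<dots> \<le> 1 * ennreal (2 * B)" using K1[OF that] by (intro mult_right_mono) auto
    finally show ?thesis by simp
  qed
  have "(\<lambda>n. \<integral>\<^sup>+z. F n z \<partial>?L) \<longlonglongrightarrow> (\<integral>\<^sup>+z. 0 \<partial>?L)"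
  proof (rule nn_integral_dominated_convergence[where w="\<lambda>_. ennreal (2 * B)"])
    show "(\<integral>\<^sup>+z. ennreal (2 * B) \<partial>?L) < \<infinity>"
      using X by (simp add: ennreal_mult_less_top emeasure_restrict_space)
    show "AE z in ?L. F n z \<le> ennreal (2 * B)" for n
      by (rule AE_I2) (use F_le in simp)
    show "AE z in ?L. (\<lambda>n. F n z) \<longlonglongrightarrow> 0"
      using conc AE_space
    proof eventually_elim
      case (elim z)
      then have z: "z \<in> X" by simp
      show ?case
      proof (rule tendsto_0_ennrealI)
        fix d :: real assume "d > 0"
        moreover have "isCont v z" using v(1) by (simp add: continuous_on_eq_continuous_at)
        ultimately obtain r where r: "r > 0" "\<And>w. dist w z < r \<Longrightarrow> dist (v w) (v z) < d"
          unfolding continuous_at_eps_delta by blast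
        have "\<forall>\<^sub>F n in sequentially. \<forall>w\<in>X. K n z w \<noteq> 0 \<longrightarrow> dist z w < r" using elim r by blast
        then show "\<forall>\<^sub>F n in sequentially. F n z \<le> ennreal d"
        proof eventually_elim
          case (elim n)
          have "F n z \<le> (\<integral>\<^sup>+w. K n z w * ennreal d \<partial>?L)"
            unfolding F_def
          proof (rule nn_integral_mono)
            fix w assume "w \<in> space ?L"
            then have w: "w \<in> X" by simp
            show "K n z w * ennreal \<bar>v z - v w\<bar> \<le> K n z w * ennreal d"
            proof (cases "K n z w = 0")
              case False
              then have "dist (v w) (v z) < d" using elim w r(2)[of w] by (simp add: dist_commute)
              then show ?thesis
                by (intro mult_left_mono ennreal_leI) (auto simp: dist_real_def)
            qed simp
          qed
          also have "\<dots> = (\<integral>\<^sup>+w. K n z w \<partial>?L) * ennreal d"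
            using z by (intro nn_integral_multc) auto
          also have "\<dots> \<le> 1 * ennreal d" using K1[OF z] by (intro mult_right_mono) auto
          finally show ?case by simp
        qed
      qed
    qed
  qed auto
  then have "\<forall>\<^sub>F n in sequentially. (\<integral>\<^sup>+z. F n z \<partial>?L) < ennreal (e / 3)"
    by (rule order_tendstoD) (use e in simp)
  then show "\<forall>\<^sub>F n in sequentially. (\<integral>\<^sup>+z. \<integral>\<^sup>+w. K n z w * ennreal \<bar>b z - b w\<bar> \<partial>?L \<partial>?L) \<le> ennreal e"
  proof eventually_elim
    case (elim n)
    define R where "R x = ennreal \<bar>b x - v x\<bar>" for x
    have [measurable]: "R \<in> borel_measurable ?L" unfolding R_def by measurable
    have "(\<integral>\<^sup>+z. \<integral>\<^sup>+w. K n z w * ennreal \<bar>b z - b w\<bar> \<partial>?L \<partial>?L)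
       \<le> (\<integral>\<^sup>+z. \<integral>\<^sup>+w. K n z w * R z + K n z w * ennreal \<bar>v z - v w\<bar> + K n z w * R w \<partial>?L \<partial>?L)"
    proof (intro nn_integral_mono)
      fix z w
      have "ennreal \<bar>b z - b w\<bar> \<le> R z + ennreal \<bar>v z - v w\<bar> + R w"
        unfolding R_def by (subst ennreal_plus[symmetric], simp, simp)+ (intro ennreal_leI, linarith)
      then have "K n z w * ennreal \<bar>b z - b w\<bar> \<le> K n z w * (R z + ennreal \<bar>v z - v w\<bar> + R w)"
        by (rule mult_left_mono) simp
      then show "K n z w * ennreal \<bar>b z - b w\<bar> \<le>
          K n z w * R z + K n z w * ennreal \<bar>v z - v w\<bar> + K n z w * R w"
        by (simp add: distrib_left)
    qed
    also have "\<dots> = (\<integral>\<^sup>+z. (\<integral>\<^sup>+w. K n z w * R z \<partial>?L) + F n z + (\<integral>\<^sup>+w. K n z w * R w \<partial>?L) \<partial>?L)"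
      unfolding F_def by (intro nn_integral_cong) (simp add: nn_integral_add)
    also have "\<dots> = (\<integral>\<^sup>+z. \<integral>\<^sup>+w. K n z w * R z \<partial>?L \<partial>?L) + (\<integral>\<^sup>+z. F n z \<partial>?L) + (\<integral>\<^sup>+z. \<integral>\<^sup>+w. K n z w * R w \<partial>?L \<partial>?L)"
      by (simp add: nn_integral_add)
    also have "(\<integral>\<^sup>+z. \<integral>\<^sup>+w. K n z w * R w \<partial>?L \<partial>?L) = (\<integral>\<^sup>+w. \<integral>\<^sup>+z. K n z w * R w \<partial>?L \<partial>?L)"
      by (rule P.Fubini'[symmetric]) simp
    also have "(\<integral>\<^sup>+w. \<integral>\<^sup>+z. K n z w * R w \<partial>?L \<partial>?L) \<le> (\<integral>\<^sup>+w. R w \<partial>?L)"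
    proof (rule nn_integral_mono)
      fix w assume "w \<in> space ?L"
      then have "(\<integral>\<^sup>+z. K n z w * R w \<partial>?L) = (\<integral>\<^sup>+z. K n z w \<partial>?L) * R w"
        by (intro nn_integral_multc) auto
      also have "\<dots> \<le> 1 * R w" using K2[of w n] \<open>w \<in> space ?L\<close> by (intro mult_right_mono) auto
      finally show "(\<integral>\<^sup>+z. K n z w * R w \<partial>?L) \<le> R w" by simp
    qed
    also have "(\<integral>\<^sup>+z. \<integral>\<^sup>+w. K n z w * R z \<partial>?L \<partial>?L) \<le> (\<integral>\<^sup>+z. R z \<partial>?L)"
    proof (rule nn_integral_mono)
      fix z assume "z \<in> space ?L"
      then have "(\<integral>\<^sup>+w. K n z w * R z \<partial>?L) = (\<integral>\<^sup>+w. K n z w \<partial>?L) * R z"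
        by (intro nn_integral_multc) auto
      also have "\<dots> \<le> 1 * R z" using K1[of z n] \<open>z \<in> space ?L\<close> by (intro mult_right_mono) auto
      finally show "(\<integral>\<^sup>+w. K n z w * R z \<partial>?L) \<le> R z" by simp
    qed
    also have "(\<integral>\<^sup>+z. R z \<partial>?L) + (\<integral>\<^sup>+z. F n z \<partial>?L) + (\<integral>\<^sup>+z. R z \<partial>?L) \<le> ennreal (e/3) + ennreal (e/3) + ennreal (e/3)"
      using elim v(3) unfolding R_def by (intro add_mono less_imp_le)
    also have "\<dots> = ennreal e" using e by (simp flip: ennreal_plus)
    finally show ?case by (simp add: add_left_mono add_right_mono)
  qed
qed

section \<open>Integration over the torus\<close>

definition periodic :: "(real ^ 'd \<Rightarrow> 'b) \<Rightarrow> bool" where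
  "periodic h \<longleftrightarrow> (\<forall>x i. h (x + (2 * pi) *\<^sub>R axis i 1) = h x)"

lemma nn_integral_lborel_shift:
  fixes h :: "'a::euclidean_space \<Rightarrow> ennreal"
  assumes [measurable]: "h \<in> borel_measurable borel"
  shows "(\<integral>\<^sup>+x. h (x + c) \<partial>lborel) = (\<integral>\<^sup>+x. h x \<partial>lborel)"
proof -
  have "(\<integral>\<^sup>+x. h x \<partial>lborel) = (\<integral>\<^sup>+x. h x \<partial>distr lborel borel ((+) c))"
    by (simp add: lborel_distr_plus)
  also have "\<dots> = (\<integral>\<^sup>+x. h (c + x) \<partial>lborel)"
    by (subst nn_integral_distr) auto
  finally show ?thesis by (simp add: add.commute)
qed

text \<open>
  A shift moves the slab \<open>x\<^sub>i \<ge> 2\<pi> - a\<close> of the cell out of it and the period brings it back in.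
\<close>

lemma torus_nn_integral_shift_coordinate:
  fixes h :: "real ^ 'd \<Rightarrow> ennreal"
  assumes [measurable]: "h \<in> borel_measurable borel" and per: "periodic h"
    and a: "0 \<le> a" "a < 2 * pi"
  shows "(\<integral>\<^sup>+x. h (x - a *\<^sub>R axis i 1) * indicator torus x \<partial>lborel)
    = (\<integral>\<^sup>+x. h x * indicator torus x \<partial>lborel)"
proof -
  let ?e = "axis i 1 :: real ^ 'd"
  define A where "A = torus \<inter> {x :: real ^ 'd. x $ i < 2 * pi - a}"
  define B where "B = torus \<inter> {x :: real ^ 'd. x $ i \<ge> 2 * pi - a}"
  have "{x :: real ^ 'd. x $ i < 2 * pi - a} \<in> sets borel" "{x :: real ^ 'd. x $ i \<ge> 2 * pi - a} \<in> sets borel"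
    by (auto intro!: borel_open borel_closed open_Collect_less closed_Collect_le continuous_intros)
  then have [measurable]: "A \<in> sets borel" "B \<in> sets borel" unfolding A_def B_def by auto
  have "(\<integral>\<^sup>+x. h (x - a *\<^sub>R ?e) * indicator torus x \<partial>lborel)
      = (\<integral>\<^sup>+x. h (x + a *\<^sub>R ?e - a *\<^sub>R ?e) * indicator torus (x + a *\<^sub>R ?e) \<partial>lborel)"
    by (rule nn_integral_lborel_shift[symmetric]) measurable
  also have "\<dots> = (\<integral>\<^sup>+x. h x * indicator A x + h x * indicator B (x + (2 * pi) *\<^sub>R ?e) \<partial>lborel)"
  proof (rule nn_integral_cong)
    fix x :: "real ^ 'd"
    have "indicator torus (x + a *\<^sub>R ?e) = (indicator A x + indicator B (x + (2 * pi) *\<^sub>R ?e) :: ennreal)"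
    proof -
      have t: "x + c *\<^sub>R ?e \<in> torus \<longleftrightarrow> (\<forall>j. j \<noteq> i \<longrightarrow> 0 \<le> x $ j \<and> x $ j < 2 * pi) \<and> 0 \<le> x $ i + c \<and> x $ i + c < 2 * pi" for c
        unfolding torus_def by (auto simp: axis_def)
      have 1: "x + a *\<^sub>R ?e \<in> torus \<longleftrightarrow> x \<in> A \<or> x + (2 * pi) *\<^sub>R ?e \<in> B"
        using t[of a] t[of 0] t[of "2 * pi"] a by (auto simp: A_def B_def)
      have 2: "\<not> (x \<in> A \<and> x + (2 * pi) *\<^sub>R ?e \<in> B)"
        using t[of 0] t[of "2 * pi"] by (auto simp: A_def B_def)
      from 1 2 show ?thesis by (auto split: split_indicator)
    qed
    then show "h (x + a *\<^sub>R ?e - a *\<^sub>R ?e) * indicator torus (x + a *\<^sub>R ?e)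
      = h x * indicator A x + h x * indicator B (x + (2 * pi) *\<^sub>R ?e)"
      by (simp add: distrib_left)
  qed
  also have "\<dots> = (\<integral>\<^sup>+x. h x * indicator A x \<partial>lborel) + (\<integral>\<^sup>+x. h x * indicator B (x + (2 * pi) *\<^sub>R ?e) \<partial>lborel)"
    by (rule nn_integral_add) auto
  also have "(\<integral>\<^sup>+x. h x * indicator B (x + (2 * pi) *\<^sub>R ?e) \<partial>lborel)
      = (\<integral>\<^sup>+x. h (x + (2 * pi) *\<^sub>R ?e) * indicator B (x + (2 * pi) *\<^sub>R ?e) \<partial>lborel)"
    using per by (simp add: periodic_def)
  also have "\<dots> = (\<integral>\<^sup>+x. h x * indicator B x \<partial>lborel)"
    by (rule nn_integral_lborel_shift) measurable
  also have "(\<integral>\<^sup>+x. h x * indicator A x \<partial>lborel) + (\<integral>\<^sup>+x. h x * indicator B x \<partial>lborel)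
      = (\<integral>\<^sup>+x. h x * indicator A x + h x * indicator B x \<partial>lborel)"
    by (rule nn_integral_add[symmetric]) auto
  also have "\<dots> = (\<integral>\<^sup>+x. h x * indicator torus x \<partial>lborel)"
    by (intro nn_integral_cong) (auto simp: A_def B_def split: split_indicator)
  finally show ?thesis .
qed

lemma vec_sum_axis: "(\<Sum>i\<in>UNIV. (y $ i) *\<^sub>R axis i 1) = (y :: real ^ 'd)"
  using basis_expansion[of y] by (simp add: scalar_mult_eq_scaleR)

lemma torus_nn_integral_shift:
  fixes h :: "real ^ 'd \<Rightarrow> ennreal"
  assumes [measurable]: "h \<in> borel_measurable borel" and per: "periodic h" and y: "y \<in> torus"
  shows "(\<integral>\<^sup>+x. h (x - y) * indicator torus x \<partial>lborel) = (\<integral>\<^sup>+x. h x * indicator torus x \<partial>lborel)"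
proof -
  have "(\<integral>\<^sup>+x. h (x - (\<Sum>i\<in>I. (y $ i) *\<^sub>R axis i 1)) * indicator torus x \<partial>lborel)
      = (\<integral>\<^sup>+x. h x * indicator torus x \<partial>lborel)" if "finite I" for I
    using that
  proof induction
    case (insert i I)
    let ?c = "\<Sum>i\<in>I. (y $ i) *\<^sub>R axis i 1 :: real ^ 'd"
    have "(\<integral>\<^sup>+x. h (x - (\<Sum>i\<in>insert i I. (y $ i) *\<^sub>R axis i 1)) * indicator torus x \<partial>lborel)
        = (\<integral>\<^sup>+x. h (x - (y $ i) *\<^sub>R axis i 1 - ?c) * indicator torus x \<partial>lborel)"
      using insert by (simp add: algebra_simps)
    also have "\<dots> = (\<integral>\<^sup>+x. h (x - ?c) * indicator torus x \<partial>lborel)"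
    proof (rule torus_nn_integral_shift_coordinate[of "\<lambda>x. h (x - ?c)"])
      have "x + p - ?c = (x - ?c) + p" for x p by simp
      then show "periodic (\<lambda>x. h (x - ?c))" using per unfolding periodic_def by metis
    qed (use y in \<open>auto simp: torus_def\<close>)
    finally show ?case using insert by simp
  qed simp
  from this[of UNIV] show ?thesis by (simp add: vec_sum_axis)
qed

lemma AE_torus_cbox: "AE x :: real ^ 'd in lborel. x \<in> torus \<longleftrightarrow> x \<in> cbox 0 (\<chi> i. 2 * pi)"
proof -
  have "AE x in lborel. (x :: real ^ 'd) $ i \<noteq> 2 * pi" for i
  proof -
    have "negligible {x :: real ^ 'd. x $ i = 2 * pi}"
      using negligible_standard_hyperplane[of "axis i 1 :: real ^ 'd" "2 * pi"]
      by (simp add: inner_axis axis_in_Basis_iff)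
    then have "{x :: real ^ 'd. x $ i = 2 * pi} \<in> null_sets lebesgue"
      by (simp add: negligible_iff_null_sets)
    then have "AE x in lebesgue. x \<notin> {x :: real ^ 'd. x $ i = 2 * pi}" by (rule AE_not_in)
    then show ?thesis by (simp add: AE_completion_iff)
  qed
  then have "AE x in lborel. \<forall>i. (x :: real ^ 'd) $ i \<noteq> 2 * pi" by (subst AE_all_countable) auto
  then show ?thesis
    by eventually_elim (auto simp: torus_def mem_box_cart less_le)
qed

text \<open>
  Up to a null set the cell is the closed cube, whose reflection is its translate by one period in
  every direction.
\<close>

lemma torus_nn_integral_reflect:
  fixes h :: "real ^ 'd \<Rightarrow> ennreal"
  assumes [measurable]: "h \<in> borel_measurable borel" and per: "periodic h"
  shows "(\<integral>\<^sup>+x. h (- x) * indicator torus x \<partial>lborel) = (\<integral>\<^sup>+x. h x * indicator torus x \<partial>lborel)"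
proof -
  define p :: "real ^ 'd" where "p = (\<chi> i. 2 * pi)"
  have "h (x + (\<Sum>i\<in>I. (2 * pi) *\<^sub>R axis i 1)) = h x" if "finite I" for I :: "'d set" and x
    using that
  proof (induction I arbitrary: x)
    case (insert i I)
    have "h (x + (\<Sum>i\<in>insert i I. (2 * pi) *\<^sub>R axis i 1)) = h ((x + (2 * pi) *\<^sub>R axis i 1) + (\<Sum>i\<in>I. (2 * pi) *\<^sub>R axis i 1))"
      using insert by (simp add: algebra_simps)
    also have "\<dots> = h (x + (2 * pi) *\<^sub>R axis i 1)" by (rule insert)
    finally show ?case using per by (simp add: periodic_def)
  qed simp
  from this[of UNIV] have hp: "h (x + p) = h x" for x
    using vec_sum_axis[of p] by (simp add: p_def)
  have ae: "AE x in lborel. x \<in> torus \<longleftrightarrow> x \<in> cbox 0 p"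
    unfolding p_def by (rule AE_torus_cbox)
  have "(\<integral>\<^sup>+x. h (- x) * indicator torus x \<partial>lborel) = (\<integral>\<^sup>+x. h (- x) * indicator (cbox 0 p) x \<partial>lborel)"
    using ae by (intro nn_integral_cong_AE) (auto split: split_indicator)
  also have "\<dots> = (\<integral>\<^sup>+x. h x * indicator (cbox 0 p) (- x) \<partial>lborel)"
  proof -
    have "(\<integral>\<^sup>+x. h x * indicator (cbox 0 p) (- x) \<partial>lborel)
       = (\<integral>\<^sup>+x. h x * indicator (cbox 0 p) (- x) \<partial>distr lborel borel uminus)"
      using lborel_affine[of "- 1" "0 :: real ^ 'd"] by (simp add: density_1)
    also have "\<dots> = (\<integral>\<^sup>+x. h (- x) * indicator (cbox 0 p) x \<partial>lborel)"
      by (subst nn_integral_distr) auto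
    finally show ?thesis by simp
  qed
  also have "\<dots> = (\<integral>\<^sup>+x. h (x + p) * indicator (cbox 0 p) (x + p) \<partial>lborel)"
  proof (rule nn_integral_cong)
    fix x :: "real ^ 'd"
    have "0 \<le> - (x $ i) \<and> - (x $ i) \<le> 2 * pi \<longleftrightarrow> 0 \<le> x $ i + 2 * pi \<and> x $ i + 2 * pi \<le> 2 * pi" for i
      by auto
    then have "- x \<in> cbox 0 p \<longleftrightarrow> x + p \<in> cbox 0 p" by (simp add: mem_box_cart p_def)
    then show "h x * indicator (cbox 0 p) (- x) = h (x + p) * indicator (cbox 0 p) (x + p)"
      by (simp add: hp indicator_def)
  qed
  also have "\<dots> = (\<integral>\<^sup>+x. h x * indicator (cbox 0 p) x \<partial>lborel)"
    by (rule nn_integral_lborel_shift) auto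
  also have "\<dots> = (\<integral>\<^sup>+x. h x * indicator torus x \<partial>lborel)"
    using ae by (intro nn_integral_cong_AE) (auto split: split_indicator)
  finally show ?thesis .
qed

lemma (in pair_sigma_finite) integrable_times:
  fixes f :: "'a \<Rightarrow> real" and g :: "'b \<Rightarrow> real"
  assumes f: "integrable M1 f" and g: "integrable M2 g"
  shows "integrable (M1 \<Otimes>\<^sub>M M2) (\<lambda>(x, y). f x * g y)"
proof (rule Fubini_integrable)
  note [measurable] = borel_measurable_integrable[OF f] borel_measurable_integrable[OF g]
  show "(\<lambda>(x, y). f x * g y) \<in> borel_measurable (M1 \<Otimes>\<^sub>M M2)" by measurable
  show "integrable M1 (\<lambda>x. \<integral>y. norm (case (x, y) of (x, y) \<Rightarrow> f x * g y) \<partial>M2)"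
    using f by (simp add: abs_mult)
  show "AE x in M1. integrable M2 (\<lambda>y. case (x, y) of (x, y) \<Rightarrow> f x * g y)"
    using g by simp
qed

lemma (in pair_sigma_finite) integral_times:
  fixes f :: "'a \<Rightarrow> real" and g :: "'b \<Rightarrow> real"
  assumes f: "integrable M1 f" and g: "integrable M2 g"
  shows "(\<integral>p. f (fst p) * g (snd p) \<partial>(M1 \<Otimes>\<^sub>M M2)) = (\<integral>x. f x \<partial>M1) * (\<integral>y. g y \<partial>M2)"
  using integral_fst'[OF integrable_times[OF f g]] by (simp add: case_prod_beta')

lemma nn_integral_lebesgue_on:
  fixes f :: "'a::euclidean_space \<Rightarrow> ennreal"
  assumes S: "S \<in> sets borel"
  shows "(\<integral>\<^sup>+x. f x \<partial>lebesgue_on S) = (\<integral>\<^sup>+x. f x * indicator S x \<partial>lborel)"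
  using S by (simp add: nn_integral_restrict_space nn_integral_completion)

lemma integral_lebesgue_on_borel:
  fixes f :: "'a::euclidean_space \<Rightarrow> real"
  assumes S: "S \<in> sets borel" and f: "f \<in> borel_measurable borel"
  shows "(\<integral>x. f x \<partial>lebesgue_on S) = (\<integral>x. f x * indicator S x \<partial>lborel)"
    and "integrable (lebesgue_on S) f \<longleftrightarrow> integrable lborel (\<lambda>x. f x * indicator S x)"
proof -
  have [measurable]: "(\<lambda>x. f x * indicator S x) \<in> borel_measurable lborel"
    using assms by measurable
  show "(\<integral>x. f x \<partial>lebesgue_on S) = (\<integral>x. f x * indicator S x \<partial>lborel)"
    using S by (simp add: integral_restrict_space integral_completion[symmetric] mult.commute)
  show "integrable (lebesgue_on S) f \<longleftrightarrow> integrable lborel (\<lambda>x. f x * indicator S x)"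
    using S by (simp add: integrable_restrict_space integrable_completion[symmetric] mult.commute)
qed

lemma nn_integral_spacetime_product:
  fixes r :: "real ^ 'd \<Rightarrow> ennreal"
  assumes [measurable]: "r \<in> borel_measurable borel" "p \<in> borel_measurable borel"
  shows "(\<integral>\<^sup>+z. r (fst z) * p (snd z) \<partial>lebesgue_on spacetime)
    = (\<integral>\<^sup>+x. r x * indicator torus x \<partial>lborel) * (\<integral>\<^sup>+t. p t * indicator {0..} t \<partial>lborel)"
proof -
  have "(\<integral>\<^sup>+z. r (fst z) * p (snd z) \<partial>lebesgue_on spacetime)
     = (\<integral>\<^sup>+z. r (fst z) * p (snd z) * indicator spacetime z \<partial>lborel)"
    by (rule nn_integral_lebesgue_on) simp
  also have "\<dots> = (\<integral>\<^sup>+z. (r (fst z) * indicator torus (fst z)) * (p (snd z) * indicator {0..} (snd z)) \<partial>(lborel \<Otimes>\<^sub>M lborel))"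
    unfolding lborel_prod
    by (intro nn_integral_cong) (auto simp: spacetime_def split: split_indicator)
  also have "\<dots> = (\<integral>\<^sup>+x. \<integral>\<^sup>+t. (r x * indicator torus x) * (p t * indicator {0..} t) \<partial>lborel \<partial>lborel)"
    by (subst lborel.nn_integral_fst[symmetric]) (auto simp del: lborel_prod)
  also have "\<dots> = (\<integral>\<^sup>+x. r x * indicator torus x \<partial>lborel) * (\<integral>\<^sup>+t. p t * indicator {0..} t \<partial>lborel)"
    by (simp add: nn_integral_cmult nn_integral_multc)
  finally show ?thesis .
qed

lemma integral_spacetime_product:
  fixes r :: "real ^ 'd \<Rightarrow> real"
  assumes [measurable]: "r \<in> borel_measurable borel" "p \<in> borel_measurable borel"
    and r: "integrable lborel (\<lambda>x. r x * indicator torus x)"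
    and p: "integrable lborel (\<lambda>t. p t * indicator {0..} t)"
  shows "(\<integral>z. r (fst z) * p (snd z) \<partial>lebesgue_on spacetime)
    = (\<integral>x. r x * indicator torus x \<partial>lborel) * (\<integral>t. p t * indicator {0..} t \<partial>lborel)"
    and "integrable (lebesgue_on spacetime) (\<lambda>z. r (fst z) * p (snd z))"
proof -
  have psf: "pair_sigma_finite (lborel :: (real ^ 'd) measure) (lborel :: real measure)"
    by (intro pair_sigma_finite.intro lborel.sigma_finite_measure_axioms)
  have [measurable]: "(\<lambda>z :: (real ^ 'd) \<times> real. r (fst z) * p (snd z)) \<in> borel_measurable borel"
    by (simp add: borel_prod[symmetric])
  have *: "r (fst z) * p (snd z) * indicator spacetime z =
      (r (fst z) * indicator torus (fst z)) * (p (snd z) * indicator {0..} (snd z))" for z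
    by (auto simp: spacetime_def mem_Times_iff split: split_indicator)
  show "(\<integral>z. r (fst z) * p (snd z) \<partial>lebesgue_on spacetime)
    = (\<integral>x. r x * indicator torus x \<partial>lborel) * (\<integral>t. p t * indicator {0..} t \<partial>lborel)"
    using pair_sigma_finite.integral_times[OF psf r p] by (simp add: integral_lebesgue_on_borel * lborel_prod)
  show "integrable (lebesgue_on spacetime) (\<lambda>z. r (fst z) * p (snd z))"
    using pair_sigma_finite.integrable_times[OF psf r p] by (simp add: integral_lebesgue_on_borel * lborel_prod case_prod_beta')
qed

lemma torus_finite: "emeasure lborel torus < \<infinity>" "emeasure lebesgue torus < \<infinity>"
  using emeasure_bounded_finite[OF torus_bounded(1)] by auto

lemma integrable_torus_bounded:
  fixes r :: "real ^ 'd \<Rightarrow> real"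
  assumes [measurable]: "r \<in> borel_measurable borel" and B: "\<And>x. \<bar>r x\<bar> \<le> B"
  shows "integrable lborel (\<lambda>x. r x * indicator torus x)"
proof (rule Bochner_Integration.integrable_bound)
  show "integrable lborel (\<lambda>x :: real ^ 'd. B * indicator torus x)"
    by (intro integrable_mult_right integrable_real_indicator torus_finite) simp
  show "AE x in lborel. norm (r x * indicator torus x) \<le> norm (B * indicator torus x :: real)"
    using order_trans[OF B abs_ge_self] by (intro AE_I2) (auto split: split_indicator)
qed simp

section \<open>Periodic mollifiers\<close>

text \<open>
  The argument of \<open>soft_plus\<close> is positive exactly where the coordinates of \<open>x\<close> are jointly close to multiples of
  \<open>2\<pi>\<close>, so for small \<open>\<delta>\<close> this is a bump around the period lattice; periodicity, evenness and
  smoothness are inherited from the cosine.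
\<close>

definition torus_bump :: "real \<Rightarrow> real ^ 'd \<Rightarrow> real" where
  "torus_bump \<delta> x = soft_plus (\<delta> - (\<Sum>i\<in>UNIV. 1 - cos (x $ i)))"

definition torus_bump_mass :: "real \<Rightarrow> 'd::finite itself \<Rightarrow> real" where
  "torus_bump_mass \<delta> _ = (\<integral>x. torus_bump \<delta> (x :: real ^ 'd) * indicator torus x \<partial>lborel)"

definition mollifier :: "real \<Rightarrow> real ^ 'd \<Rightarrow> real" where
  "mollifier \<delta> x = torus_bump \<delta> x / torus_bump_mass \<delta> TYPE('d)"

definition mollifier_grad :: "real \<Rightarrow> 'd \<Rightarrow> real ^ 'd \<Rightarrow> real" where
  "mollifier_grad \<delta> i x =
     - (soft_plus_deriv (\<delta> - (\<Sum>j\<in>UNIV. 1 - cos (x $ j))) * sin (x $ i)) / torus_bump_mass \<delta> TYPE('d)"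

lemma soft_plus_mono_bound: "x \<le> y \<Longrightarrow> soft_plus x \<le> soft_plus y"
  by (rule DERIV_nonneg_imp_nondecreasing) (use soft_plus_has_derivative soft_plus_simps(6) in blast)+

lemma continuous_soft_plus: "continuous_on A soft_plus" "continuous_on A soft_plus_deriv"
  using smooth_continuous[OF smooth_soft_plus] smooth_continuous[OF smooth_soft_plus_deriv]
    continuous_on_subset by blast+

lemma soft_plus_deriv_bounded_above: obtains C where "C \<ge> 0" "\<And>x. x \<le> b \<Longrightarrow> soft_plus_deriv x \<le> C"
proof -
  have "compact (soft_plus_deriv ` {0..b})"
    by (intro compact_continuous_image continuous_soft_plus) simp
  then obtain C where C: "\<And>x. x \<in> {0..b} \<Longrightarrow> norm (soft_plus_deriv x) \<le> C"
    using compact_imp_bounded bounded_iff by (metis imageI)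
  have "soft_plus_deriv x \<le> max 0 C" if "x \<le> b" for x
    using C[of x] soft_plus_simps(4)[of x] that by (cases "x \<in> {0..b}") auto
  then show ?thesis by (intro that[of "max 0 C"]) auto
qed

lemma sum_one_minus_cos_nonneg: "(\<Sum>i\<in>UNIV. 1 - cos ((x :: real ^ 'd) $ i)) \<ge> 0"
  by (intro sum_nonneg) simp

lemma torus_bump_bounds: "0 \<le> torus_bump \<delta> x" "torus_bump \<delta> x \<le> soft_plus \<delta>"
  using sum_one_minus_cos_nonneg[of x]
  by (auto simp: torus_bump_def soft_plus_simps intro!: soft_plus_mono_bound)

lemma torus_bump_abs: "\<bar>torus_bump \<delta> x\<bar> \<le> soft_plus \<delta>"
  using torus_bump_bounds[of \<delta> x] by simp

lemma continuous_torus_bump: "continuous_on A (torus_bump \<delta>)"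
  unfolding torus_bump_def
  by (intro continuous_on_compose2[OF continuous_soft_plus(1)[of UNIV]] continuous_intros) auto

lemma torus_bump_borel [measurable]: "torus_bump \<delta> \<in> borel_measurable borel"
  by (intro borel_measurable_continuous_onI continuous_torus_bump)

lemma torus_bump_periodic: "torus_bump \<delta> (x + (2 * pi) *\<^sub>R axis i 1) = torus_bump \<delta> x"
  and torus_bump_even: "torus_bump \<delta> (- x) = torus_bump \<delta> x"
proof -
  have "cos ((x + (2 * pi) *\<^sub>R axis i 1) $ j) = cos (x $ j)" for j
    by (cases "j = i") (auto simp: axis_def)
  then show "torus_bump \<delta> (x + (2 * pi) *\<^sub>R axis i 1) = torus_bump \<delta> x" by (simp only: torus_bump_def)
  show "torus_bump \<delta> (- x) = torus_bump \<delta> x" by (simp add: torus_bump_def)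
qed

text \<open>
  The bump is positive on a nonempty open subset of the cell, and such a set is not negligible.
\<close>

lemma torus_bump_mass_pos:
  assumes "\<delta> > 0" shows "torus_bump_mass \<delta> TYPE('d::finite) > 0"
proof -
  have int: "integrable lborel (\<lambda>x :: real ^ 'd. torus_bump \<delta> x * indicator torus x)"
    by (rule integrable_torus_bounded[OF torus_bump_borel torus_bump_abs])
  have "torus_bump_mass \<delta> TYPE('d) \<ge> 0"
    unfolding torus_bump_mass_def
    by (intro Bochner_Integration.integral_nonneg mult_nonneg_nonneg torus_bump_bounds) simp
  moreover have "torus_bump_mass \<delta> TYPE('d) \<noteq> 0"
  proof
    assume "torus_bump_mass \<delta> TYPE('d) = 0"
    then have "AE x in lborel. torus_bump \<delta> (x :: real ^ 'd) * indicator torus x = 0"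
      unfolding torus_bump_mass_def
      by (subst (asm) integral_nonneg_eq_0_iff_AE[OF int]) (auto intro!: AE_I2 mult_nonneg_nonneg torus_bump_bounds(1))
    then have *: "AE x in lborel. torus_bump \<delta> (x :: real ^ 'd) = 0 \<or> x \<notin> torus"
      by (auto simp: indicator_def elim: eventually_mono)
    define U where "U = {x :: real ^ 'd. torus_bump \<delta> x > 0} \<inter> box 0 (\<chi> i. 2 * pi)"
    have "open U" unfolding U_def
      by (intro open_Int open_Collect_less continuous_torus_bump open_box continuous_on_const)
    have U: "U \<subseteq> {x. \<not> (torus_bump \<delta> x = 0 \<or> x \<notin> torus)}"
      by (auto simp: U_def torus_def mem_box_cart less_imp_le)
    have "AE x in lborel. x \<notin> U" using * by eventually_elim (use U in blast)
    then have "U \<in> null_sets lborel"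
      using \<open>open U\<close> by (simp add: AE_iff_null_sets)
    then have "negligible U" by (simp add: negligible_iff_null_sets null_sets_completionI)
    then have empty: "U = {}" using open_not_negligible[OF \<open>open U\<close>] by blast
    have "((\<lambda>s. \<delta> - (\<Sum>i\<in>(UNIV :: 'd set). 1 - cos s)) \<longlongrightarrow> \<delta> - (\<Sum>i\<in>(UNIV :: 'd set). 1 - cos 0)) (at_right (0 :: real))"
      by (intro tendsto_intros)
    then have "\<forall>\<^sub>F s in at_right (0 :: real). \<delta> - (\<Sum>i\<in>(UNIV :: 'd set). 1 - cos s) > 0"
      by (rule order_tendstoD) (use assms in simp)
    moreover have "\<forall>\<^sub>F s in at_right (0 :: real). 0 < s \<and> s < 2 * pi"
      by (rule eventually_at_rightI[of 0 "2 * pi"]) auto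
    ultimately have "\<forall>\<^sub>F s in at_right (0 :: real). False"
    proof eventually_elim
      case (elim s)
      note s = elim
      have "(\<chi> i. s) \<in> U"
        using s(1,2) by (simp add: U_def torus_bump_def soft_plus_simps(2) mem_box_cart)
      with empty show False by blast
    qed
    then show False by simp
  qed
  ultimately show ?thesis by simp
qed

lemma mollifier_nonneg: "\<delta> > 0 \<Longrightarrow> mollifier \<delta> x \<ge> 0"
  unfolding mollifier_def by (intro divide_nonneg_pos torus_bump_bounds torus_bump_mass_pos)

lemma mollifier_even: "mollifier \<delta> (- x) = mollifier \<delta> x"
  by (simp add: mollifier_def torus_bump_even)

lemma mollifier_swap: "mollifier \<delta> (x - y) = mollifier \<delta> (y - x)"
  using mollifier_even[of \<delta> "y - x"] by simp

lemma mollifier_grad_swap: "mollifier_grad \<delta> i (x - y) = - mollifier_grad \<delta> i (y - x)"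
proof -
  have "mollifier_grad \<delta> i (- z) = - mollifier_grad \<delta> i z" for z
    by (simp add: mollifier_grad_def)
  from this[of "y - x"] show ?thesis by simp
qed

lemma mollifier_periodic: "periodic (mollifier \<delta>)"
  by (simp add: periodic_def mollifier_def torus_bump_periodic)

lemma mollifier_grad_periodic: "periodic (mollifier_grad \<delta> i)"
  unfolding periodic_def
proof (intro allI)
  fix x :: "real ^ 'a" and k
  have "cos ((x + (2 * pi) *\<^sub>R axis k 1) $ j) = cos (x $ j)"
    "sin ((x + (2 * pi) *\<^sub>R axis k 1) $ j) = sin (x $ j)" for j
    by (cases "j = k"; auto simp: axis_def)+
  then show "mollifier_grad \<delta> i (x + (2 * pi) *\<^sub>R axis k 1) = mollifier_grad \<delta> i x"
    by (simp only: mollifier_grad_def)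
qed

lemma continuous_mollifier: "continuous_on A (mollifier \<delta>)"
  unfolding mollifier_def divide_inverse by (intro continuous_on_mult_right continuous_torus_bump)

lemma continuous_mollifier_grad: "continuous_on A (mollifier_grad \<delta> i)"
  unfolding mollifier_grad_def divide_inverse
  by (intro continuous_on_mult_right continuous_on_minus continuous_on_mult
      continuous_on_compose2[OF continuous_soft_plus(2)[of UNIV]] continuous_intros) auto

lemma mollifier_borel [measurable]: "mollifier \<delta> \<in> borel_measurable borel"
  by (intro borel_measurable_continuous_onI continuous_mollifier)

lemma mollifier_grad_borel [measurable]: "mollifier_grad \<delta> i \<in> borel_measurable borel"
  by (intro borel_measurable_continuous_onI continuous_mollifier_grad)

lemma mollifier_bounded:
  assumes "\<delta> > 0"
  obtains C where "C > 0" "\<And>x :: real ^ 'd. \<bar>mollifier \<delta> x\<bar> \<le> C" "\<And>(x :: real ^ 'd) i. \<bar>mollifier_grad \<delta> i x\<bar> \<le> C"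
proof -
  let ?m = "torus_bump_mass \<delta> TYPE('d)"
  have m: "?m > 0" by (rule torus_bump_mass_pos[OF assms])
  obtain D where D: "D \<ge> 0" "\<And>x. x \<le> \<delta> \<Longrightarrow> soft_plus_deriv x \<le> D"
    using soft_plus_deriv_bounded_above by blast
  define C where "C = (1 + soft_plus \<delta> + D) / ?m"
  have s0: "soft_plus \<delta> \<ge> 0" by (simp add: soft_plus_simps)
  show ?thesis
  proof
    show "C > 0" unfolding C_def using m D s0 by (intro divide_pos_pos) auto
    show "\<bar>mollifier \<delta> x\<bar> \<le> C" for x :: "real ^ 'd"
      unfolding C_def mollifier_def using torus_bump_bounds[of \<delta> x] m D
      by (simp add: abs_divide divide_right_mono)
    show "\<bar>mollifier_grad \<delta> i x\<bar> \<le> C" for x :: "real ^ 'd" and i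
    proof -
      let ?a = "soft_plus_deriv (\<delta> - (\<Sum>j\<in>UNIV. 1 - cos (x $ j)))"
      have "?a \<le> D" using sum_one_minus_cos_nonneg[of x] by (intro D) simp
      moreover have "?a \<ge> 0" by (simp add: soft_plus_simps)
      ultimately have "\<bar>?a * sin (x $ i)\<bar> \<le> D * 1"
        unfolding abs_mult by (intro mult_mono) auto
      then show ?thesis unfolding C_def mollifier_grad_def using m s0
        by (simp add: abs_divide divide_right_mono)
    qed
  qed
qed

lemma mollifier_mass:
  fixes y :: "real ^ 'd"
  assumes "\<delta> > 0" "y \<in> torus"
  shows "(\<integral>\<^sup>+x. ennreal (mollifier \<delta> (x - y)) * indicator torus x \<partial>lborel) = 1"
    and "(\<integral>\<^sup>+x. ennreal (mollifier \<delta> (y - x)) * indicator torus x \<partial>lborel) = 1"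
proof -
  let ?m = "torus_bump_mass \<delta> TYPE('d)"
  have int: "integrable lborel (\<lambda>x :: real ^ 'd. torus_bump \<delta> x * indicator torus x)"
    by (rule integrable_torus_bounded[OF torus_bump_borel torus_bump_abs])
  have m: "?m > 0" by (rule torus_bump_mass_pos[OF assms(1)])
  have per: "periodic (\<lambda>x :: real ^ 'd. ennreal (mollifier \<delta> x))"
    using mollifier_periodic[where \<delta>=\<delta> and ?'a='d] by (simp add: periodic_def)
  have "(\<integral>\<^sup>+x. ennreal (mollifier \<delta> (x - y)) * indicator torus x \<partial>lborel)
      = (\<integral>\<^sup>+x. ennreal (mollifier \<delta> (x :: real ^ 'd)) * indicator torus x \<partial>lborel)"
    by (rule torus_nn_integral_shift[OF _ per assms(2)]) simp
  also have "\<dots> = (\<integral>\<^sup>+x. ennreal (torus_bump \<delta> (x :: real ^ 'd) * indicator torus x / ?m) \<partial>lborel)"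
    by (intro nn_integral_cong) (auto simp: mollifier_def split: split_indicator)
  also have "\<dots> = ennreal (\<integral>x. torus_bump \<delta> (x :: real ^ 'd) * indicator torus x / ?m \<partial>lborel)"
    using int by (intro nn_integral_eq_integral AE_I2 divide_nonneg_pos mult_nonneg_nonneg torus_bump_bounds m) auto
  also have "\<dots> = 1"
    using m by (simp add: torus_bump_mass_def)
  finally show "(\<integral>\<^sup>+x. ennreal (mollifier \<delta> (x - y)) * indicator torus x \<partial>lborel) = 1" .
  then show "(\<integral>\<^sup>+x. ennreal (mollifier \<delta> (y - x)) * indicator torus x \<partial>lborel) = 1"
    by (simp only: mollifier_swap[of \<delta> y])
qed

lemma mollifier_integral:
  fixes y :: "real ^ 'd"
  assumes "\<delta> > 0" "y \<in> torus"
  shows "(\<integral>x. mollifier \<delta> (x - y) * indicator torus x \<partial>lborel) = 1"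
    and "(\<integral>x. mollifier \<delta> (y - x) * indicator torus x \<partial>lborel) = 1"
proof -
  have "(\<integral>x. mollifier \<delta> (x - y) * indicator torus x \<partial>lborel)
    = enn2real (\<integral>\<^sup>+x. ennreal (mollifier \<delta> (x - y) * indicator torus x) \<partial>lborel)"
    by (intro integral_eq_nn_integral AE_I2 mult_nonneg_nonneg mollifier_nonneg assms) auto
  also have "(\<integral>\<^sup>+x. ennreal (mollifier \<delta> (x - y) * indicator torus x) \<partial>lborel) = 1"
    by (subst mollifier_mass(1)[OF assms, symmetric]) (intro nn_integral_cong, simp split: split_indicator)
  finally show "(\<integral>x. mollifier \<delta> (x - y) * indicator torus x \<partial>lborel) = 1" by simp
  then show "(\<integral>x. mollifier \<delta> (y - x) * indicator torus x \<partial>lborel) = 1"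
    by (simp only: mollifier_swap[of \<delta> y])
qed

text \<open>
  The gradient is odd and periodic. Shifting and reflecting the cell shows that its positive and
  negative parts have equal integrals. This is the reason why the flux concentrations leave no trace in
  the doubling argument.
\<close>

lemma mollifier_grad_integral:
  fixes y :: "real ^ 'd"
  assumes "y \<in> torus"
  shows "(\<integral>x. mollifier_grad \<delta> i (y - x) * indicator torus x \<partial>lborel) = 0"
proof -
  let ?G = "mollifier_grad \<delta> i"
  have odd: "?G (- x) = - ?G x" for x by (simp add: mollifier_grad_def)
  have sh: "(\<integral>\<^sup>+x. ennreal (?G (x - y)) * indicator torus x \<partial>lborel) = (\<integral>\<^sup>+x. ennreal (?G x) * indicator torus x \<partial>lborel)"
    "(\<integral>\<^sup>+x. ennreal (- ?G (x - y)) * indicator torus x \<partial>lborel) = (\<integral>\<^sup>+x. ennreal (- ?G x) * indicator torus x \<partial>lborel)"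
    using mollifier_grad_periodic[of \<delta> i] assms
    by (auto intro!: torus_nn_integral_shift[of "\<lambda>x. ennreal (?G x)"] torus_nn_integral_shift[of "\<lambda>x. ennreal (- ?G x)"]
        simp: periodic_def)
  have re: "(\<integral>\<^sup>+x. ennreal (- ?G x) * indicator torus x \<partial>lborel) = (\<integral>\<^sup>+x. ennreal (?G x) * indicator torus x \<partial>lborel)"
    using torus_nn_integral_reflect[of "\<lambda>x. ennreal (?G x)"] mollifier_grad_periodic[of \<delta> i]
    by (simp add: odd periodic_def)
  have eq: "(\<integral>\<^sup>+x. ennreal (?G (y - x) * indicator torus x) \<partial>lborel) = (\<integral>\<^sup>+x. ennreal (- (?G (y - x) * indicator torus x)) \<partial>lborel)"
  proof -
    have "(\<integral>\<^sup>+x. ennreal (?G (y - x) * indicator torus x) \<partial>lborel) = (\<integral>\<^sup>+x. ennreal (- ?G (x - y)) * indicator torus x \<partial>lborel)"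
      by (intro nn_integral_cong) (simp add: mollifier_grad_swap[of \<delta> i y] split: split_indicator)
    moreover have "(\<integral>\<^sup>+x. ennreal (- (?G (y - x) * indicator torus x)) \<partial>lborel) = (\<integral>\<^sup>+x. ennreal (?G (x - y)) * indicator torus x \<partial>lborel)"
      by (intro nn_integral_cong) (simp add: mollifier_grad_swap[of \<delta> i y] split: split_indicator)
    ultimately show ?thesis by (simp only: sh re)
  qed
  show ?thesis
  proof (cases "integrable lborel (\<lambda>x. ?G (y - x) * indicator torus x)")
    case True
    then show ?thesis unfolding real_lebesgue_integral_def[OF True] by (simp only: eq)
  qed (simp add: not_integrable_integral_eq)
qed

lemma mollifier_support:
  "mollifier \<delta> x \<noteq> 0 \<Longrightarrow> 1 - cos (x $ i) < \<delta>"
proof (rule ccontr)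
  assume m: "mollifier \<delta> x \<noteq> 0" and "\<not> 1 - cos (x $ i) < \<delta>"
  moreover have "(\<Sum>i\<in>UNIV. 1 - cos (x $ i)) \<ge> 1 - cos (x $ i)"
    by (rule member_le_sum) auto
  ultimately have "torus_bump \<delta> x = 0" unfolding torus_bump_def by (intro soft_plus_simps) linarith
  with m show False by (simp add: mollifier_def)
qed

lemma smooth_mollifier: "smooth (mollifier \<delta>)"
proof -
  have c: "smooth (\<lambda>x :: real ^ 'a. cos (x $ i))" for i
    by (intro smooth_compose[OF smooth_cos] smooth_bounded_linear bounded_linear_vec_nth)
  then have "smooth (torus_bump \<delta> :: real ^ 'a \<Rightarrow> real)"
    unfolding torus_bump_def[abs_def]
    by (intro smooth_compose[OF smooth_soft_plus] smooth_diff smooth_const smooth_sum c)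
  then show ?thesis unfolding mollifier_def[abs_def] divide_inverse
    by (intro smooth_mult smooth_const)
qed

lemma mollifier_has_derivative:
  "(mollifier \<delta> has_derivative (\<lambda>v. \<Sum>i\<in>UNIV. v $ i * mollifier_grad \<delta> i x)) (at x)"
proof -
  let ?m = "torus_bump_mass \<delta> TYPE('a)"
  let ?S = "\<lambda>x :: real ^ 'a. \<delta> - (\<Sum>i\<in>UNIV. 1 - cos (x $ i))"
  have 1: "(?S has_derivative (\<lambda>v. - (\<Sum>i\<in>UNIV. sin (x $ i) * v $ i))) (at x)"
  proof -
    have "((\<lambda>x :: real ^ 'a. cos (x $ i)) has_derivative (\<lambda>v. - sin (x $ i) * v $ i)) (at x)" for i
      by (rule has_derivative_compose[OF bounded_linear_imp_has_derivative[OF bounded_linear_vec_nth]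
          DERIV_cos[unfolded has_field_derivative_def]])
    then have "(?S has_derivative (\<lambda>v. 0 - (\<Sum>i\<in>UNIV. 0 - (- sin (x $ i) * v $ i)))) (at x)"
      by (intro has_derivative_diff has_derivative_sum has_derivative_const)
    then show ?thesis by simp
  qed
  have 2: "(soft_plus has_derivative (*) (soft_plus_deriv (?S x))) (at (?S x))"
    using soft_plus_has_derivative[of "?S x"] by (simp add: has_field_derivative_def)
  have "(mollifier \<delta> has_derivative (\<lambda>v. soft_plus_deriv (?S x) * - (\<Sum>i\<in>UNIV. sin (x $ i) * v $ i) / ?m)) (at x)"
    unfolding mollifier_def[abs_def] torus_bump_def[abs_def] divide_inverse
    by (rule has_derivative_mult_left[OF has_derivative_compose[OF 1 2]])
  then show ?thesis
    by (rule has_derivative_eq_rhs)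
      (simp add: mollifier_grad_def sum_distrib_left sum_distrib_right sum_divide_distrib sum_negf[symmetric] fun_eq_iff mult_ac)
qed

section \<open>Test functions\<close>

lemma real_derivative_zero_if_locally_zero:
  fixes F :: "real \<Rightarrow> real"
  assumes "(F has_real_derivative c) (at t)" "open S" "t \<in> S" "\<And>u. u \<in> S \<Longrightarrow> F u = 0"
  shows "c = 0"
proof -
  have "((\<lambda>_. 0) has_real_derivative c) (at t)"
    using has_field_derivative_transform_within_open[OF assms(1-3)] assms(4) by auto
  then show ?thesis using DERIV_unique DERIV_const by blast
qed

lemma integral_derivative_compact_support:
  fixes F :: "real \<Rightarrow> real"
  assumes F: "\<And>t. (F has_real_derivative F' t) (at t)" and F': "continuous_on UNIV F'"
    and lo: "\<And>t. t \<le> lo \<Longrightarrow> F t = 0" and hi: "\<And>t. t \<ge> hi \<Longrightarrow> F t = 0"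
    and "0 \<le> lo" "lo \<le> hi"
  shows "(\<integral>t. F' t * indicator {0..} t \<partial>lborel) = 0"
proof -
  have 1: "F' t = 0" if "t < lo" for t
    by (rule real_derivative_zero_if_locally_zero[OF F, of "{..<lo}"]) (use that lo in auto)
  have 2: "F' t = 0" if "t > hi" for t
    by (rule real_derivative_zero_if_locally_zero[OF F, of "{hi<..}"]) (use that hi in auto)
  have "(\<integral>t. F' t * indicator {0..} t \<partial>lborel) = (\<integral>t. F' t * indicator {lo..hi} t \<partial>lborel)"
    using 1 2 assms(5,6) by (intro Bochner_Integration.integral_cong)
      (auto simp: not_le split: split_indicator)
  also have "\<dots> = F hi - F lo"
    using F F' assms(6) by (intro integral_FTC_Icc_real) (auto simp: continuous_on_eq_continuous_at)
  finally show ?thesis using lo hi by simp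
qed

definition bump_deriv :: "real \<Rightarrow> real" where
  "bump_deriv x = frechet_derivative bump (at x) 1"

lemma bump_has_derivative: "(bump has_real_derivative bump_deriv x) (at x)"
proof -
  note d = smooth_differentiable[OF smooth_bump, of x]
  have "frechet_derivative bump (at x) = (*) (bump_deriv x)"
    unfolding bump_deriv_def
    by (rule ext) (subst real_has_derivative_1[OF d], simp add: mult.commute)
  then show ?thesis using d by (simp add: has_field_derivative_def)
qed

definition time_kernel :: "real \<Rightarrow> real \<Rightarrow> real" where
  "time_kernel T r = bump (r / T) / T"

definition time_kernel_deriv :: "real \<Rightarrow> real \<Rightarrow> real" where
  "time_kernel_deriv T r = bump_deriv (r / T) / T\<^sup>2"

text \<open>
  For \<open>2T \<le> \<tau>\<close> the cutoff rises from \<open>0\<close> to \<open>1\<close> on \<open>[T, 2T]\<close> and falls back on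
  \<open>[\<tau>, \<tau> + 1]\<close>.
\<close>

definition cutoff :: "real \<Rightarrow> real \<Rightarrow> real \<Rightarrow> real" where
  "cutoff \<tau> T t = smooth_step (t / T - 1) * (1 - smooth_step (t - \<tau>))"

definition cutoff_deriv :: "real \<Rightarrow> real \<Rightarrow> real \<Rightarrow> real" where
  "cutoff_deriv \<tau> T t = bump (t / T - 1) / T * (1 - smooth_step (t - \<tau>)) - smooth_step (t / T - 1) * bump (t - \<tau>)"

lemma smooth_affine: "smooth (\<lambda>t :: real. t / c + d)"
  unfolding divide_inverse
  by (intro smooth_add smooth_mult smooth_const smooth_bounded_linear bounded_linear_ident)

lemma smooth_time_kernel: "smooth (time_kernel T)"
  unfolding time_kernel_def[abs_def]
  using smooth_compose[OF smooth_bump smooth_affine[of T 0]] smooth_mult[OF _ smooth_const[of "inverse T"]]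
  by (simp add: divide_inverse)

lemma smooth_cutoff: "smooth (cutoff \<tau> T)"
proof -
  have "smooth (\<lambda>t. smooth_step (t / T + - 1))" "smooth (\<lambda>t. smooth_step (t / 1 + - \<tau>))"
    by (rule smooth_compose[OF smooth_step_smooth smooth_affine])+
  then show ?thesis unfolding cutoff_def[abs_def]
    by (intro smooth_mult smooth_diff smooth_const) simp_all
qed

lemma time_kernel_has_derivative:
  "(time_kernel T has_real_derivative time_kernel_deriv T r) (at r)"
proof -
  have "((\<lambda>r. bump (r / T) / T) has_real_derivative bump_deriv (r / T) * (1 / T) / T) (at r)"
    by (intro DERIV_cdivide DERIV_chain'[OF DERIV_cdivide[OF DERIV_ident] bump_has_derivative])
  then show ?thesis by (simp add: time_kernel_def[abs_def] time_kernel_deriv_def power2_eq_square)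
qed

lemma cutoff_has_derivative: "(cutoff \<tau> T has_real_derivative cutoff_deriv \<tau> T t) (at t)"
proof -
  have 1: "((\<lambda>t. smooth_step (t / T - 1)) has_real_derivative bump (t / T - 1) * (1 / T - 0)) (at t)"
    by (intro DERIV_chain'[OF DERIV_diff[OF DERIV_cdivide[OF DERIV_ident] DERIV_const] smooth_step_has_derivative])
  have 2: "((\<lambda>t. smooth_step (t - \<tau>)) has_real_derivative bump (t - \<tau>) * (1 - 0)) (at t)"
    by (intro DERIV_chain'[OF DERIV_diff[OF DERIV_ident DERIV_const] smooth_step_has_derivative])
  show ?thesis
    unfolding cutoff_def[abs_def]
    by (rule DERIV_cong[OF DERIV_mult[OF 1 DERIV_diff[OF DERIV_const 2]]])
      (simp add: cutoff_deriv_def algebra_simps)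
qed

lemma continuous_cutoff: "continuous_on A (cutoff \<tau> T)"
  using smooth_continuous[OF smooth_cutoff] continuous_on_subset by blast

lemma continuous_cutoff_deriv: "continuous_on A (cutoff_deriv \<tau> T)"
  using smooth_continuous[OF smooth_real_deriv[OF cutoff_has_derivative smooth_cutoff]] continuous_on_subset
  by blast

lemma continuous_time_kernel: "continuous_on A (time_kernel T)"
  using smooth_continuous[OF smooth_time_kernel] continuous_on_subset by blast

lemma continuous_time_kernel_deriv: "continuous_on A (time_kernel_deriv T)"
  using smooth_continuous[OF smooth_real_deriv[OF time_kernel_has_derivative smooth_time_kernel]] continuous_on_subset
  by blast

lemma time_functions_borel [measurable]:
  "cutoff \<tau> T \<in> borel_measurable borel" "cutoff_deriv \<tau> T \<in> borel_measurable borel"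
  "time_kernel T \<in> borel_measurable borel" "time_kernel_deriv T \<in> borel_measurable borel"
  "bump \<in> borel_measurable borel"
  by (intro borel_measurable_continuous_onI continuous_cutoff continuous_cutoff_deriv continuous_time_kernel
      continuous_time_kernel_deriv continuous_on_bump)+

lemma time_kernel_nonneg: "T > 0 \<Longrightarrow> time_kernel T r \<ge> 0"
  by (simp add: time_kernel_def bump_nonneg)

lemma time_kernel_zero: "T > 0 \<Longrightarrow> r \<le> 0 \<or> r \<ge> T \<Longrightarrow> time_kernel T r = 0"
  by (auto simp: time_kernel_def divide_le_0_iff intro!: bump_eq_0)

lemma time_kernel_deriv_zero:
  assumes T: "T > 0" and "r < 0 \<or> r > T" shows "time_kernel_deriv T r = 0"
proof (rule real_derivative_zero_if_locally_zero[OF time_kernel_has_derivative])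
  show "open ({..<0} \<union> {T<..})" by auto
  show "time_kernel T u = 0" if "u \<in> {..<0} \<union> {T<..}" for u
    by (rule time_kernel_zero[OF T]) (use that in auto)
qed (use assms in auto)

lemma cutoff_zero: "T > 0 \<Longrightarrow> t \<le> T \<or> t \<ge> \<tau> + 1 \<Longrightarrow> cutoff \<tau> T t = 0"
  using smooth_step_0[of "t / T - 1"] smooth_step_1[of "t - \<tau>"] by (auto simp: cutoff_def divide_le_eq)

lemma cutoff_nonneg: "cutoff \<tau> T t \<ge> 0"
  using smooth_step_nonneg smooth_step_le_1 by (simp add: cutoff_def)

lemma cutoff_deriv_zero:
  assumes T: "T > 0" and "t < T \<or> t > \<tau> + 1" shows "cutoff_deriv \<tau> T t = 0"
proof (rule real_derivative_zero_if_locally_zero[OF cutoff_has_derivative])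
  show "open ({..<T} \<union> {\<tau> + 1<..})" by auto
  show "cutoff \<tau> T u = 0" if "u \<in> {..<T} \<union> {\<tau> + 1<..}" for u
    by (rule cutoff_zero[OF T]) (use that in auto)
qed (use assms in auto)

text \<open>
  The rise of the cutoff costs a term of order \<open>1/T\<close> on the initial layer; the descent, which has
  the opposite sign, produces the quantity to be estimated.
\<close>

lemma cutoff_deriv_le:
  assumes T: "T > 0" "2 * T \<le> \<tau>" and B: "\<And>x. bump x \<le> B"
  shows "cutoff_deriv \<tau> T t \<le> B / T * indicator {..2 * T} t - bump (t - \<tau>)"
proof (cases "t \<le> 2 * T")
  case True
  then have "bump (t - \<tau>) = 0" using T by (intro bump_eq_0) auto
  moreover have "smooth_step (t - \<tau>) = 0" using True T by (intro smooth_step_0) auto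
  moreover have "bump (t / T - 1) / T \<le> B / T" using T B by (intro divide_right_mono) auto
  ultimately show ?thesis using True by (simp add: cutoff_deriv_def)
next
  case False
  then have t: "t / T - 1 \<ge> 1" using T by (simp add: le_divide_eq)
  then have "bump (t / T - 1) = 0" by (intro bump_eq_0) auto
  moreover have "smooth_step (t / T - 1) = 1" using t by (rule smooth_step_1)
  ultimately show ?thesis using False by (simp add: cutoff_deriv_def)
qed

lemma time_kernel_mass_right:
  assumes T: "T > 0" and t: "t \<ge> 0"
  shows "(\<integral>\<^sup>+s. ennreal (time_kernel T (s - t)) * indicator {0..} s \<partial>lborel) = 1"
proof -
  have "(\<integral>\<^sup>+s. ennreal (time_kernel T (s - t)) * indicator {0..} s \<partial>lborel)
     = (\<integral>\<^sup>+s. ennreal (time_kernel T (s - t)) * indicator {t..t + T} s \<partial>lborel)"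
  proof (rule nn_integral_cong)
    fix s
    show "ennreal (time_kernel T (s - t)) * indicator {0..} s = ennreal (time_kernel T (s - t)) * indicator {t..t + T} s"
    proof (cases "s \<in> {t..t + T}")
      case True
      with t show ?thesis by simp
    next
      case False
      then have "time_kernel T (s - t) = 0" by (intro time_kernel_zero[OF T]) auto
      then show ?thesis by simp
    qed
  qed
  also have "\<dots> = ennreal (smooth_step ((t + T - t) / T) - smooth_step ((t - t) / T))"
  proof (rule nn_integral_FTC_Icc)
    show "((\<lambda>s. smooth_step ((s - t) / T)) has_real_derivative time_kernel T (s - t)) (at s)" for s
    proof -
      have "((\<lambda>s. (s - t) / T) has_real_derivative (1 - 0) / T) (at s)"
        by (intro DERIV_cdivide DERIV_diff DERIV_ident DERIV_const)
      from DERIV_chain'[OF this smooth_step_has_derivative] show ?thesis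
        by (simp add: time_kernel_def)
    qed
  qed (use T time_kernel_nonneg in auto)
  also have "\<dots> = 1" using T smooth_step_0[of 0] smooth_step_1[of 1] by simp
  finally show ?thesis .
qed

text \<open>
  Times \<open>t < 0\<close> are cut off, so for \<open>s < T\<close> part of the mass may be lost.
\<close>

lemma time_kernel_mass_left:
  assumes T: "T > 0"
  shows "(\<integral>\<^sup>+t. ennreal (time_kernel T (s - t)) * indicator {0..} t \<partial>lborel) \<le> 1"
proof -
  have "(\<integral>\<^sup>+t. ennreal (time_kernel T (s - t)) * indicator {0..} t \<partial>lborel)
     \<le> (\<integral>\<^sup>+t. ennreal (time_kernel T (s - t)) * indicator {s - T..s} t \<partial>lborel)"
  proof (rule nn_integral_mono)
    fix t
    show "ennreal (time_kernel T (s - t)) * indicator {0..} t \<le> ennreal (time_kernel T (s - t)) * indicator {s - T..s} t"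
    proof (cases "t \<in> {s - T..s}")
      case False
      then have "time_kernel T (s - t) = 0" by (intro time_kernel_zero[OF T]) auto
      then show ?thesis by simp
    qed (auto split: split_indicator)
  qed
  also have "\<dots> = ennreal (- smooth_step ((s - s) / T) - (- smooth_step ((s - (s - T)) / T)))"
  proof (rule nn_integral_FTC_Icc)
    show "((\<lambda>t. - smooth_step ((s - t) / T)) has_real_derivative time_kernel T (s - t)) (at t)" for t
    proof -
      have "((\<lambda>t. (s - t) / T) has_real_derivative (0 - 1) / T) (at t)"
        by (intro DERIV_cdivide DERIV_diff DERIV_ident DERIV_const)
      from DERIV_minus[OF DERIV_chain'[OF this smooth_step_has_derivative]] show ?thesis
        by (simp add: time_kernel_def)
    qed
  qed (use T time_kernel_nonneg in auto)
  also have "\<dots> = 1" using T smooth_step_0[of 0] smooth_step_1[of 1] by simp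
  finally show ?thesis .
qed

lemma product_test_function:
  fixes y :: "real ^ 'd" and \<delta> :: real and a a' :: "real \<Rightarrow> real"
  assumes a: "smooth a" "\<And>t. (a has_real_derivative a' t) (at t)"
    and supp: "0 < lo" "\<And>t. t \<notin> {lo..hi} \<Longrightarrow> a t = 0"
  defines "\<phi> \<equiv> (\<lambda>z. a (snd z) * mollifier \<delta> (fst z - y))"
  shows "\<phi> \<in> Cc_smooth"
    and "dt \<phi> z = a' (snd z) * mollifier \<delta> (fst z - y)"
    and "grad_x \<phi> z $ i = a (snd z) * mollifier_grad \<delta> i (fst z - y)"
proof -
  have shift: "Ck n h \<Longrightarrow> Ck n (\<lambda>z :: (real ^ 'd) \<times> real. h (fst z - y))" for n and h :: "real ^ 'd \<Rightarrow> real"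
  proof (induction n arbitrary: h)
    case 0
    then show ?case unfolding Ck.simps
      by (rule continuous_on_compose2) (auto intro!: continuous_on_diff continuous_on_fst continuous_on_id continuous_on_const)
  next
    case (Suc n)
    have l: "((\<lambda>z :: (real ^ 'd) \<times> real. fst z - y) has_derivative (\<lambda>v. fst v - 0)) (at z)" for z
      by (intro has_derivative_diff has_derivative_const has_derivative_fst has_derivative_ident)
    show ?case
      by (rule Ck_SucI[OF has_derivative_compose[OF l Ck_SucD(1)[OF Suc.prems]]])
        (rule Suc.IH[OF Ck_SucD(2)[OF Suc.prems]])
  qed
  have "smooth (\<lambda>z :: (real ^ 'd) \<times> real. a (snd z))"
    by (intro smooth_compose[OF a(1)] smooth_bounded_linear bounded_linear_snd)
  moreover have "smooth (\<lambda>z :: (real ^ 'd) \<times> real. mollifier \<delta> (fst z - y))"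
    using smooth_mollifier[where \<delta>=\<delta> and ?'a='d] shift unfolding smooth_def by blast
  ultimately have "smooth \<phi>" unfolding \<phi>_def by (rule smooth_mult)
  then have "\<forall>n. Ck n \<phi>" by (simp add: smooth_def)
  moreover have "x_periodic \<phi>"
    unfolding x_periodic_def
  proof (intro allI)
    fix x :: "real ^ 'd" and t i
    have "x + (2 * pi) *\<^sub>R axis i 1 - y = (x - y) + (2 * pi) *\<^sub>R axis i 1" by simp
    moreover have "mollifier \<delta> (v + (2 * pi) *\<^sub>R axis i 1) = mollifier \<delta> v" for v :: "real ^ 'd"
      using mollifier_periodic[where \<delta>=\<delta> and ?'a='d] by (simp add: periodic_def)
    ultimately show "\<phi> (x + (2 * pi) *\<^sub>R axis i 1, t) = \<phi> (x, t)"
      by (simp only: \<phi>_def fst_conv snd_conv)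
  qed
  moreover have "\<exists>a b. 0 < a \<and> (\<forall>x t. t \<notin> {a..b} \<longrightarrow> \<phi> (x, t) = 0)"
    using supp by (intro exI[of _ lo] exI[of _ hi]) (auto simp: \<phi>_def)
  ultimately show "\<phi> \<in> Cc_smooth" by (simp add: Cc_smooth_def)
  have d1: "((\<lambda>z :: (real ^ 'd) \<times> real. a (snd z)) has_derivative (\<lambda>v. a' (snd z) * snd v)) (at z)" for z
    by (rule has_derivative_compose[OF has_derivative_snd[OF has_derivative_ident] a(2)[unfolded has_field_derivative_def]])
  have l: "((\<lambda>z :: (real ^ 'd) \<times> real. fst z - y) has_derivative (\<lambda>v. fst v - 0)) (at z)" for z
    by (intro has_derivative_diff has_derivative_const has_derivative_fst has_derivative_ident)
  have d2: "((\<lambda>z :: (real ^ 'd) \<times> real. mollifier \<delta> (fst z - y)) has_derivative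
      (\<lambda>v. \<Sum>i\<in>UNIV. (fst v - 0) $ i * mollifier_grad \<delta> i (fst z - y))) (at z)" for z
    by (rule has_derivative_compose[OF l mollifier_has_derivative])
  have "(\<phi> has_derivative (\<lambda>v. a (snd z) * (\<Sum>i\<in>UNIV. (fst v - 0) $ i * mollifier_grad \<delta> i (fst z - y))
      + a' (snd z) * snd v * mollifier \<delta> (fst z - y))) (at z)" for z
    unfolding \<phi>_def by (rule has_derivative_mult[OF d1 d2])
  from frechet_derivative_at[OF this[of z]]
  have fd: "frechet_derivative \<phi> (at z) = (\<lambda>v. a (snd z) * (\<Sum>i\<in>UNIV. (fst v - 0) $ i * mollifier_grad \<delta> i (fst z - y))
      + a' (snd z) * snd v * mollifier \<delta> (fst z - y))" by simp
  show "dt \<phi> z = a' (snd z) * mollifier \<delta> (fst z - y)" by (simp add: dt_def fd)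
  have "(\<Sum>j\<in>UNIV. axis i 1 $ j * mollifier_grad \<delta> j (fst z - y)) = (\<Sum>j\<in>UNIV. if j = i then mollifier_grad \<delta> j (fst z - y) else 0)"
    by (intro sum.cong) (auto simp: axis_def)
  then show "grad_x \<phi> z $ i = a (snd z) * mollifier_grad \<delta> i (fst z - y)"
    by (simp add: grad_x_def fd)
qed

section \<open>Measures on space-time\<close>

lemma fst_borel [measurable]: "fst \<in> borel_measurable (lebesgue_on (S :: ((real ^ 'd) \<times> real) set))"
  and snd_borel [measurable]: "snd \<in> borel_measurable (lebesgue_on (S :: ((real ^ 'd) \<times> real) set))"
  by (intro borel_measurable_lebesgue_on borel_measurable_continuous_onI continuous_intros)+

text \<open>
  Restrictions of Lebesgue measure are complete.
\<close>

lemma lebesgue_on_AE_measurable: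
  assumes S: "S \<in> sets lebesgue" and ae: "AE x in lebesgue_on S. f x = g x"
    and g: "g \<in> lebesgue_on S \<rightarrow>\<^sub>M N" and f: "f \<in> S \<rightarrow> space N"
  shows "f \<in> lebesgue_on S \<rightarrow>\<^sub>M N"
proof -
  interpret complete_measure "lebesgue_on S"
  proof (rule complete_measure.intro)
    fix B A assume "A \<subseteq> B" "B \<in> null_sets (lebesgue_on S)"
    then have B: "B \<in> null_sets lebesgue" "A \<subseteq> S"
      using S by (auto simp: null_sets_restrict_space)
    then have "A \<in> sets lebesgue"
      using \<open>A \<subseteq> B\<close> completion.complete by blast
    with B S show "A \<in> sets (lebesgue_on S)" by (simp add: sets_restrict_space_iff)
  qed
  show ?thesis
  proof (rule measurableI)
    fix A assume A: "A \<in> sets N"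
    show "f -` A \<inter> space (lebesgue_on S) \<in> sets (lebesgue_on S)"
    proof (rule in_sets_AE)
      show "AE x in lebesgue_on S. (x \<in> g -` A \<inter> space (lebesgue_on S)) = (x \<in> f -` A \<inter> space (lebesgue_on S))"
        using ae by eventually_elim auto
      show "g -` A \<inter> space (lebesgue_on S) \<in> sets (lebesgue_on S)"
        using g A by (rule measurable_sets)
    qed auto
  qed (use f in auto)
qed

lemma slab_borel [measurable]: "torus \<times> {0..T :: real} \<in> sets borel"
  by (intro borel_Times) auto

lemma slab_sets: "torus \<times> {0..T} \<in> sets borel_spacetime"
proof -
  have "torus \<times> {0..T} = spacetime \<inter> (torus \<times> {0..T})" by (auto simp: spacetime_def)
  then show ?thesis unfolding borel_spacetime_def sets_restrict_space by (metis image_eqI slab_borel)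
qed

lemma space_borel_spacetime [simp]: "space borel_spacetime = spacetime"
  by (simp add: borel_spacetime_def)

lemma
  assumes m: "radon_measure m"
  shows space_radon_measure: "space m = spacetime"
    and borel_measurable_radon_measure: "g \<in> borel_measurable borel \<Longrightarrow> g \<in> borel_measurable m"
    and sigma_finite_radon_measure: "sigma_finite_measure m"
    and radon_measure_integrable_indicator: "integrable m (\<lambda>z. indicator {..R} (snd z) :: real)"
proof -
  have s: "sets m = sets borel_spacetime" using m by (simp add: radon_measure_def)
  show sp: "space m = spacetime" using sets_eq_imp_space_eq[OF s] by simp
  show "g \<in> borel_measurable m" if "g \<in> borel_measurable borel"
    using that unfolding measurable_cong_sets[OF s refl] borel_spacetime_def
    by (rule measurable_restrict_space1)
  have fin: "emeasure m (torus \<times> {0..T}) < \<infinity>" for T using m by (simp add: radon_measure_def)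
  show "sigma_finite_measure m"
  proof (intro sigma_finite_measure.intro exI[of _ "range (\<lambda>n. torus \<times> {0..real n})"] conjI)
    show "range (\<lambda>n. torus \<times> {0..real n}) \<subseteq> sets m"
      unfolding s by (rule image_subsetI) (rule slab_sets)
    show "\<Union> (range (\<lambda>n. torus \<times> {0..real n})) = space m"
      by (auto simp: sp spacetime_def real_arch_simple)
    show "\<forall>a\<in>range (\<lambda>n. torus \<times> {0..real n}). emeasure m a \<noteq> \<infinity>"
      using fin by (auto simp: less_top)
  qed simp
  have "integrable m (indicator (torus \<times> {0..R}) :: _ \<Rightarrow> real)"
    using fin slab_sets by (intro integrable_real_indicator) (auto simp: s)
  moreover have "(indicator {..R} (snd z) :: real) = indicator (torus \<times> {0..R}) z" if "z \<in> space m" for z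
    using that by (auto simp: sp spacetime_def split: split_indicator)
  ultimately show "integrable m (\<lambda>z. indicator {..R} (snd z) :: real)"
    by (simp cong: Bochner_Integration.integrable_cong)
qed

lemma norm_le_total_variation:
  assumes B: "B \<in> bounded_borel" "B \<subseteq> A"
  shows "ennreal (norm (m B)) \<le> total_variation m A"
proof -
  define F where "F n = (if n = 0 then B else {})" for n :: nat
  have F: "F \<in> {B :: nat \<Rightarrow> _. disjoint_family B \<and> (\<forall>n. B n \<in> bounded_borel \<and> B n \<subseteq> A)}"
    using B by (auto simp: F_def disjoint_family_on_def bounded_borel_def)
  have "ennreal (norm (m B)) = (\<Sum>n\<in>{0}. ennreal (norm (m (F n))))" by (simp add: F_def)
  also have "\<dots> \<le> (\<Sum>n. ennreal (norm (m (F n))))" by (rule sum_le_suminf) auto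
  also have "\<dots> \<le> total_variation m A"
    unfolding total_variation_def by (rule SUP_upper[OF F])
  finally show ?thesis .
qed

text \<open>
  If the set function in the definition of the positive part were no measure, the definition would
  produce the zero measure; the bound holds in either case. It makes the
  two parts locally finite, and then Fubini's theorem applies to them.
\<close>

lemma emeasure_pos_part_le: "emeasure (pos_part m i) A \<le> total_variation m A"
proof -
  have "(SUP B \<in> {B \<in> bounded_borel. B \<subseteq> A}. ennreal (m B $ i)) \<le> total_variation m A"
  proof (rule SUP_least)
    fix B assume B: "B \<in> {B \<in> bounded_borel. B \<subseteq> A}"
    have "ennreal (m B $ i) \<le> ennreal (norm (m B))"
      by (intro ennreal_leI order_trans[OF abs_ge_self component_le_norm_cart])
    also have "\<dots> \<le> total_variation m A" using B by (intro norm_le_total_variation) auto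
    finally show "ennreal (m B $ i) \<le> total_variation m A" .
  qed
  then show ?thesis
    unfolding pos_part_def emeasure_measure_of_conv by simp
qed

lemma total_variation_uminus: "total_variation (\<lambda>A. - m A) = total_variation m"
  by (simp add: total_variation_def fun_eq_iff)

lemma radon_pos_part:
  fixes m :: "((real ^ 'd) \<times> real) set \<Rightarrow> real ^ 'd"
  assumes "\<And>T. total_variation m (torus \<times> {0..T}) < \<infinity>"
  shows "radon_measure (pos_part m i)"
  unfolding radon_measure_def
proof (intro conjI allI)
  show "sets (pos_part m i) = sets borel_spacetime"
    using sets.sigma_sets_eq[of "borel_spacetime :: ((real ^ 'd) \<times> real) measure"]
      sets.space_closed[of "borel_spacetime :: ((real ^ 'd) \<times> real) measure"]
    by (simp add: pos_part_def sets_measure_of)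
  show "emeasure (pos_part m i) (torus \<times> {0..T}) < \<infinity>" for T
    using emeasure_pos_part_le assms by (rule le_less_trans)
qed

lemma (in pair_sigma_finite) integrable_dominated_by_product:
  fixes F :: "'a \<times> 'b \<Rightarrow> real"
  assumes F: "F \<in> borel_measurable (M1 \<Otimes>\<^sub>M M2)"
    and g1: "integrable M1 g1" and g2: "integrable M2 g2"
    and le: "\<And>p q. p \<in> space M1 \<Longrightarrow> q \<in> space M2 \<Longrightarrow> \<bar>F (p, q)\<bar> \<le> c * (g1 p * g2 q)"
  shows "integrable (M1 \<Otimes>\<^sub>M M2) F"
proof (rule Bochner_Integration.integrable_bound)
  show "integrable (M1 \<Otimes>\<^sub>M M2) (\<lambda>pq. c * (case pq of (p, q) \<Rightarrow> g1 p * g2 q))"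
    by (intro integrable_mult_right integrable_times g1 g2)
  show "AE pq in M1 \<Otimes>\<^sub>M M2. norm (F pq) \<le> norm (c * (case pq of (p, q) \<Rightarrow> g1 p * g2 q))"
    by (rule AE_I2) (use le in \<open>force simp: space_pair_measure intro: order_trans[OF _ abs_ge_self]\<close>)
qed (rule F)

lemma abs_diff_weight: "\<bar>\<bar>l - k\<bar>\<bar> \<le> 1 * ((1 + \<bar>l\<bar>) * (1 + \<bar>k\<bar>))" for l k :: real
proof -
  have "0 \<le> \<bar>l\<bar> * \<bar>k\<bar>" by simp
  moreover have "1 * ((1 + \<bar>l\<bar>) * (1 + \<bar>k\<bar>)) = 1 + \<bar>l\<bar> + \<bar>k\<bar> + \<bar>l\<bar> * \<bar>k\<bar>" by (simp add: algebra_simps)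
  ultimately show ?thesis using abs_triangle_ineq4[of l k] by linarith
qed

section \<open>Entropy solutions tested with product functions\<close>

text \<open>
  The hypotheses on one solution that enter the comparison argument: those on the generating sequence and on
  the initial datum are added where they are used.
\<close>

locale entropy_solution =
  fixes f :: "real \<Rightarrow> real ^ 'd" and \<nu> :: "(real ^ 'd) \<times> real \<Rightarrow> real measure"
    and m1 :: "((real ^ 'd) \<times> real) measure" and m2 :: "((real ^ 'd) \<times> real) set \<Rightarrow> real ^ 'd"
  assumes f_continuous: "continuous_on UNIV f"
    and f_growth: "\<exists>C>0. \<forall>l. norm (f l) \<le> C * (1 + \<bar>l\<bar>)"
    and young: "young_measure \<nu>"
    and radon: "radon_measure m1"
    and first_moment: "\<And>T. (\<integral>\<^sup>+z\<in>torus \<times> {0..T}. (\<integral>\<^sup>+l. ennreal \<bar>l\<bar> \<partial>\<nu> z) \<partial>lebesgue) < \<infinity>"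
    and entropy: "entropy_inequality f \<nu> m1 m2"
    and variation: "\<exists>C>0. \<forall>A\<in>sets borel. A \<subseteq> {0..} \<longrightarrow>
        total_variation m2 (torus \<times> A) \<le> ennreal C * emeasure m1 (torus \<times> A)"

sublocale entropy_solution \<subseteq> markov_kernel "lebesgue_on spacetime" \<nu>
  by (rule young_measure_markov_kernel[OF young])

context entropy_solution
begin

abbreviation \<Lambda> :: "((real ^ 'd) \<times> real) measure" where "\<Lambda> \<equiv> lebesgue_on spacetime"

text \<open>
  An integrable majorant for integrands of linear growth that live in \<open>t \<le> R\<close>.
\<close>

definition weight :: "real \<Rightarrow> ((real ^ 'd) \<times> real) \<times> real \<Rightarrow> real" where
  "weight R p = (1 + \<bar>snd p\<bar>) * indicator {..R} (snd (fst p))"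

lemma f_borel [measurable]: "f \<in> borel_measurable borel"
  by (rule borel_measurable_continuous_onI[OF f_continuous])

lemma coordinates_measurable [measurable]:
  "(\<lambda>p. fst (fst p)) \<in> borel_measurable joint" "(\<lambda>p. snd (fst p)) \<in> borel_measurable joint"
  "snd \<in> borel_measurable joint"
  by measurable

lemma flux_component_measurable [measurable]:
  assumes [measurable]: "g \<in> borel_measurable N" "h \<in> borel_measurable N"
  shows "(\<lambda>x. entropy_flux f (g x) (h x) $ i) \<in> borel_measurable N"
proof -
  have [measurable]: "(\<lambda>l. f l $ i) \<in> borel_measurable borel"
    by (intro borel_measurable_continuous_onI continuous_on_component f_continuous)
  show ?thesis by (simp add: entropy_flux_def)
qed

lemma indicator_integrable: "integrable \<Lambda> (\<lambda>z. indicator {..R} (snd z) :: real)"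
proof -
  have "emeasure lborel (torus \<times> {0..R} :: ((real ^ 'd) \<times> real) set) < \<infinity>"
    by (intro emeasure_bounded_finite bounded_Times torus_bounded(1) bounded_closed_interval)
  then have "emeasure lebesgue (torus \<times> {0..R} :: ((real ^ 'd) \<times> real) set) < \<infinity>"
    by simp
  moreover have sub: "torus \<times> {0..R} \<subseteq> (spacetime :: ((real ^ 'd) \<times> real) set)"
    by (auto simp: spacetime_def)
  ultimately have "integrable \<Lambda> (indicator (torus \<times> {0..R}) :: _ \<Rightarrow> real)"
    by (intro integrable_real_indicator) (simp_all add: emeasure_restrict_space sets_restrict_space_iff sub)
  moreover have "(indicator {..R} (snd z) :: real) = indicator (torus \<times> {0..R}) z" if "z \<in> space \<Lambda>" for z
    using that by (auto simp: spacetime_def split: split_indicator)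
  ultimately show ?thesis
    using Bochner_Integration.integrable_cong[OF refl, of \<Lambda>] by (metis (no_types, lifting))
qed

lemma weight_integrable: "integrable joint (weight R)"
proof -
  have 1: "integrable joint (\<lambda>p. indicator {..R} (snd (fst p)) :: real)"
    using integrable_joint_fst(1)[OF indicator_integrable] .
  have "(\<integral>\<^sup>+p. ennreal (\<bar>snd p\<bar> * indicator {..R} (snd (fst p))) \<partial>joint)
      = (\<integral>\<^sup>+z. \<integral>\<^sup>+l. ennreal (\<bar>l\<bar> * indicator {..R} (snd z)) \<partial>\<nu> z \<partial>\<Lambda>)"
    by (subst nn_integral_joint) auto
  also have "\<dots> = (\<integral>\<^sup>+z. (\<integral>\<^sup>+l. ennreal \<bar>l\<bar> \<partial>\<nu> z) * indicator (torus \<times> {0..R}) z \<partial>\<Lambda>)"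
    by (intro nn_integral_cong) (auto simp: spacetime_def split: split_indicator)
  also have "\<dots> = (\<integral>\<^sup>+z. (\<integral>\<^sup>+l. ennreal \<bar>l\<bar> \<partial>\<nu> z) * indicator (torus \<times> {0..R}) z \<partial>lebesgue)"
    using spacetime_borel[where ?'a='d]
    by (subst nn_integral_restrict_space) (auto intro!: nn_integral_cong simp: spacetime_def split: split_indicator)
  also have "\<dots> < \<infinity>" by (rule first_moment)
  finally have 2: "integrable joint (\<lambda>p. \<bar>snd p\<bar> * indicator {..R} (snd (fst p)))"
    by (intro integrableI_nonneg) auto
  show ?thesis
    using Bochner_Integration.integrable_add[OF 1 2] by (simp add: weight_def[abs_def] distrib_right)
qed

lemma flux_bound:
  obtains C where "C > 0" "\<And>l k i. \<bar>entropy_flux f l k $ i\<bar> \<le> C * ((1 + \<bar>l\<bar>) * (1 + \<bar>k\<bar>))"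
    "\<And>l k. norm (entropy_flux f l k) \<le> C * ((1 + \<bar>l\<bar>) * (1 + \<bar>k\<bar>))"
proof -
  obtain C where C: "C > 0" "\<And>l. norm (f l) \<le> C * (1 + \<bar>l\<bar>)" using f_growth by blast
  have *: "norm (entropy_flux f l k) \<le> (2 * C) * ((1 + \<bar>l\<bar>) * (1 + \<bar>k\<bar>))" for l k
  proof -
    have "norm (entropy_flux f l k) \<le> norm (f l) + norm (f k)"
      unfolding entropy_flux_def using norm_triangle_ineq4[of "f l" "f k"]
      by (auto simp: sgn_if add_increasing norm_minus_commute)
    also have "\<dots> \<le> C * (1 + \<bar>l\<bar>) + C * (1 + \<bar>k\<bar>)" by (intro add_mono C)
    also have "\<dots> = C * ((1 + \<bar>l\<bar>) + (1 + \<bar>k\<bar>))" by (simp add: distrib_left)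
    also have "\<dots> \<le> C * (2 * ((1 + \<bar>l\<bar>) * (1 + \<bar>k\<bar>)))"
    proof (rule mult_left_mono)
      have "0 \<le> \<bar>l\<bar> * \<bar>k\<bar>" by simp
      then show "(1 + \<bar>l\<bar>) + (1 + \<bar>k\<bar>) \<le> 2 * ((1 + \<bar>l\<bar>) * (1 + \<bar>k\<bar>))"
        by (simp add: algebra_simps)
    qed (use C in simp)
    finally show ?thesis by simp
  qed
  show ?thesis
  proof (rule that[of "2 * C"])
    show "\<bar>entropy_flux f l k $ i\<bar> \<le> 2 * C * ((1 + \<bar>l\<bar>) * (1 + \<bar>k\<bar>))" for l k i
      using order_trans[OF component_le_norm_cart *] .
  qed (use C * in auto)
qed

lemma joint_integrable_bound:
  fixes F :: "((real ^ 'd) \<times> real) \<times> real \<Rightarrow> real"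
  assumes "F \<in> borel_measurable joint" "\<And>p. \<bar>F p\<bar> \<le> c * weight R p"
  shows "integrable joint F"
proof (rule Bochner_Integration.integrable_bound)
  show "integrable joint (\<lambda>p. c * weight R p)" by (intro integrable_mult_right weight_integrable)
  show "AE p in joint. norm (F p) \<le> norm (c * weight R p)"
    using assms(2) by (intro AE_I2) (auto intro: order_trans[OF _ abs_ge_self])
qed (rule assms)

lemma flux_radon: "radon_measure (pos_part m2 i)" "radon_measure (neg_part m2 i)"
proof -
  obtain C where C: "C > 0" "\<And>A. A \<in> sets borel \<Longrightarrow> A \<subseteq> {0..} \<Longrightarrow>
      total_variation m2 (torus \<times> A) \<le> ennreal C * emeasure m1 (torus \<times> A)"
    using variation by blast
  have "total_variation m2 (torus \<times> {0..T}) < \<infinity>" for T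
  proof -
    have "total_variation m2 (torus \<times> {0..T}) \<le> ennreal C * emeasure m1 (torus \<times> {0..T})"
      by (rule C) auto
    also have "\<dots> < \<infinity>" using radon by (simp add: radon_measure_def ennreal_mult_less_top)
    finally show ?thesis .
  qed
  then show "radon_measure (pos_part m2 i)" "radon_measure (neg_part m2 i)"
    unfolding neg_part_def by (auto intro!: radon_pos_part simp: total_variation_uminus)
qed

text \<open>
  The entropy inequality for the test function \<open>a(t) \<rho>(x - y)\<close>, rewritten with the joint measure. The
  vector-valued flux is taken apart into components, after which all integrals are real.
\<close>

lemma entropy_product_test:
  fixes y :: "real ^ 'd" and k :: real
  assumes a: "smooth a" "\<And>t. (a has_real_derivative a' t) (at t)" "\<And>t. a t \<ge> 0"
    and supp: "0 < lo" "\<And>t. t \<notin> {lo..hi} \<Longrightarrow> a t = 0" "\<And>t. t \<notin> {lo..hi} \<Longrightarrow> a' t = 0"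
    and bd: "\<And>t. \<bar>a t\<bar> \<le> c" "\<And>t. \<bar>a' t\<bar> \<le> c"
    and \<delta>: "\<delta> > 0"
  shows "0 \<le> (\<integral>p. \<bar>snd p - k\<bar> * (a' (snd (fst p)) * mollifier \<delta> (fst (fst p) - y)) \<partial>joint)
     + (\<integral>z. a' (snd z) * mollifier \<delta> (fst z - y) \<partial>m1)
     + (\<Sum>i\<in>UNIV. \<integral>p. entropy_flux f (snd p) k $ i * (a (snd (fst p)) * mollifier_grad \<delta> i (fst (fst p) - y)) \<partial>joint)
     + (\<Sum>i\<in>UNIV. (\<integral>z. a (snd z) * mollifier_grad \<delta> i (fst z - y) \<partial>pos_part m2 i)
          - (\<integral>z. a (snd z) * mollifier_grad \<delta> i (fst z - y) \<partial>neg_part m2 i))"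
proof -
  define \<phi> where "\<phi> = (\<lambda>z. a (snd z) * mollifier \<delta> (fst z - y))"
  note \<phi> = product_test_function[OF a(1,2) supp(1,2), where \<delta>=\<delta> and y=y, folded \<phi>_def]
  have "continuous_on UNIV a'" by (intro smooth_continuous smooth_real_deriv[OF a(2,1)])
  then have [measurable]: "a' \<in> borel_measurable borel" "a \<in> borel_measurable borel"
    using smooth_continuous[OF a(1)] by (auto intro: borel_measurable_continuous_onI)
  obtain D where D: "D > 0" "\<And>x :: real ^ 'd. \<bar>mollifier \<delta> x\<bar> \<le> D"
      "\<And>(x :: real ^ 'd) i. \<bar>mollifier_grad \<delta> i x\<bar> \<le> D"
    using mollifier_bounded[OF \<delta>, where ?'d='d] by blast
  obtain C where C: "C > 0" "\<And>l k i. \<bar>entropy_flux f l k $ i\<bar> \<le> C * ((1 + \<bar>l\<bar>) * (1 + \<bar>k\<bar>))"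
    "\<And>l k. norm (entropy_flux f l k) \<le> C * ((1 + \<bar>l\<bar>) * (1 + \<bar>k\<bar>))"
    using flux_bound by blast
  have c: "c \<ge> 0" using bd(1)[of 0] by simp
  have bound: "\<bar>X * (b * M)\<bar> \<le> (K * (1 + \<bar>k\<bar>) * (c * D)) * weight hi p"
    if "\<bar>X\<bar> \<le> K * ((1 + \<bar>snd p\<bar>) * (1 + \<bar>k\<bar>))" "K \<ge> 0" "\<bar>b\<bar> \<le> c" "\<bar>M\<bar> \<le> D"
      "snd (fst p) > hi \<Longrightarrow> b = 0" for X b M K and p :: "((real ^ 'd) \<times> real) \<times> real"
  proof (cases "snd (fst p) \<le> hi")
    case True
    have "\<bar>X * (b * M)\<bar> \<le> (K * ((1 + \<bar>snd p\<bar>) * (1 + \<bar>k\<bar>))) * (c * D)"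
      unfolding abs_mult using that D c by (intro mult_mono) auto
    with True show ?thesis by (simp add: weight_def mult_ac)
  next
    case False
    then have "b = 0" using that by simp
    with False show ?thesis by (simp add: weight_def)
  qed
  have i1: "integrable joint (\<lambda>p. \<bar>snd p - k\<bar> * (a' (snd (fst p)) * mollifier \<delta> (fst (fst p) - y)))"
    by (rule joint_integrable_bound[OF _ bound[where K=1]]) (use abs_diff_weight[of _ k] bd D supp in auto)
  have i3: "integrable joint (\<lambda>p. entropy_flux f (snd p) k $ i * (a (snd (fst p)) * mollifier_grad \<delta> i (fst (fst p) - y)))" for i
    by (rule joint_integrable_bound[OF _ bound[where K=C]]) (use C bd D supp in auto)
  have dt_\<phi>: "dt \<phi> z = a' (snd z) * mollifier \<delta> (fst z - y)" for z by (rule \<phi>(2))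
  have grad_\<phi>: "grad_x \<phi> z $ i = a (snd z) * mollifier_grad \<delta> i (fst z - y)" for z i by (rule \<phi>(3))
  have I1: "(\<integral>z. (\<integral>l. \<bar>l - k\<bar> \<partial>\<nu> z) * dt \<phi> z \<partial>\<Lambda>)
      = (\<integral>p. \<bar>snd p - k\<bar> * (a' (snd (fst p)) * mollifier \<delta> (fst (fst p) - y)) \<partial>joint)"
    unfolding dt_\<phi> by (subst integral_joint[OF i1]) simp
  have flux_int: "AE z in \<Lambda>. snd z \<le> hi \<longrightarrow> integrable (\<nu> z) (\<lambda>l. entropy_flux f l k)"
  proof -
    have flux_m: "(\<lambda>l. entropy_flux f l k) \<in> borel_measurable borel"
      unfolding entropy_flux_def by measurable
    have "integrable joint (weight hi)" by (rule weight_integrable)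
    from AE_integrable_joint[OF this] show ?thesis
      using AE_space
    proof eventually_elim
      case (elim z)
      show ?case
      proof
        assume t: "snd z \<le> hi"
        with elim have i: "integrable (\<nu> z) (\<lambda>l. 1 + \<bar>l\<bar>)" by (simp add: weight_def)
        show "integrable (\<nu> z) (\<lambda>l. entropy_flux f l k)"
        proof (rule Bochner_Integration.integrable_bound)
          show "integrable (\<nu> z) (\<lambda>l. (C * (1 + \<bar>k\<bar>)) * (1 + \<bar>l\<bar>))"
            by (rule integrable_mult_right[OF i])
          show "(\<lambda>l. entropy_flux f l k) \<in> borel_measurable (\<nu> z)"
            using flux_m elim(2) by (simp cong: measurable_cong_sets)
          show "AE l in \<nu> z. norm (entropy_flux f l k) \<le> norm ((C * (1 + \<bar>k\<bar>)) * (1 + \<bar>l\<bar>))"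
          proof (rule AE_I2)
            fix l
            have "norm (entropy_flux f l k) \<le> (C * (1 + \<bar>k\<bar>)) * (1 + \<bar>l\<bar>)"
              using C(3)[of l k] by (simp add: mult_ac)
            then show "norm (entropy_flux f l k) \<le> norm ((C * (1 + \<bar>k\<bar>)) * (1 + \<bar>l\<bar>))"
              by (rule order_trans) simp
          qed
        qed
      qed
    qed
  qed
  have "(\<integral>z. (\<integral>l. entropy_flux f l k \<partial>\<nu> z) \<bullet> grad_x \<phi> z \<partial>\<Lambda>)
     = (\<integral>z. (\<Sum>i\<in>UNIV. \<integral>l. entropy_flux f l k $ i * (a (snd z) * mollifier_grad \<delta> i (fst z - y)) \<partial>\<nu> z) \<partial>\<Lambda>)"
  proof -
    have *: "(\<integral>l. entropy_flux f l k \<partial>\<nu> z) \<bullet> grad_x \<phi> z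
      = (\<Sum>i\<in>UNIV. \<integral>l. entropy_flux f l k $ i * (a (snd z) * mollifier_grad \<delta> i (fst z - y)) \<partial>\<nu> z)"
      if "snd z \<le> hi \<longrightarrow> integrable (\<nu> z) (\<lambda>l. entropy_flux f l k)" for z
    proof (cases "snd z \<le> hi")
      case True
      with that have i: "integrable (\<nu> z) (\<lambda>l. entropy_flux f l k)" by simp
      have "(\<integral>l. entropy_flux f l k \<partial>\<nu> z) $ i = (\<integral>l. entropy_flux f l k $ i \<partial>\<nu> z)" for i
        using integral_bounded_linear[OF bounded_linear_vec_nth i] by simp
      then show ?thesis by (simp add: inner_vec_def grad_\<phi>)
    next
      case False
      then have "a (snd z) = 0" using supp by auto
      then show ?thesis by (simp add: inner_vec_def grad_\<phi>)
    qed
    have m: "(\<lambda>z. \<Sum>i\<in>UNIV. \<integral>l. entropy_flux f l k $ i * (a (snd z) * mollifier_grad \<delta> i (fst z - y)) \<partial>\<nu> z)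
        \<in> borel_measurable \<Lambda>"
      using borel_measurable_integrable[OF integrable_integral_joint[OF i3]]
      by (intro borel_measurable_sum) simp
    have ae: "AE z in \<Lambda>. (\<integral>l. entropy_flux f l k \<partial>\<nu> z) \<bullet> grad_x \<phi> z
      = (\<Sum>i\<in>UNIV. \<integral>l. entropy_flux f l k $ i * (a (snd z) * mollifier_grad \<delta> i (fst z - y)) \<partial>\<nu> z)"
      using flux_int by eventually_elim (rule *)
    have "(\<lambda>z. (\<integral>l. entropy_flux f l k \<partial>\<nu> z) \<bullet> grad_x \<phi> z) \<in> borel_measurable \<Lambda>"
      by (rule lebesgue_on_AE_measurable[OF _ ae m]) auto
    then show ?thesis using m ae by (intro integral_cong_AE)
  qed
  also have "\<dots> = (\<Sum>i\<in>UNIV. \<integral>z. \<integral>l. entropy_flux f l k $ i * (a (snd z) * mollifier_grad \<delta> i (fst z - y)) \<partial>\<nu> z \<partial>\<Lambda>)"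
    using integrable_integral_joint[OF i3] by (intro Bochner_Integration.integral_sum) simp
  also have "\<dots> = (\<Sum>i\<in>UNIV. \<integral>p. entropy_flux f (snd p) k $ i * (a (snd (fst p)) * mollifier_grad \<delta> i (fst (fst p) - y)) \<partial>joint)"
    by (intro sum.cong refl) (simp add: integral_joint[OF i3])
  finally have I3: "(\<integral>z. (\<integral>l. entropy_flux f l k \<partial>\<nu> z) \<bullet> grad_x \<phi> z \<partial>\<Lambda>) = \<dots>" .
  have "0 \<le> \<phi> z" for z unfolding \<phi>_def by (intro mult_nonneg_nonneg a(3) mollifier_nonneg[OF \<delta>])
  then have "0 \<le> (\<integral>z. (\<integral>l. \<bar>l - k\<bar> \<partial>\<nu> z) * dt \<phi> z \<partial>\<Lambda>) + (\<integral>z. dt \<phi> z \<partial>m1)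
        + (\<integral>z. (\<integral>l. entropy_flux f l k \<partial>\<nu> z) \<bullet> grad_x \<phi> z \<partial>\<Lambda>) + dot_integral m2 (grad_x \<phi>)"
    using entropy \<phi>(1) unfolding entropy_inequality_def by blast
  then show ?thesis
    unfolding I1 I3 dot_integral_def vector_integral_def by (simp add: dt_\<phi> grad_\<phi>)
qed

end

section \<open>Doubling of variables\<close>

lemma bounded_if_compact_support:
  fixes h :: "real \<Rightarrow> real"
  assumes "continuous_on UNIV h" and zero: "\<And>t. t \<notin> {a..b} \<Longrightarrow> h t = 0"
  obtains c where "c > 0" "\<And>t. \<bar>h t\<bar> \<le> c"
proof -
  have "compact (h ` {a..b})"
    by (rule compact_continuous_image[OF continuous_on_subset[OF assms(1)]]) auto
  then obtain c where c: "\<And>x. x \<in> {a..b} \<Longrightarrow> norm (h x) \<le> c"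
    using compact_imp_bounded bounded_iff by (metis imageI)
  have "\<bar>h x\<bar> \<le> max 1 c" for x
    using c[of x] zero[of x] by (cases "x \<in> {a..b}") auto
  then show ?thesis by (intro that[of "max 1 c"]) auto
qed

text \<open>
  All integrands of the doubling argument have this form: a coefficient of at most linear growth in
  each of the two states, times a bounded kernel in the differences of the positions that is supported in bounded times.
\<close>

lemma kernel_integrable:
  fixes pa :: "'a \<Rightarrow> (real ^ 'd) \<times> real" and pb :: "'b \<Rightarrow> (real ^ 'd) \<times> real"
    and c :: "'a \<Rightarrow> 'b \<Rightarrow> real" and b :: "real \<Rightarrow> real \<Rightarrow> real" and g :: "real ^ 'd \<Rightarrow> real"
  assumes P: "pair_sigma_finite M1 M2"
    and [measurable]: "(\<lambda>p. fst (pa p)) \<in> borel_measurable M1" "(\<lambda>p. snd (pa p)) \<in> borel_measurable M1"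
      "(\<lambda>q. fst (pb q)) \<in> borel_measurable M2" "(\<lambda>q. snd (pb q)) \<in> borel_measurable M2"
      "(\<lambda>(p, q). c p q) \<in> borel_measurable (M1 \<Otimes>\<^sub>M M2)"
      "(\<lambda>(t, s). b t s) \<in> borel_measurable (borel \<Otimes>\<^sub>M borel)" "g \<in> borel_measurable borel"
    and c: "\<And>p q. \<bar>c p q\<bar> \<le> K * (wa p * wb q)"
    and w: "integrable M1 (\<lambda>p. wa p * indicator {..R} (snd (pa p)))"
      "integrable M2 (\<lambda>q. wb q * indicator {..R} (snd (pb q)))"
    and b: "\<And>t s. \<bar>b t s\<bar> \<le> B" "\<And>t s. b t s \<noteq> 0 \<Longrightarrow> t \<le> R \<and> s \<le> R"
    and g: "\<And>x. \<bar>g x\<bar> \<le> D"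
  shows "integrable (M1 \<Otimes>\<^sub>M M2) (\<lambda>(p, q). c p q * (b (snd (pa p)) (snd (pb q)) * g (fst (pa p) - fst (pb q))))"
proof (rule pair_sigma_finite.integrable_dominated_by_product[OF P _ w])
  fix p q
  have B: "0 \<le> B" and D: "0 \<le> D" using b(1)[of 0 0] g[of 0] by auto
  let ?L = "\<bar>(case (p, q) of (p, q) \<Rightarrow> c p q * (b (snd (pa p)) (snd (pb q)) * g (fst (pa p) - fst (pb q))))\<bar>"
  show "?L \<le> (K * (B * D)) * (wa p * indicator {..R} (snd (pa p)) * (wb q * indicator {..R} (snd (pb q))))"
  proof (cases "b (snd (pa p)) (snd (pb q)) = 0")
    case True
    have "0 \<le> K * (wa p * wb q)" using c[of p q] by simp
    then have "0 \<le> K * (wa p * wb q) * (B * D * (indicator {..R} (snd (pa p)) * indicator {..R} (snd (pb q))))"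
      by (rule mult_nonneg_nonneg) (use B D in auto)
    with True show ?thesis by (simp add: mult_ac)
  next
    case False
    from b(2)[OF this] have ind: "indicator {..R} (snd (pa p)) = (1 :: real)" "indicator {..R} (snd (pb q)) = (1 :: real)"
      by auto
    have "?L \<le> (K * (wa p * wb q)) * (B * D)"
      unfolding prod.case abs_mult
      by (intro mult_mono c b(1) g mult_nonneg_nonneg B D order_trans[OF abs_ge_zero c]) auto
    then show ?thesis unfolding ind by (simp add: mult_ac)
  qed
qed measurable

lemma entropy_flux_commute: "entropy_flux f l k = entropy_flux f k l"
proof -
  have "sgn (l - k) = - sgn (k - l)" using sgn_minus[of "k - l"] by simp
  then show ?thesis by (simp add: entropy_flux_def algebra_simps)
qed

text \<open>
  The parameters are the width \<open>\<delta>\<close> of the spatial mollifier, the time scale \<open>T\<close> of the initial layer and of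
  the smoothing in time, and the time \<open>\<tau>\<close> near which the two solutions are compared.
\<close>

locale two_solutions =
  S1: entropy_solution f \<nu> m1 m2 + S2: entropy_solution f \<sigma> m1' m2'
  for f :: "real \<Rightarrow> real ^ 'd" and \<nu> m1 m2 \<sigma> m1' m2' +
  fixes \<delta> T \<tau> :: real
  assumes \<delta>: "\<delta> > 0" and T: "T > 0" and \<tau>: "\<tau> > 0"
begin

abbreviation "J1 \<equiv> S1.joint"
abbreviation "J2 \<equiv> S2.joint"
abbreviation "\<eta> \<equiv> cutoff \<tau> T"
abbreviation "\<eta>' \<equiv> cutoff_deriv \<tau> T"
abbreviation "\<omega> \<equiv> time_kernel T"
abbreviation "\<omega>' \<equiv> time_kernel_deriv T"
abbreviation "\<rho> \<equiv> (mollifier \<delta> :: real ^ 'd \<Rightarrow> real)"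
abbreviation "G i \<equiv> (mollifier_grad \<delta> i :: real ^ 'd \<Rightarrow> real)"
abbreviation "R \<equiv> \<tau> + 1 + T"

text \<open>
  The time factor \<open>b0\<close> of the test function, its derivatives \<open>bt\<close> in \<open>t\<close> and \<open>bs\<close> in \<open>s\<close>, and their sum \<open>bd\<close>,
  in which the derivative of the time kernel has cancelled.
\<close>

definition "b0 t s = \<eta> t * \<omega> (s - t)"
definition "bt t s = \<eta>' t * \<omega> (s - t) - \<eta> t * \<omega>' (s - t)"
definition "bs t s = \<eta> t * \<omega>' (s - t)"
definition "bd t s = \<eta>' t * \<omega> (s - t)"

lemma b_measurable [measurable]:
  "(\<lambda>(t, s). b0 t s) \<in> borel_measurable (borel \<Otimes>\<^sub>M borel)" "(\<lambda>(t, s). bt t s) \<in> borel_measurable (borel \<Otimes>\<^sub>M borel)"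
  "(\<lambda>(t, s). bs t s) \<in> borel_measurable (borel \<Otimes>\<^sub>M borel)" "(\<lambda>(t, s). bd t s) \<in> borel_measurable (borel \<Otimes>\<^sub>M borel)"
  unfolding b0_def bt_def bs_def bd_def by measurable

lemma b_support:
  assumes "b0 t s \<noteq> 0 \<or> bt t s \<noteq> 0 \<or> bs t s \<noteq> 0 \<or> bd t s \<noteq> 0"
  shows "T \<le> t" "t \<le> \<tau> + 1" "T \<le> s" "s \<le> R" "t \<le> R"
proof -
  from assms have "\<eta> t \<noteq> 0 \<or> \<eta>' t \<noteq> 0" "\<omega> (s - t) \<noteq> 0 \<or> \<omega>' (s - t) \<noteq> 0"
    by (auto simp: b0_def bt_def bs_def bd_def)
  then have "T \<le> t \<and> t \<le> \<tau> + 1" "0 \<le> s - t \<and> s - t \<le> T"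
    using cutoff_zero[OF T, of t \<tau>] cutoff_deriv_zero[OF T, of t \<tau>] time_kernel_zero[OF T, of "s - t"]
      time_kernel_deriv_zero[OF T, of "s - t"] by linarith+
  then show "T \<le> t" "t \<le> \<tau> + 1" "T \<le> s" "s \<le> R" "t \<le> R" using T by linarith+
qed

lemma b_bounded:
  obtains B where "B > 0" "\<And>t s. \<bar>b0 t s\<bar> \<le> B" "\<And>t s. \<bar>bt t s\<bar> \<le> B" "\<And>t s. \<bar>bs t s\<bar> \<le> B" "\<And>t s. \<bar>bd t s\<bar> \<le> B"
proof -
  obtain c1 where c1: "c1 > 0" "\<And>t. \<bar>\<eta> t\<bar> \<le> c1"
    by (rule bounded_if_compact_support[OF continuous_cutoff, of T "\<tau> + 1" \<tau> T]) (use T cutoff_zero[of T] in auto)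
  obtain c2 where c2: "c2 > 0" "\<And>t. \<bar>\<eta>' t\<bar> \<le> c2"
    by (rule bounded_if_compact_support[OF continuous_cutoff_deriv, of T "\<tau> + 1" \<tau> T]) (use T cutoff_deriv_zero[of T] in auto)
  obtain c3 where c3: "c3 > 0" "\<And>t. \<bar>\<omega> t\<bar> \<le> c3"
    by (rule bounded_if_compact_support[OF continuous_time_kernel, of 0 T T]) (use T time_kernel_zero[of T] in auto)
  obtain c4 where c4: "c4 > 0" "\<And>t. \<bar>\<omega>' t\<bar> \<le> c4"
    by (rule bounded_if_compact_support[OF continuous_time_kernel_deriv, of 0 T T]) (use T time_kernel_deriv_zero[of T] in auto)
  have p: "\<bar>\<eta> t * \<omega> r\<bar> \<le> c1 * c3" "\<bar>\<eta>' t * \<omega> r\<bar> \<le> c2 * c3" "\<bar>\<eta> t * \<omega>' r\<bar> \<le> c1 * c4" for t r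
    unfolding abs_mult using c1 c2 c3 c4 by (auto intro!: mult_mono)
  have n: "0 \<le> c1 * c3" "0 \<le> c2 * c3" "0 \<le> c1 * c4" using c1 c2 c3 c4 by auto
  show ?thesis
  proof (rule that[of "1 + c1 * c3 + c2 * c3 + c1 * c4"])
    fix t s
    show "\<bar>b0 t s\<bar> \<le> 1 + c1 * c3 + c2 * c3 + c1 * c4" "\<bar>bt t s\<bar> \<le> 1 + c1 * c3 + c2 * c3 + c1 * c4"
      "\<bar>bs t s\<bar> \<le> 1 + c1 * c3 + c2 * c3 + c1 * c4" "\<bar>bd t s\<bar> \<le> 1 + c1 * c3 + c2 * c3 + c1 * c4"
      using p[of t "s - t"] n unfolding b0_def bt_def bs_def bd_def by linarith+
  qed (use n in linarith)
qed

lemma time_integrals: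
  assumes t: "t \<ge> 0"
  shows "(\<integral>s. bt t s * indicator {0..} s \<partial>lborel) = \<eta>' t" "integrable lborel (\<lambda>s. bt t s * indicator {0..} s)"
    and "integrable lborel (\<lambda>s. b0 t s * indicator {0..} s)"
proof -
  have 1: "(\<integral>s. \<omega> (s - t) * indicator {0..} s \<partial>lborel) = 1"
  proof -
    have "(\<integral>s. \<omega> (s - t) * indicator {0..} s \<partial>lborel) = enn2real (\<integral>\<^sup>+s. ennreal (\<omega> (s - t) * indicator {0..} s) \<partial>lborel)"
      using time_kernel_nonneg[OF T] by (intro integral_eq_nn_integral) auto
    also have "(\<integral>\<^sup>+s. ennreal (\<omega> (s - t) * indicator {0..} s) \<partial>lborel) = 1"
      by (subst time_kernel_mass_right[OF T t, symmetric]) (intro nn_integral_cong, simp split: split_indicator)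
    finally show ?thesis by simp
  qed
  have i1: "integrable lborel (\<lambda>s. \<omega> (s - t) * indicator {0..} s)"
    using 1 not_integrable_integral_eq by fastforce
  have d: "((\<lambda>s. \<omega> (s - t)) has_real_derivative \<omega>' (s - t)) (at s)" for s
  proof -
    have "((\<lambda>s. s - t) has_real_derivative 1 - 0) (at s)" by (intro DERIV_diff DERIV_ident DERIV_const)
    from DERIV_chain'[OF this time_kernel_has_derivative] show ?thesis by simp
  qed
  have c: "continuous_on UNIV (\<lambda>s. \<omega>' (s - t))"
    by (rule continuous_on_compose2[OF continuous_time_kernel_deriv[of UNIV]])
      (auto intro!: continuous_on_diff continuous_on_id continuous_on_const)
  have 2: "(\<integral>s. \<omega>' (s - t) * indicator {0..} s \<partial>lborel) = 0"
    by (rule integral_derivative_compact_support[OF d c, of t "t + T"]) (use t T time_kernel_zero[OF T] in auto)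
  have i2: "integrable lborel (\<lambda>s. \<omega>' (s - t) * indicator {0..} s)"
  proof -
    have "integrable lborel (\<lambda>s. indicator {t..t + T} s *\<^sub>R \<omega>' (s - t))"
      by (rule borel_integrable_compact[OF compact_Icc]) (rule continuous_on_subset[OF c], simp)
    then show ?thesis
      by (rule Bochner_Integration.integrable_cong[THEN iffD1, rotated -1])
        (use t time_kernel_deriv_zero[OF T] in \<open>auto split: split_indicator\<close>)
  qed
  have eq: "bt t s * indicator {0..} s = \<eta>' t * (\<omega> (s - t) * indicator {0..} s) - \<eta> t * (\<omega>' (s - t) * indicator {0..} s)" for s
    by (simp add: bt_def left_diff_distrib mult.assoc)
  show "(\<integral>s. bt t s * indicator {0..} s \<partial>lborel) = \<eta>' t" "integrable lborel (\<lambda>s. bt t s * indicator {0..} s)"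
    unfolding eq using i1 i2 1 2 by simp_all
  show "integrable lborel (\<lambda>s. b0 t s * indicator {0..} s)"
    using integrable_mult_right[OF i1, of "\<eta> t"] by (simp add: b0_def mult.assoc)
qed

lemma compact_integrable:
  fixes h :: "real \<Rightarrow> real"
  assumes "continuous_on UNIV h" "\<And>t. t \<notin> {a..b} \<Longrightarrow> h t = 0"
  shows "integrable lborel (\<lambda>t. h t * indicator {0..} t :: real)"
proof -
  have [measurable]: "h \<in> borel_measurable borel" by (rule borel_measurable_continuous_onI[OF assms(1)])
  have "integrable lborel (\<lambda>s. indicator {a..b} s *\<^sub>R h s)"
    by (rule borel_integrable_compact[OF compact_Icc]) (rule continuous_on_subset[OF assms(1)], simp)
  then show ?thesis
    by (rule Bochner_Integration.integrable_bound) (use assms(2) in \<open>auto split: split_indicator\<close>)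
qed

lemma time_integrals_left:
  shows "(\<integral>t. bs t s * indicator {0..} t \<partial>lborel) = (\<integral>t. bd t s * indicator {0..} t \<partial>lborel)"
    and "integrable lborel (\<lambda>t. bs t s * indicator {0..} t)" "integrable lborel (\<lambda>t. b0 t s * indicator {0..} t)"
    and "integrable lborel (\<lambda>t. bd t s * indicator {0..} t)"
proof -
  have om: "continuous_on UNIV (\<lambda>t. \<omega> (s - t))" "continuous_on UNIV (\<lambda>t. \<omega>' (s - t))"
    by (rule continuous_on_compose2[OF continuous_time_kernel[of UNIV]] continuous_on_compose2[OF continuous_time_kernel_deriv[of UNIV]];
        auto intro!: continuous_on_diff continuous_on_id continuous_on_const)+
  have cb: "continuous_on UNIV (\<lambda>t. bs t s)" "continuous_on UNIV (\<lambda>t. b0 t s)" "continuous_on UNIV (\<lambda>t. bd t s)"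
    unfolding bs_def b0_def bd_def
    by (intro continuous_on_mult om continuous_cutoff continuous_cutoff_deriv)+
  have z: "bs t s = 0" "b0 t s = 0" "bd t s = 0" if "t \<notin> {T..\<tau> + 1}" for t
    using b_support[of t s] that by auto
  show i: "integrable lborel (\<lambda>t. bs t s * indicator {0..} t)" "integrable lborel (\<lambda>t. b0 t s * indicator {0..} t)"
    "integrable lborel (\<lambda>t. bd t s * indicator {0..} t)"
    by (rule compact_integrable[OF cb(1) z(1)] compact_integrable[OF cb(2) z(2)] compact_integrable[OF cb(3) z(3)]; simp)+
  have d: "((\<lambda>t. b0 t s) has_real_derivative (bd t s - bs t s)) (at t)" for t
  proof -
    have "((\<lambda>t. s - t) has_real_derivative 0 - 1) (at t)" by (intro DERIV_diff DERIV_ident DERIV_const)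
    from DERIV_mult[OF cutoff_has_derivative DERIV_chain'[OF this time_kernel_has_derivative]]
    show ?thesis unfolding b0_def by (rule DERIV_cong) (simp add: bd_def bs_def algebra_simps)
  qed
  have "(\<integral>t. (bd t s - bs t s) * indicator {0..} t \<partial>lborel) = 0"
  proof (rule integral_derivative_compact_support[OF d])
    show "continuous_on UNIV (\<lambda>t. bd t s - bs t s)" by (intro continuous_on_diff cb)
    show "b0 t s = 0" if "t \<le> T" for t using cutoff_zero[OF T, of t \<tau>] that by (simp add: b0_def)
    show "b0 t s = 0" if "t \<ge> \<tau> + 1 + T" for t using cutoff_zero[OF T, of t \<tau>] that T by (simp add: b0_def)
  qed (use T \<tau> in auto)
  then show "(\<integral>t. bs t s * indicator {0..} t \<partial>lborel) = (\<integral>t. bd t s * indicator {0..} t \<partial>lborel)"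
    using i by (simp add: left_diff_distrib)
qed

lemma shifted_mollifier_integrable:
  "integrable lborel (\<lambda>y. \<rho> (x - y) * indicator torus y)" "integrable lborel (\<lambda>y. G i (x - y) * indicator torus y)"
proof -
  obtain D where D: "D > 0" "\<And>x :: real ^ 'd. \<bar>mollifier \<delta> x\<bar> \<le> D"
      "\<And>(x :: real ^ 'd) i. \<bar>mollifier_grad \<delta> i x\<bar> \<le> D"
    using mollifier_bounded[OF \<delta>, where ?'d='d] by blast
  show "integrable lborel (\<lambda>y. \<rho> (x - y) * indicator torus y)" "integrable lborel (\<lambda>y. G i (x - y) * indicator torus y)"
    by (rule integrable_torus_bounded[where B=D]; use D in simp)+
qed

text \<open>
  The averages over the variable that the concentration measures do not see: the mollifier has mean \<open>1\<close>, its
  gradient has mean \<open>0\<close>, and derivatives of compactly supported functions of time integrate to \<open>0\<close>.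
\<close>

lemma slice_integrals:
  assumes z: "z \<in> spacetime"
  shows "(\<integral>w. bt (snd z) (snd w) * \<rho> (fst z - fst w) \<partial>S1.\<Lambda>) = \<eta>' (snd z)"
    and "(\<integral>w. b0 (snd z) (snd w) * G i (fst z - fst w) \<partial>S1.\<Lambda>) = 0"
    and "(\<integral>w. bs (snd w) (snd z) * \<rho> (fst z - fst w) \<partial>S1.\<Lambda>) = (\<integral>t. bd t (snd z) * indicator {0..} t \<partial>lborel)"
    and "(\<integral>w. b0 (snd w) (snd z) * G i (fst z - fst w) \<partial>S1.\<Lambda>) = 0"
proof -
  have x: "fst z \<in> torus" and t: "snd z \<ge> 0" using z by (auto simp: spacetime_def)
  have [measurable]: "(\<lambda>s. b0 u s) \<in> borel_measurable borel" "(\<lambda>s. bt u s) \<in> borel_measurable borel"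
    "(\<lambda>s. b0 s u) \<in> borel_measurable borel" "(\<lambda>s. bs s u) \<in> borel_measurable borel" for u
    unfolding b0_def bt_def bs_def by measurable
  note I = integral_spacetime_product(1)[OF _ _ shifted_mollifier_integrable(1)] integral_spacetime_product(1)[OF _ _ shifted_mollifier_integrable(2)]
  show "(\<integral>w. bt (snd z) (snd w) * \<rho> (fst z - fst w) \<partial>S1.\<Lambda>) = \<eta>' (snd z)"
    by (subst mult.commute, subst I(1)[OF _ _ time_integrals(2)[OF t]]) (simp_all add: time_integrals(1)[OF t] mollifier_integral(2)[OF \<delta> x])
  show "(\<integral>w. b0 (snd z) (snd w) * G i (fst z - fst w) \<partial>S1.\<Lambda>) = 0"
    by (subst mult.commute, subst I(2)[OF _ _ time_integrals(3)[OF t]]) (simp_all add: mollifier_grad_integral[OF x])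
  show "(\<integral>w. bs (snd w) (snd z) * \<rho> (fst z - fst w) \<partial>S1.\<Lambda>) = (\<integral>t. bd t (snd z) * indicator {0..} t \<partial>lborel)"
    by (subst mult.commute, subst I(1)[OF _ _ time_integrals_left(2)]) (simp_all add: time_integrals_left(1) mollifier_integral(2)[OF \<delta> x])
  show "(\<integral>w. b0 (snd w) (snd z) * G i (fst z - fst w) \<partial>S1.\<Lambda>) = 0"
    by (subst mult.commute, subst I(2)[OF _ _ time_integrals_left(3)]) (simp_all add: mollifier_grad_integral[OF x])
qed

lemma b0_derivatives:
  "smooth (\<lambda>t. b0 t s)" "((\<lambda>t. b0 t s) has_real_derivative bt t s) (at t)"
  "smooth (\<lambda>s. b0 t s)" "((\<lambda>s. b0 t s) has_real_derivative bs t s) (at s)"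
  "b0 t s \<ge> 0"
proof -
  have id: "smooth (\<lambda>t :: real. t)" by (rule smooth_bounded_linear[OF bounded_linear_ident])
  show "smooth (\<lambda>t. b0 t s)" "smooth (\<lambda>s. b0 t s)"
    unfolding b0_def
    by (rule smooth_mult[OF smooth_cutoff smooth_compose[OF smooth_time_kernel smooth_diff[OF smooth_const id]]]
        smooth_mult[OF smooth_const smooth_compose[OF smooth_time_kernel smooth_diff[OF id smooth_const]]])+
  show "((\<lambda>t. b0 t s) has_real_derivative bt t s) (at t)"
  proof -
    have "((\<lambda>t. s - t) has_real_derivative 0 - 1) (at t)" by (intro DERIV_diff DERIV_ident DERIV_const)
    from DERIV_mult[OF cutoff_has_derivative DERIV_chain'[OF this time_kernel_has_derivative]]
    show ?thesis unfolding b0_def by (rule DERIV_cong) (simp add: bt_def algebra_simps)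
  qed
  show "((\<lambda>s. b0 t s) has_real_derivative bs t s) (at s)"
  proof -
    have "((\<lambda>s. s - t) has_real_derivative 1 - 0) (at s)" by (intro DERIV_diff DERIV_ident DERIV_const)
    from DERIV_cmult[OF DERIV_chain'[OF this time_kernel_has_derivative]]
    show ?thesis unfolding b0_def by (rule DERIV_cong) (simp add: bs_def)
  qed
  show "b0 t s \<ge> 0" by (simp add: b0_def cutoff_nonneg time_kernel_nonneg[OF T])
qed

definition "main_integrand = (\<lambda>(p, q). \<bar>snd p - snd q\<bar> *
    (bd (snd (fst p)) (snd (fst q)) * \<rho> (fst (fst p) - fst (fst q))))"

lemma pair_J: "pair_sigma_finite J1 J2"
  by (intro pair_sigma_finite.intro S1.sigma_finite_joint S2.sigma_finite_joint)

lemma weights: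
  "integrable J1 (\<lambda>p. (1 + \<bar>snd p\<bar>) * indicator {..R} (snd (fst p)))"
  "integrable J2 (\<lambda>p. (1 + \<bar>snd p\<bar>) * indicator {..R} (snd (fst p)))"
  using S1.weight_integrable[of R] S2.weight_integrable[of R]
  by (simp_all add: S1.weight_def[abs_def] S2.weight_def[abs_def])

lemma J_integrable_general:
  assumes b: "(\<lambda>(t, s). b t s) \<in> borel_measurable (borel \<Otimes>\<^sub>M borel)" "\<And>t s. \<bar>b t s\<bar> \<le> B"
      "\<And>t s. b t s \<noteq> 0 \<longrightarrow> t \<le> R \<and> s \<le> R"
    and g: "g = \<rho> \<or> g = G i"
    and c: "(\<lambda>(p, q). c (snd p) (snd q)) \<in> borel_measurable (J1 \<Otimes>\<^sub>M J2)"
    and cb: "\<And>l k. \<bar>c l k\<bar> \<le> K * ((1 + \<bar>l\<bar>) * (1 + \<bar>k\<bar>))"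
  shows "integrable (J1 \<Otimes>\<^sub>M J2) (\<lambda>(p, q). c (snd p) (snd q) * (b (snd (fst p)) (snd (fst q)) * g (fst (fst p) - fst (fst q))))"
proof -
  obtain D where D: "D > 0" "\<And>x :: real ^ 'd. \<bar>mollifier \<delta> x\<bar> \<le> D"
      "\<And>(x :: real ^ 'd) i. \<bar>mollifier_grad \<delta> i x\<bar> \<le> D"
    using mollifier_bounded[OF \<delta>, where ?'d='d] by blast
  have gm: "g \<in> borel_measurable borel" "\<bar>g x\<bar> \<le> D" for x using g D by auto
  show ?thesis
    by (rule kernel_integrable[where pa=fst and pb=fst and b=b and g=g and c="\<lambda>p q. c (snd p) (snd q)"
          and wa="\<lambda>p. 1 + \<bar>snd p\<bar>" and wb="\<lambda>p. 1 + \<bar>snd p\<bar>",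
          OF pair_J S1.coordinates_measurable(1,2) S2.coordinates_measurable(1,2) c b(1) gm(1) cb weights b(2) _ gm(2)])
      (use b(3) in blast)
qed

lemma J_integrable:
  assumes b: "b \<in> {b0, bt, bs, bd}" and "g = \<rho> \<or> g = G i"
    and "(\<lambda>(p, q). c (snd p) (snd q)) \<in> borel_measurable (J1 \<Otimes>\<^sub>M J2)"
    and "\<And>l k. \<bar>c l k\<bar> \<le> K * ((1 + \<bar>l\<bar>) * (1 + \<bar>k\<bar>))"
  shows "integrable (J1 \<Otimes>\<^sub>M J2) (\<lambda>(p, q). c (snd p) (snd q) * (b (snd (fst p)) (snd (fst q)) * g (fst (fst p) - fst (fst q))))"
proof -
  obtain B where B: "\<And>t s. \<bar>b t s\<bar> \<le> B" using b_bounded b by (metis insertE singletonD)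
  have bm: "(\<lambda>(t, s). b t s) \<in> borel_measurable (borel \<Otimes>\<^sub>M borel)" using b b_measurable by auto
  have bsup: "b t s \<noteq> 0 \<longrightarrow> t \<le> R \<and> s \<le> R" for t s using b b_support[of t s] by auto
  show ?thesis by (rule J_integrable_general[OF bm B bsup assms(2-4)])
qed

lemma main_integrable: "integrable (J1 \<Otimes>\<^sub>M J2) main_integrand"
  unfolding main_integrand_def
  by (rule J_integrable[where b=bd and g=\<rho> and c="\<lambda>l k. \<bar>l - k\<bar>", OF _ _ _ abs_diff_weight]) simp_all

text \<open>
  A concentration measure \<open>m\<close> does not see the states, so in the average over the other solution the
  joint measure collapses to Lebesgue measure, and the inner integral is one of \<open>slice_integrals\<close>.
\<close>

lemma radon_J_swap:
  fixes b :: "real \<Rightarrow> real \<Rightarrow> real" and g :: "real ^ 'd \<Rightarrow> real"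
    and m :: "((real ^ 'd) \<times> real) measure" and K :: "(real ^ 'd) \<times> real \<Rightarrow> real measure"
  assumes m: "radon_measure m" and S: "markov_kernel (lebesgue_on spacetime) K"
    and J: "integrable (markov_kernel.joint (lebesgue_on spacetime) K) (\<lambda>p. (1 + \<bar>snd p\<bar>) * indicator {..R} (snd (fst p)))"
    and b: "\<And>t s. \<bar>b t s\<bar> \<le> B" "\<And>t s. b t s \<noteq> 0 \<longrightarrow> t \<le> R \<and> s \<le> R"
      "(\<lambda>(t, s). b t s) \<in> borel_measurable (borel \<Otimes>\<^sub>M borel)"
    and g: "g \<in> borel_measurable borel" "\<And>x. \<bar>g x\<bar> \<le> D"
  shows "integrable (markov_kernel.joint (lebesgue_on spacetime) K) (\<lambda>q. \<integral>z. b (snd z) (snd (fst q)) * g (fst z - fst (fst q)) \<partial>m)"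
    and "(\<integral>q. \<integral>z. b (snd z) (snd (fst q)) * g (fst z - fst (fst q)) \<partial>m \<partial>(markov_kernel.joint (lebesgue_on spacetime) K))
       = (\<integral>z. \<integral>w. b (snd z) (snd w) * g (fst z - fst w) \<partial>lebesgue_on spacetime \<partial>m)"
proof -
  interpret S: markov_kernel "lebesgue_on spacetime :: ((real ^ 'd) \<times> real) measure" K by (rule S)
  have P: "pair_sigma_finite m S.joint"
    by (intro pair_sigma_finite.intro S.sigma_finite_joint sigma_finite_radon_measure[OF m])
  interpret P: pair_sigma_finite m S.joint by (rule P)
  have [measurable]: "fst \<in> borel_measurable m" "snd \<in> borel_measurable m"
    by (intro borel_measurable_radon_measure[OF m] borel_measurable_continuous_onI continuous_intros)+
  have int: "integrable (m \<Otimes>\<^sub>M S.joint) (\<lambda>(z, q). 1 * (b (snd z) (snd (fst q)) * g (fst z - fst (fst q))))"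
    by (rule kernel_integrable[where pa="\<lambda>z. z" and pb=fst and c="\<lambda>_ _. 1" and K=1 and R=R and D=D and B=B
          and wa="\<lambda>_. 1" and wb="\<lambda>p. 1 + \<bar>snd p\<bar>", OF P])
      (use radon_measure_integrable_indicator[OF m] J b g in simp_all)
  then have int: "integrable (m \<Otimes>\<^sub>M S.joint) (\<lambda>(z, q). b (snd z) (snd (fst q)) * g (fst z - fst (fst q)))" by simp
  show "integrable S.joint (\<lambda>q. \<integral>z. b (snd z) (snd (fst q)) * g (fst z - fst (fst q)) \<partial>m)"
    by (rule P.integrable_snd[OF int])
  have "(\<integral>q. \<integral>z. b (snd z) (snd (fst q)) * g (fst z - fst (fst q)) \<partial>m \<partial>S.joint)
      = (\<integral>z. \<integral>q. b (snd z) (snd (fst q)) * g (fst z - fst (fst q)) \<partial>S.joint \<partial>m)"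
    by (rule P.Fubini_integral[OF int])
  also have "\<dots> = (\<integral>z. \<integral>w. b (snd z) (snd w) * g (fst z - fst w) \<partial>lebesgue_on spacetime \<partial>m)"
  proof (rule Bochner_Integration.integral_cong[OF refl])
    fix z :: "(real ^ 'd) \<times> real"
    have [measurable]: "(\<lambda>s. b (snd z) s) \<in> borel_measurable borel"
      using measurable_Pair2[OF b(3), of "snd z"] by simp
    note g(1)[measurable]
    have "(\<lambda>w. b (snd z) (snd w) * g (fst z - fst w)) \<in> borel_measurable (lebesgue_on spacetime)"
      by measurable
    from S.integrable_joint_fst(2)[OF this]
    show "(\<integral>q. b (snd z) (snd (fst q)) * g (fst z - fst (fst q)) \<partial>S.joint)
      = (\<integral>w. b (snd z) (snd w) * g (fst z - fst w) \<partial>lebesgue_on spacetime)" .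
  qed
  finally show "(\<integral>q. \<integral>z. b (snd z) (snd (fst q)) * g (fst z - fst (fst q)) \<partial>m \<partial>S.joint)
       = (\<integral>z. \<integral>w. b (snd z) (snd w) * g (fst z - fst w) \<partial>lebesgue_on spacetime \<partial>m)" .
qed

lemma radon_J_swap_instances:
  fixes m :: "((real ^ 'd) \<times> real) measure"
  assumes m: "radon_measure m"
  shows "integrable J2 (\<lambda>q. \<integral>z. bt (snd z) (snd (fst q)) * \<rho> (fst z - fst (fst q)) \<partial>m)"
    and "(\<integral>q. \<integral>z. bt (snd z) (snd (fst q)) * \<rho> (fst z - fst (fst q)) \<partial>m \<partial>J2) = (\<integral>z. \<eta>' (snd z) \<partial>m)"
    and "integrable J2 (\<lambda>q. \<integral>z. b0 (snd z) (snd (fst q)) * G i (fst z - fst (fst q)) \<partial>m)"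
    and "(\<integral>q. \<integral>z. b0 (snd z) (snd (fst q)) * G i (fst z - fst (fst q)) \<partial>m \<partial>J2) = 0"
    and "integrable J1 (\<lambda>p. \<integral>z. bs (snd (fst p)) (snd z) * \<rho> (fst z - fst (fst p)) \<partial>m)"
    and "(\<integral>p. \<integral>z. bs (snd (fst p)) (snd z) * \<rho> (fst z - fst (fst p)) \<partial>m \<partial>J1)
       = (\<integral>z. (\<integral>t. bd t (snd z) * indicator {0..} t \<partial>lborel) \<partial>m)"
    and "integrable J1 (\<lambda>p. \<integral>z. b0 (snd (fst p)) (snd z) * G i (fst z - fst (fst p)) \<partial>m)"
    and "(\<integral>p. \<integral>z. b0 (snd (fst p)) (snd z) * G i (fst z - fst (fst p)) \<partial>m \<partial>J1) = 0"
proof -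
  obtain B where B: "\<And>t s. \<bar>b0 t s\<bar> \<le> B" "\<And>t s. \<bar>bt t s\<bar> \<le> B" "\<And>t s. \<bar>bs t s\<bar> \<le> B"
    using b_bounded by metis
  obtain D where D: "\<And>x :: real ^ 'd. \<bar>mollifier \<delta> x\<bar> \<le> D" "\<And>(x :: real ^ 'd) i. \<bar>mollifier_grad \<delta> i x\<bar> \<le> D"
    using mollifier_bounded[OF \<delta>, where ?'d='d] by metis
  have sup: "bt t s \<noteq> 0 \<longrightarrow> t \<le> R \<and> s \<le> R" "b0 t s \<noteq> 0 \<longrightarrow> t \<le> R \<and> s \<le> R"
    "bs s t \<noteq> 0 \<longrightarrow> t \<le> R \<and> s \<le> R" "b0 s t \<noteq> 0 \<longrightarrow> t \<le> R \<and> s \<le> R" for t s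
    using b_support[of t s] b_support[of s t] by auto
  have fm: "(\<lambda>(s, t). bs t s) \<in> borel_measurable (borel \<Otimes>\<^sub>M borel)" "(\<lambda>(s, t). b0 t s) \<in> borel_measurable (borel \<Otimes>\<^sub>M borel)"
    unfolding bs_def b0_def by measurable
  note k2 = S2.markov_kernel_axioms and k1 = S1.markov_kernel_axioms
  note s1 = radon_J_swap[where b=bt, OF m k2 weights(2) B(2) sup(1) b_measurable(2) mollifier_borel D(1)]
  note s2 = radon_J_swap[where b=b0 and g="G i", OF m k2 weights(2) B(1) sup(2) b_measurable(1) mollifier_grad_borel D(2)]
  note s3 = radon_J_swap[where b="\<lambda>s t. bs t s", OF m k1 weights(1) B(3) sup(3) fm(1) mollifier_borel D(1)]
  note s4 = radon_J_swap[where b="\<lambda>s t. b0 t s" and g="G i", OF m k1 weights(1) B(1) sup(4) fm(2) mollifier_grad_borel D(2)]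
  have sp: "z \<in> space m \<Longrightarrow> z \<in> spacetime" for z using space_radon_measure[OF m] by simp
  show "integrable J2 (\<lambda>q. \<integral>z. bt (snd z) (snd (fst q)) * \<rho> (fst z - fst (fst q)) \<partial>m)" by (rule s1(1))
  show "integrable J2 (\<lambda>q. \<integral>z. b0 (snd z) (snd (fst q)) * G i (fst z - fst (fst q)) \<partial>m)" by (rule s2(1))
  show "integrable J1 (\<lambda>p. \<integral>z. bs (snd (fst p)) (snd z) * \<rho> (fst z - fst (fst p)) \<partial>m)" by (rule s3(1))
  show "integrable J1 (\<lambda>p. \<integral>z. b0 (snd (fst p)) (snd z) * G i (fst z - fst (fst p)) \<partial>m)" by (rule s4(1))
  show "(\<integral>q. \<integral>z. bt (snd z) (snd (fst q)) * \<rho> (fst z - fst (fst q)) \<partial>m \<partial>J2) = (\<integral>z. \<eta>' (snd z) \<partial>m)"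
    by (rule trans[OF s1(2)]) (rule Bochner_Integration.integral_cong[OF refl slice_integrals(1)[OF sp]])
  show "(\<integral>q. \<integral>z. b0 (snd z) (snd (fst q)) * G i (fst z - fst (fst q)) \<partial>m \<partial>J2) = 0"
    by (rule trans[OF s2(2)]) (simp add: slice_integrals(2)[OF sp] cong: Bochner_Integration.integral_cong)
  show "(\<integral>p. \<integral>z. bs (snd (fst p)) (snd z) * \<rho> (fst z - fst (fst p)) \<partial>m \<partial>J1)
       = (\<integral>z. (\<integral>t. bd t (snd z) * indicator {0..} t \<partial>lborel) \<partial>m)"
    by (rule trans[OF s3(2)]) (rule Bochner_Integration.integral_cong[OF refl slice_integrals(3)[OF sp]])
  show "(\<integral>p. \<integral>z. b0 (snd (fst p)) (snd z) * G i (fst z - fst (fst p)) \<partial>m \<partial>J1) = 0"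
    by (rule trans[OF s4(2)]) (simp add: slice_integrals(4)[OF sp] cong: Bochner_Integration.integral_cong)
qed

lemma J_swap:
  fixes F :: "(((real ^ 'd) \<times> real) \<times> real) \<Rightarrow> (((real ^ 'd) \<times> real) \<times> real) \<Rightarrow> real"
  assumes "integrable (J1 \<Otimes>\<^sub>M J2) (\<lambda>(p, q). F p q)"
  shows "integrable J2 (\<lambda>q. \<integral>p. F p q \<partial>J1)" "integrable J1 (\<lambda>p. \<integral>q. F p q \<partial>J2)"
    "(\<integral>q. \<integral>p. F p q \<partial>J1 \<partial>J2) = (\<integral>(p, q). F p q \<partial>(J1 \<Otimes>\<^sub>M J2))"
    "(\<integral>p. \<integral>q. F p q \<partial>J2 \<partial>J1) = (\<integral>(p, q). F p q \<partial>(J1 \<Otimes>\<^sub>M J2))"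
proof -
  interpret P: pair_sigma_finite J1 J2 by (rule pair_J)
  show "integrable J2 (\<lambda>q. \<integral>p. F p q \<partial>J1)" by (rule P.integrable_snd[OF assms])
  show "integrable J1 (\<lambda>p. \<integral>q. F p q \<partial>J2)" by (rule P.integrable_fst[OF assms])
  show "(\<integral>q. \<integral>p. F p q \<partial>J1 \<partial>J2) = (\<integral>(p, q). F p q \<partial>(J1 \<Otimes>\<^sub>M J2))" by (rule P.integral_snd[OF assms])
  show "(\<integral>p. \<integral>q. F p q \<partial>J2 \<partial>J1) = (\<integral>(p, q). F p q \<partial>(J1 \<Otimes>\<^sub>M J2))" by (rule P.integral_fst[OF assms])
qed

text \<open>
  The inequality for \<open>\<nu>\<close> is integrated over \<open>J2\<close> and the one for \<open>\<sigma>\<close> over \<open>J1\<close>. By Fubini's theorem the two flux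
  integrals are opposite, the flux concentrations integrate to zero, and in the sum of the two distance terms only the
  derivative of the cutoff survives.
\<close>

lemma doubling:
  "0 \<le> (\<integral>pq. main_integrand pq \<partial>(J1 \<Otimes>\<^sub>M J2)) + (\<integral>z. \<eta>' (snd z) \<partial>m1)
      + (\<integral>z. (\<integral>t. bd t (snd z) * indicator {0..} t \<partial>lborel) \<partial>m1')"
proof -
  define FA where "FA p q = \<bar>snd p - snd q\<bar> * (bt (snd (fst p)) (snd (fst q)) * \<rho> (fst (fst p) - fst (fst q)))" for p q
  define FS where "FS p q = \<bar>snd p - snd q\<bar> * (bs (snd (fst p)) (snd (fst q)) * \<rho> (fst (fst p) - fst (fst q)))" for p q
  define FC where "FC i p q = entropy_flux f (snd p) (snd q) $ i * (b0 (snd (fst p)) (snd (fst q)) * G i (fst (fst p) - fst (fst q)))" for i p q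
  obtain C where C: "\<And>l k i. \<bar>entropy_flux f l k $ i\<bar> \<le> C * ((1 + \<bar>l\<bar>) * (1 + \<bar>k\<bar>))"
    by (rule S1.flux_bound) (rule that)
  have iA: "integrable (J1 \<Otimes>\<^sub>M J2) (\<lambda>(p, q). FA p q)"
    unfolding FA_def by (rule J_integrable[where b=bt and g=\<rho> and c="\<lambda>l k. \<bar>l - k\<bar>", OF _ _ _ abs_diff_weight]) simp_all
  have iS: "integrable (J1 \<Otimes>\<^sub>M J2) (\<lambda>(p, q). FS p q)"
    unfolding FS_def by (rule J_integrable[where b=bs and g=\<rho> and c="\<lambda>l k. \<bar>l - k\<bar>", OF _ _ _ abs_diff_weight]) simp_all
  have iC: "integrable (J1 \<Otimes>\<^sub>M J2) (\<lambda>(p, q). FC i p q)" for i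
    unfolding FC_def by (rule J_integrable[where b=b0 and g="G i" and i=i and c="\<lambda>l k. entropy_flux f l k $ i", OF _ _ _ C]) simp_all
  obtain B where B: "\<And>t s. \<bar>b0 t s\<bar> \<le> B" "\<And>t s. \<bar>bt t s\<bar> \<le> B" "\<And>t s. \<bar>bs t s\<bar> \<le> B"
    using b_bounded by metis
  \<comment> \<open>The inequality for \<open>\<nu>\<close>: the point and the level of \<open>q\<close> are parameters of the test function and of the entropy.\<close>
  have E1: "0 \<le> (\<integral>p. FA p q \<partial>J1)
     + (\<integral>z. bt (snd z) (snd (fst q)) * \<rho> (fst z - fst (fst q)) \<partial>m1)
     + (\<Sum>i\<in>UNIV. \<integral>p. FC i p q \<partial>J1)
     + (\<Sum>i\<in>UNIV. (\<integral>z. b0 (snd z) (snd (fst q)) * G i (fst z - fst (fst q)) \<partial>pos_part m2 i)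
          - (\<integral>z. b0 (snd z) (snd (fst q)) * G i (fst z - fst (fst q)) \<partial>neg_part m2 i))" for q
    unfolding FA_def FC_def
  proof (rule S1.entropy_product_test[where a="\<lambda>t. b0 t (snd (fst q))" and lo=T and hi="\<tau> + 1" and c=B])
    show "b0 t (snd (fst q)) = 0" "bt t (snd (fst q)) = 0" if "t \<notin> {T..\<tau> + 1}" for t
      using b_support[of t "snd (fst q)"] that by auto
  qed (use T \<delta> b0_derivatives B in simp_all)
  \<comment> \<open>The inequality for \<open>\<sigma>\<close>, brought to the same integrands by the symmetry of the flux and the oddness of the gradient.\<close>
  have E2: "0 \<le> (\<integral>q. FS p q \<partial>J2)
     + (\<integral>z. bs (snd (fst p)) (snd z) * \<rho> (fst z - fst (fst p)) \<partial>m1')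
     + (\<Sum>i\<in>UNIV. - (\<integral>q. FC i p q \<partial>J2))
     + (\<Sum>i\<in>UNIV. (\<integral>z. b0 (snd (fst p)) (snd z) * G i (fst z - fst (fst p)) \<partial>pos_part m2' i)
          - (\<integral>z. b0 (snd (fst p)) (snd z) * G i (fst z - fst (fst p)) \<partial>neg_part m2' i))" for p
  proof -
    have 1: "FS p q = \<bar>snd q - snd p\<bar> * (bs (snd (fst p)) (snd (fst q)) * \<rho> (fst (fst q) - fst (fst p)))" for q
      unfolding FS_def by (subst mollifier_swap) (simp add: abs_minus_commute)
    have "- FC i p q = entropy_flux f (snd q) (snd p) $ i * (b0 (snd (fst p)) (snd (fst q)) * G i (fst (fst q) - fst (fst p)))" for i q
      unfolding FC_def by (subst mollifier_grad_swap, subst entropy_flux_commute) simp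
    then have 2: "- (\<integral>q. FC i p q \<partial>J2) = (\<integral>q. entropy_flux f (snd q) (snd p) $ i * (b0 (snd (fst p)) (snd (fst q)) * G i (fst (fst q) - fst (fst p))) \<partial>J2)" for i
      by (simp flip: Bochner_Integration.integral_minus)
    show ?thesis
      unfolding 1 2
    proof (rule S2.entropy_product_test[where a="\<lambda>s. b0 (snd (fst p)) s" and lo=T and hi=R and c=B])
      show "b0 (snd (fst p)) s = 0" "bs (snd (fst p)) s = 0" if "s \<notin> {T..R}" for s
        using b_support[of "snd (fst p)" s] that by auto
    qed (use T \<delta> b0_derivatives B in simp_all)
  qed
  note sw1 = radon_J_swap_instances[OF S1.radon] and sw1p = radon_J_swap_instances[OF S1.flux_radon(1)]
    and sw1n = radon_J_swap_instances[OF S1.flux_radon(2)]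
  note sw2 = radon_J_swap_instances[OF S2.radon] and sw2p = radon_J_swap_instances[OF S2.flux_radon(1)]
    and sw2n = radon_J_swap_instances[OF S2.flux_radon(2)]
  note jA = J_swap[OF iA] and jS = J_swap[OF iS] and jC = J_swap[OF iC]
  have "0 \<le> (\<integral>q. (\<integral>p. FA p q \<partial>J1)
     + (\<integral>z. bt (snd z) (snd (fst q)) * \<rho> (fst z - fst (fst q)) \<partial>m1)
     + (\<Sum>i\<in>UNIV. \<integral>p. FC i p q \<partial>J1)
     + (\<Sum>i\<in>UNIV. (\<integral>z. b0 (snd z) (snd (fst q)) * G i (fst z - fst (fst q)) \<partial>pos_part m2 i)
          - (\<integral>z. b0 (snd z) (snd (fst q)) * G i (fst z - fst (fst q)) \<partial>neg_part m2 i)) \<partial>J2)"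
    by (rule Bochner_Integration.integral_nonneg) (rule E1)
  also have "\<dots> = (\<integral>(p, q). FA p q \<partial>(J1 \<Otimes>\<^sub>M J2)) + (\<integral>z. \<eta>' (snd z) \<partial>m1)
      + (\<Sum>i\<in>UNIV. (\<integral>(p, q). FC i p q \<partial>(J1 \<Otimes>\<^sub>M J2)))"
    using sw1(1) sw1p(3) sw1n(3) jA(1) jC(1)
    by (simp add: sw1(2) sw1p(4) sw1n(4) jA(3) jC(3))
  finally have X: "0 \<le> \<dots>" .
  have "0 \<le> (\<integral>p. (\<integral>q. FS p q \<partial>J2)
     + (\<integral>z. bs (snd (fst p)) (snd z) * \<rho> (fst z - fst (fst p)) \<partial>m1')
     + (\<Sum>i\<in>UNIV. - (\<integral>q. FC i p q \<partial>J2))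
     + (\<Sum>i\<in>UNIV. (\<integral>z. b0 (snd (fst p)) (snd z) * G i (fst z - fst (fst p)) \<partial>pos_part m2' i)
          - (\<integral>z. b0 (snd (fst p)) (snd z) * G i (fst z - fst (fst p)) \<partial>neg_part m2' i)) \<partial>J1)"
    by (rule Bochner_Integration.integral_nonneg) (rule E2)
  also have "\<dots> = (\<integral>(p, q). FS p q \<partial>(J1 \<Otimes>\<^sub>M J2)) + (\<integral>z. (\<integral>t. bd t (snd z) * indicator {0..} t \<partial>lborel) \<partial>m1')
      + (\<Sum>i\<in>UNIV. - (\<integral>(p, q). FC i p q \<partial>(J1 \<Otimes>\<^sub>M J2)))"
    using sw2(5) sw2p(7) sw2n(7) jS(2) jC(2)
    by (simp add: sw2(6) sw2p(8) sw2n(8) jS(4) jC(4))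
  finally have Y: "0 \<le> \<dots>" .
  \<comment> \<open>The flux integrals in \<open>X\<close> and \<open>Y\<close> cancel, and the distance terms add up.\<close>
  have "bd t s = bt t s + bs t s" for t s by (simp add: bd_def bt_def bs_def)
  then have "main_integrand pq = (case pq of (p, q) \<Rightarrow> FA p q) + (case pq of (p, q) \<Rightarrow> FS p q)" for pq
    by (simp add: main_integrand_def FA_def FS_def split: prod.split) (simp add: algebra_simps)
  then have "(\<integral>pq. main_integrand pq \<partial>(J1 \<Otimes>\<^sub>M J2)) = (\<integral>(p, q). FA p q \<partial>(J1 \<Otimes>\<^sub>M J2)) + (\<integral>(p, q). FS p q \<partial>(J1 \<Otimes>\<^sub>M J2))"
    using iA iS by simp
  with X Y show ?thesis by (simp add: sum_negf)
qed

end

section \<open>The contraction estimate near the initial time\<close>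

context two_solutions
begin

lemma integrable_radon_time:
  assumes m: "radon_measure m" and h: "continuous_on UNIV h" "\<And>t. t \<notin> {a..b} \<Longrightarrow> h t = (0 :: real)"
  shows "integrable m (\<lambda>z :: (real ^ 'd) \<times> real. h (snd z))"
proof -
  obtain c where c: "c > 0" "\<And>t. \<bar>h t\<bar> \<le> c" using bounded_if_compact_support[OF h] by metis
  show ?thesis
  proof (rule Bochner_Integration.integrable_bound)
    show "integrable m (\<lambda>z. c * indicator {..b} (snd z))"
      by (intro integrable_mult_right radon_measure_integrable_indicator[OF m])
    show "(\<lambda>z. h (snd z)) \<in> borel_measurable m"
      by (intro borel_measurable_radon_measure[OF m] borel_measurable_continuous_onI
          continuous_on_compose2[OF h(1)] continuous_on_snd continuous_on_id) auto
    show "AE z in m. norm (h (snd z)) \<le> norm (c * indicator {..b} (snd z))"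
      using c h(2) by (intro AE_I2) (auto split: split_indicator)
  qed
qed

lemma measure_slab:
  assumes m: "radon_measure m"
  shows "(\<integral>z. indicator {..r} (snd z) \<partial>m) = measure m (torus \<times> {0..r})"
    and "ennreal (measure m (torus \<times> {0..r})) = emeasure m (torus \<times> {0..r})"
proof -
  have "(\<integral>z. indicator {..r} (snd z) \<partial>m) = (\<integral>z. indicator (torus \<times> {0..r}) z \<partial>m)"
    by (rule Bochner_Integration.integral_cong[OF refl])
      (auto simp: space_radon_measure[OF m] spacetime_def split: split_indicator)
  also have "\<dots> = measure m (torus \<times> {0..r})"
  proof -
    have s: "torus \<times> {0..r} \<in> sets m" using slab_sets m by (simp add: radon_measure_def)
    show ?thesis using sets.sets_into_space[OF s] by (simp add: Int_absorb2)
  qed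
  finally show "(\<integral>z. indicator {..r} (snd z) \<partial>m) = measure m (torus \<times> {0..r})" .
  show "ennreal (measure m (torus \<times> {0..r})) = emeasure m (torus \<times> {0..r})"
    using m by (subst emeasure_eq_ennreal_measure) (auto simp: radon_measure_def less_top[symmetric])
qed

lemma time_kernel_left_real:
  "(\<integral>t. \<omega> (s - t) * indicator {0..} t \<partial>lborel) \<le> 1" "integrable lborel (\<lambda>t. \<omega> (s - t) * indicator {0..} t)"
proof -
  show "integrable lborel (\<lambda>t. \<omega> (s - t) * indicator {0..} t)"
  proof (rule compact_integrable)
    show "continuous_on UNIV (\<lambda>t. \<omega> (s - t))"
      by (rule continuous_on_compose2[OF continuous_time_kernel[of UNIV]])
        (auto intro!: continuous_on_diff continuous_on_id continuous_on_const)
    show "\<omega> (s - t) = 0" if "t \<notin> {s - T..s}" for t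
      by (rule time_kernel_zero[OF T]) (use that in auto)
  qed
  have "(\<integral>t. \<omega> (s - t) * indicator {0..} t \<partial>lborel) = enn2real (\<integral>\<^sup>+t. ennreal (\<omega> (s - t) * indicator {0..} t) \<partial>lborel)"
    using time_kernel_nonneg[OF T] by (intro integral_eq_nn_integral) auto
  also have "(\<integral>\<^sup>+t. ennreal (\<omega> (s - t) * indicator {0..} t) \<partial>lborel) \<le> 1"
    by (rule order_trans[OF _ time_kernel_mass_left[OF T, of s]]) (intro nn_integral_mono, simp split: split_indicator)
  then have "enn2real (\<integral>\<^sup>+t. ennreal (\<omega> (s - t) * indicator {0..} t) \<partial>lborel) \<le> enn2real 1"
    by (rule enn2real_mono) simp
  finally show "(\<integral>t. \<omega> (s - t) * indicator {0..} t \<partial>lborel) \<le> 1" by simp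
qed

text \<open>
  The smoothing in space and time that separates the two variables.
\<close>

definition "moll_kernel z w = ennreal (\<omega> (snd w - snd z) * \<rho> (fst z - fst w))"

lemma kernel_measurable [measurable]:
  assumes [measurable]: "(\<lambda>x. fst (g x)) \<in> borel_measurable N" "(\<lambda>x. snd (g x)) \<in> borel_measurable N"
    "(\<lambda>x. fst (h x)) \<in> borel_measurable N" "(\<lambda>x. snd (h x)) \<in> borel_measurable N"
  shows "(\<lambda>x. moll_kernel (g x) (h x)) \<in> borel_measurable N"
  unfolding moll_kernel_def by measurable

lemma nn_integral_kernel_product:
  assumes [measurable]: "r \<in> borel_measurable borel" "p \<in> borel_measurable borel"
  shows "(\<integral>\<^sup>+w. ennreal (r (fst w)) * ennreal (p (snd w)) \<partial>S1.\<Lambda>)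
    = (\<integral>\<^sup>+x. ennreal (r x) * indicator torus x \<partial>lborel) * (\<integral>\<^sup>+t. ennreal (p t) * indicator {0..} t \<partial>lborel)"
  by (rule nn_integral_spacetime_product[of "\<lambda>x. ennreal (r x)" "\<lambda>t. ennreal (p t)"]) measurable

lemma kernel_mass:
  shows "z \<in> spacetime \<Longrightarrow> (\<integral>\<^sup>+w. moll_kernel z w \<partial>S1.\<Lambda>) = 1"
    and "w \<in> spacetime \<Longrightarrow> (\<integral>\<^sup>+z. moll_kernel z w \<partial>S1.\<Lambda>) \<le> 1"
proof -
  have eq: "moll_kernel z w = ennreal (\<rho> (fst z - fst w)) * ennreal (\<omega> (snd w - snd z))" for z w
    unfolding moll_kernel_def using mollifier_nonneg[OF \<delta>] time_kernel_nonneg[OF T]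
    by (simp add: ennreal_mult'' mult.commute)
  show "(\<integral>\<^sup>+w. moll_kernel z w \<partial>S1.\<Lambda>) = 1" if z: "z \<in> spacetime"
  proof -
    have "(\<integral>\<^sup>+w. moll_kernel z w \<partial>S1.\<Lambda>) = (\<integral>\<^sup>+y. ennreal (\<rho> (fst z - y)) * indicator torus y \<partial>lborel)
        * (\<integral>\<^sup>+s. ennreal (\<omega> (s - snd z)) * indicator {0..} s \<partial>lborel)"
      unfolding eq by (rule nn_integral_kernel_product) measurable
    also have "\<dots> = 1"
      using z mollifier_mass(2)[OF \<delta>, of "fst z"] time_kernel_mass_right[OF T, of "snd z"] by (simp add: spacetime_def mem_Times_iff)
    finally show ?thesis .
  qed
  show "(\<integral>\<^sup>+z. moll_kernel z w \<partial>S1.\<Lambda>) \<le> 1" if w: "w \<in> spacetime"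
  proof -
    have "(\<integral>\<^sup>+z. moll_kernel z w \<partial>S1.\<Lambda>) = (\<integral>\<^sup>+x. ennreal (\<rho> (x - fst w)) * indicator torus x \<partial>lborel)
        * (\<integral>\<^sup>+t. ennreal (\<omega> (snd w - t)) * indicator {0..} t \<partial>lborel)"
      unfolding eq by (rule nn_integral_kernel_product) measurable
    also have "\<dots> \<le> 1"
      using w mollifier_mass(1)[OF \<delta>, of "fst w"] time_kernel_mass_left[OF T, of "snd w"] by (simp add: spacetime_def mem_Times_iff)
    finally show ?thesis .
  qed
qed

lemma kernel_zero: "snd w \<le> snd z \<or> snd w \<ge> snd z + T \<Longrightarrow> moll_kernel z w = 0"
  unfolding moll_kernel_def by (subst time_kernel_zero[OF T]) auto

text \<open>
  The triangle inequality through \<open>v0(x)\<close> and \<open>v0(y)\<close>; in each of the first two terms the other variable is integrated out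
  at the cost of the mass of the kernel, which is at most \<open>1\<close>. Since \<open>s < t + T\<close> on the support of the kernel,
  \<open>t \<le> 2T\<close> entails \<open>s \<le> 3T\<close>.
\<close>

lemma initial_layer_bound:
  fixes v0 :: "real ^ 'd \<Rightarrow> real"
  assumes [measurable]: "v0 \<in> borel_measurable borel"
  shows "(\<integral>\<^sup>+pq. (case pq of (p, q) \<Rightarrow> ennreal \<bar>snd p - snd q\<bar> * indicator {..2 * T} (snd (fst p)) * moll_kernel (fst p) (fst q)) \<partial>(J1 \<Otimes>\<^sub>M J2))
    \<le> (\<integral>\<^sup>+p. ennreal \<bar>snd p - v0 (fst (fst p))\<bar> * indicator {..2 * T} (snd (fst p)) \<partial>J1)
    + (\<integral>\<^sup>+q. ennreal \<bar>snd q - v0 (fst (fst q))\<bar> * indicator {..3 * T} (snd (fst q)) \<partial>J2)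
    + ennreal (2 * T) * (\<integral>\<^sup>+x. \<integral>\<^sup>+y. ennreal (\<rho> (x - y)) * ennreal \<bar>v0 x - v0 y\<bar> \<partial>lebesgue_on torus \<partial>lebesgue_on torus)"
proof -
  interpret P: pair_sigma_finite J1 J2 by (rule pair_J)
  note [measurable] = S1.coordinates_measurable S2.coordinates_measurable
  let ?i = "indicator :: real set \<Rightarrow> real \<Rightarrow> ennreal"
  define A where "A p = ennreal \<bar>snd p - v0 (fst (fst p))\<bar> * ?i {..2 * T} (snd (fst p))" for p :: "((real ^ 'd) \<times> real) \<times> real"
  define C where "C q = ennreal \<bar>snd q - v0 (fst (fst q))\<bar> * ?i {..3 * T} (snd (fst q))" for q :: "((real ^ 'd) \<times> real) \<times> real"
  define W where "W z w = ennreal \<bar>v0 (fst z) - v0 (fst w)\<bar> * ?i {..2 * T} (snd z) * moll_kernel z w" for z w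
  have [measurable]: "A \<in> borel_measurable J1" "C \<in> borel_measurable J2" unfolding A_def C_def by measurable
  have "(\<integral>\<^sup>+pq. (case pq of (p, q) \<Rightarrow> ennreal \<bar>snd p - snd q\<bar> * ?i {..2 * T} (snd (fst p)) * moll_kernel (fst p) (fst q)) \<partial>(J1 \<Otimes>\<^sub>M J2))
    \<le> (\<integral>\<^sup>+pq. A (fst pq) * moll_kernel (fst (fst pq)) (fst (snd pq)) + C (snd pq) * moll_kernel (fst (fst pq)) (fst (snd pq))
        + W (fst (fst pq)) (fst (snd pq)) \<partial>(J1 \<Otimes>\<^sub>M J2))"
  proof (rule nn_integral_mono)
    fix pq :: "(((real ^ 'd) \<times> real) \<times> real) \<times> (((real ^ 'd) \<times> real) \<times> real)"
    obtain p q where pq: "pq = (p, q)" by (cases pq)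
    let ?k = "moll_kernel (fst p) (fst q)" and ?j = "?i {..2 * T} (snd (fst p))"
    have "ennreal \<bar>snd p - snd q\<bar> \<le> ennreal \<bar>snd p - v0 (fst (fst p))\<bar> + ennreal \<bar>snd q - v0 (fst (fst q))\<bar> + ennreal \<bar>v0 (fst (fst p)) - v0 (fst (fst q))\<bar>"
      by (subst ennreal_plus[symmetric], simp, simp)+ (intro ennreal_leI, linarith)
    then have "ennreal \<bar>snd p - snd q\<bar> * ?j * ?k \<le> (ennreal \<bar>snd p - v0 (fst (fst p))\<bar> + ennreal \<bar>snd q - v0 (fst (fst q))\<bar> + ennreal \<bar>v0 (fst (fst p)) - v0 (fst (fst q))\<bar>) * ?j * ?k"
      by (intro mult_right_mono) auto
    also have "\<dots> = A p * ?k + ennreal \<bar>snd q - v0 (fst (fst q))\<bar> * (?j * ?k) + W (fst p) (fst q)"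
      by (simp add: A_def W_def distrib_right mult.assoc)
    also have "?j * ?k \<le> ?i {..3 * T} (snd (fst q)) * ?k"
      using kernel_zero[of "fst q" "fst p"] T by (auto split: split_indicator)
    then have "ennreal \<bar>snd q - v0 (fst (fst q))\<bar> * (?j * ?k) \<le> C q * ?k"
      unfolding C_def mult.assoc by (rule mult_left_mono) simp
    finally show "(case pq of (p, q) \<Rightarrow> ennreal \<bar>snd p - snd q\<bar> * ?i {..2 * T} (snd (fst p)) * moll_kernel (fst p) (fst q))
      \<le> A (fst pq) * moll_kernel (fst (fst pq)) (fst (snd pq)) + C (snd pq) * moll_kernel (fst (fst pq)) (fst (snd pq)) + W (fst (fst pq)) (fst (snd pq))"
      by (simp add: pq add_left_mono add_right_mono)
  qed
  also have "\<dots> = (\<integral>\<^sup>+pq. A (fst pq) * moll_kernel (fst (fst pq)) (fst (snd pq)) \<partial>(J1 \<Otimes>\<^sub>M J2))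
     + (\<integral>\<^sup>+pq. C (snd pq) * moll_kernel (fst (fst pq)) (fst (snd pq)) \<partial>(J1 \<Otimes>\<^sub>M J2))
     + (\<integral>\<^sup>+pq. W (fst (fst pq)) (fst (snd pq)) \<partial>(J1 \<Otimes>\<^sub>M J2))"
    unfolding W_def by (simp add: nn_integral_add)
  also have "(\<integral>\<^sup>+pq. A (fst pq) * moll_kernel (fst (fst pq)) (fst (snd pq)) \<partial>(J1 \<Otimes>\<^sub>M J2)) \<le> (\<integral>\<^sup>+p. A p \<partial>J1)"
  proof -
    have "(\<integral>\<^sup>+pq. A (fst pq) * moll_kernel (fst (fst pq)) (fst (snd pq)) \<partial>(J1 \<Otimes>\<^sub>M J2)) = (\<integral>\<^sup>+p. \<integral>\<^sup>+q. A p * moll_kernel (fst p) (fst q) \<partial>J2 \<partial>J1)"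
      by (subst P.M2.nn_integral_fst[symmetric]) auto
    also have "\<dots> \<le> (\<integral>\<^sup>+p. A p \<partial>J1)"
    proof (rule nn_integral_mono)
      fix p assume "p \<in> space J1"
      then have z: "fst p \<in> spacetime" by (auto simp: S1.space_joint)
      have "(\<integral>\<^sup>+q. moll_kernel (fst p) (fst q) \<partial>J2) = 1"
        using S2.nn_integral_joint_fst[of "moll_kernel (fst p)"] kernel_mass(1)[OF z] by simp
      then show "(\<integral>\<^sup>+q. A p * moll_kernel (fst p) (fst q) \<partial>J2) \<le> A p"
        by (subst nn_integral_cmult) auto
    qed
    finally show ?thesis .
  qed
  also have "(\<integral>\<^sup>+pq. C (snd pq) * moll_kernel (fst (fst pq)) (fst (snd pq)) \<partial>(J1 \<Otimes>\<^sub>M J2)) \<le> (\<integral>\<^sup>+q. C q \<partial>J2)"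
  proof -
    have "(\<integral>\<^sup>+pq. C (snd pq) * moll_kernel (fst (fst pq)) (fst (snd pq)) \<partial>(J1 \<Otimes>\<^sub>M J2)) = (\<integral>\<^sup>+q. \<integral>\<^sup>+p. C q * moll_kernel (fst p) (fst q) \<partial>J1 \<partial>J2)"
      by (subst P.nn_integral_snd[symmetric]) auto
    also have "\<dots> \<le> (\<integral>\<^sup>+q. C q \<partial>J2)"
    proof (rule nn_integral_mono)
      fix q assume "q \<in> space J2"
      then have w: "fst q \<in> spacetime" by (auto simp: S2.space_joint)
      have "(\<integral>\<^sup>+p. moll_kernel (fst p) (fst q) \<partial>J1) \<le> 1"
        using S1.nn_integral_joint_fst[of "\<lambda>z. moll_kernel z (fst q)"] kernel_mass(2)[OF w] by simp
      then have "C q * (\<integral>\<^sup>+p. moll_kernel (fst p) (fst q) \<partial>J1) \<le> C q * 1" by (rule mult_left_mono) simp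
      then show "(\<integral>\<^sup>+p. C q * moll_kernel (fst p) (fst q) \<partial>J1) \<le> C q"
        by (subst nn_integral_cmult) auto
    qed
    finally show ?thesis .
  qed
  also have "(\<integral>\<^sup>+pq. W (fst (fst pq)) (fst (snd pq)) \<partial>(J1 \<Otimes>\<^sub>M J2))
      = ennreal (2 * T) * (\<integral>\<^sup>+x. \<integral>\<^sup>+y. ennreal (\<rho> (x - y)) * ennreal \<bar>v0 x - v0 y\<bar> \<partial>lebesgue_on torus \<partial>lebesgue_on torus)"
  proof -
    have \<rho>0: "0 \<le> \<rho> x" for x by (rule mollifier_nonneg[OF \<delta>])
    define V where "V x = (\<integral>\<^sup>+y. ennreal (\<rho> (x - y) * \<bar>v0 x - v0 y\<bar>) * indicator torus y \<partial>lborel)" for x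
    have [measurable]: "V \<in> borel_measurable borel" unfolding V_def by measurable
    have "(\<integral>\<^sup>+pq. W (fst (fst pq)) (fst (snd pq)) \<partial>(J1 \<Otimes>\<^sub>M J2)) = (\<integral>\<^sup>+p. \<integral>\<^sup>+q. W (fst p) (fst q) \<partial>J2 \<partial>J1)"
      unfolding W_def by (subst P.M2.nn_integral_fst[symmetric]) auto
    also have "\<dots> = (\<integral>\<^sup>+p. V (fst (fst p)) * ?i {..2 * T} (snd (fst p)) \<partial>J1)"
    proof (rule nn_integral_cong)
      fix p assume "p \<in> space J1"
      then have z: "fst p \<in> spacetime" by (auto simp: S1.space_joint)
      let ?x = "fst (fst p)" and ?t = "snd (fst p)"
      have "(\<integral>\<^sup>+q. W (fst p) (fst q) \<partial>J2) = (\<integral>\<^sup>+w. W (fst p) w \<partial>S1.\<Lambda>)"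
        unfolding W_def by (rule S2.nn_integral_joint_fst) measurable
      also have "\<dots> = (\<integral>\<^sup>+w. ennreal (\<rho> (?x - fst w) * \<bar>v0 ?x - v0 (fst w)\<bar>) * ennreal (\<omega> (snd w - ?t) * indicator {..2 * T} ?t) \<partial>S1.\<Lambda>)"
        unfolding W_def moll_kernel_def using \<rho>0 time_kernel_nonneg[OF T]
        by (intro nn_integral_cong) (auto simp: ennreal_mult[symmetric] mult_ac split: split_indicator)
      also have "\<dots> = V ?x * (\<integral>\<^sup>+s. ennreal (\<omega> (s - ?t) * indicator {..2 * T} ?t) * indicator {0..} s \<partial>lborel)"
        unfolding V_def by (rule nn_integral_kernel_product) measurable
      also have "(\<integral>\<^sup>+s. ennreal (\<omega> (s - ?t) * indicator {..2 * T} ?t) * indicator {0..} s \<partial>lborel) = ?i {..2 * T} ?t"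
        using z time_kernel_mass_right[OF T, of ?t] by (auto simp: spacetime_def mem_Times_iff split: split_indicator)
      finally show "(\<integral>\<^sup>+q. W (fst p) (fst q) \<partial>J2) = V ?x * ?i {..2 * T} ?t" .
    qed
    also have "\<dots> = (\<integral>\<^sup>+z. V (fst z) * ?i {..2 * T} (snd z) \<partial>S1.\<Lambda>)"
      by (rule S1.nn_integral_joint_fst) measurable
    also have "\<dots> = (\<integral>\<^sup>+x. V x * indicator torus x \<partial>lborel) * (\<integral>\<^sup>+t. ?i {..2 * T} t * indicator {0..} t \<partial>lborel)"
      by (rule nn_integral_spacetime_product) measurable
    also have "(\<integral>\<^sup>+t. ?i {..2 * T} t * indicator {0..} t \<partial>lborel) = (\<integral>\<^sup>+t. indicator {0..2 * T} t \<partial>lborel)"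
      by (intro nn_integral_cong) (auto split: split_indicator)
    also have "\<dots> = ennreal (2 * T)" using T by simp
    also have "(\<integral>\<^sup>+x. V x * indicator torus x \<partial>lborel)
        = (\<integral>\<^sup>+x. \<integral>\<^sup>+y. ennreal (\<rho> (x - y)) * ennreal \<bar>v0 x - v0 y\<bar> \<partial>lebesgue_on torus \<partial>lebesgue_on torus)"
      unfolding V_def using \<rho>0 by (simp add: nn_integral_lebesgue_on ennreal_mult)
    finally show ?thesis by (simp add: mult.commute)
  qed
  finally show ?thesis unfolding A_def C_def by (simp add: add_left_mono add_right_mono)
qed

text \<open>
  This is \<open>doubling\<close> with the derivative of the cutoff split into its rise and its descent. The bound is linear in the
  contents of the initial layers \<open>t \<le> 2T\<close> and \<open>s \<le> 3T\<close> and carries the factor \<open>1/T\<close>, which matches the time averages in the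
  initial condition.
\<close>

lemma energy_estimate:
  fixes v0 :: "real ^ 'd \<Rightarrow> real"
  assumes \<tau>T: "2 * T \<le> \<tau>" and B: "B > 0" "\<And>x. bump x \<le> B" and v0: "v0 \<in> borel_measurable borel"
  shows "(\<integral>\<^sup>+pq. (case pq of (p, q) \<Rightarrow> ennreal \<bar>snd p - snd q\<bar> * ennreal (bump (snd (fst p) - \<tau>)) * moll_kernel (fst p) (fst q)) \<partial>(J1 \<Otimes>\<^sub>M J2))
      + (\<integral>\<^sup>+z. ennreal (bump (snd z - \<tau>)) \<partial>m1)
    \<le> ennreal (B / T) * ((\<integral>\<^sup>+p. ennreal \<bar>snd p - v0 (fst (fst p))\<bar> * indicator {..2 * T} (snd (fst p)) \<partial>J1)
      + (\<integral>\<^sup>+q. ennreal \<bar>snd q - v0 (fst (fst q))\<bar> * indicator {..3 * T} (snd (fst q)) \<partial>J2)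
      + ennreal (2 * T) * (\<integral>\<^sup>+x. \<integral>\<^sup>+y. ennreal (\<rho> (x - y)) * ennreal \<bar>v0 x - v0 y\<bar> \<partial>lebesgue_on torus \<partial>lebesgue_on torus)
      + emeasure m1 (torus \<times> {0..2 * T}) + emeasure m1' (torus \<times> {0..3 * T}))"
proof -
  define b1 where "b1 t s = bump (t - \<tau>) * \<omega> (s - t)" for t s
  define b2 where "b2 t s = indicator {..2 * T} t * \<omega> (s - t)" for t s :: real
  define H1 where "H1 = (\<lambda>(p, q). \<bar>snd p - snd q\<bar> * (b1 (snd (fst p)) (snd (fst q)) * \<rho> (fst (fst p) - fst (fst q))))"
  define H2 where "H2 = (\<lambda>(p, q). \<bar>snd p - snd q\<bar> * (b2 (snd (fst p)) (snd (fst q)) * \<rho> (fst (fst p) - fst (fst q))))"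
  have bt: "t \<notin> {\<tau>..\<tau> + 1} \<Longrightarrow> bump (t - \<tau>) = 0" for t by (rule bump_eq_0) auto
  have bc: "continuous_on UNIV (\<lambda>t. bump (t - \<tau>))"
    by (rule continuous_on_compose2[OF continuous_on_bump[of UNIV]])
      (auto intro!: continuous_on_diff continuous_on_id continuous_on_const)
  have \<omega>B: "\<omega> r \<le> B / T" for r unfolding time_kernel_def using B T by (intro divide_right_mono) auto
  have \<omega>0: "\<omega> r \<ge> 0" for r by (rule time_kernel_nonneg[OF T])
  have \<omega>z: "\<omega> (s - t) \<noteq> 0 \<Longrightarrow> t < s \<and> s < t + T" for t s using time_kernel_zero[OF T, of "s - t"] by force
  have \<rho>0: "\<rho> x \<ge> 0" for x by (rule mollifier_nonneg[OF \<delta>])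
  have i1: "integrable (J1 \<Otimes>\<^sub>M J2) H1"
    unfolding H1_def
  proof (rule J_integrable_general[where g=\<rho> and c="\<lambda>l k. \<bar>l - k\<bar>", OF _ _ _ _ _ abs_diff_weight])
    show "(\<lambda>(t, s). b1 t s) \<in> borel_measurable (borel \<Otimes>\<^sub>M borel)" unfolding b1_def by measurable
    show "\<bar>b1 t s\<bar> \<le> B * (B / T)" for t s
      unfolding b1_def abs_mult using B bump_nonneg \<omega>B \<omega>0 by (intro mult_mono) auto
    show "b1 t s \<noteq> 0 \<longrightarrow> t \<le> R \<and> s \<le> R" for t s
    proof
      assume nz: "b1 t s \<noteq> 0"
      then have "bump (t - \<tau>) \<noteq> 0" "\<omega> (s - t) \<noteq> 0" by (auto simp: b1_def)
      then have "t \<in> {\<tau>..\<tau> + 1}" "t < s \<and> s < t + T" using bt \<omega>z by blast+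
      then show "t \<le> R \<and> s \<le> R" using T by auto
    qed
  qed simp_all
  have i2: "integrable (J1 \<Otimes>\<^sub>M J2) H2"
    unfolding H2_def
  proof (rule J_integrable_general[where g=\<rho> and c="\<lambda>l k. \<bar>l - k\<bar>", OF _ _ _ _ _ abs_diff_weight])
    show "(\<lambda>(t, s). b2 t s) \<in> borel_measurable (borel \<Otimes>\<^sub>M borel)" unfolding b2_def by measurable
    show "\<bar>b2 t s\<bar> \<le> B / T" for t s
      unfolding b2_def using \<omega>B[of "s - t"] \<omega>0[of "s - t"] B T by (auto split: split_indicator)
    show "b2 t s \<noteq> 0 \<longrightarrow> t \<le> R \<and> s \<le> R" for t s
      using \<omega>z[of s t] T \<tau>T by (auto simp: b2_def split: split_indicator_asm)
  qed simp_all
  have cd: "\<eta>' t \<le> B / T * indicator {..2 * T} t - bump (t - \<tau>)" for t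
    by (rule cutoff_deriv_le[OF T \<tau>T B(2)])
  have "(\<integral>pq. main_integrand pq \<partial>(J1 \<Otimes>\<^sub>M J2)) \<le> (\<integral>pq. B / T * H2 pq - H1 pq \<partial>(J1 \<Otimes>\<^sub>M J2))"
  proof (rule integral_mono[OF main_integrable])
    show "integrable (J1 \<Otimes>\<^sub>M J2) (\<lambda>pq. B / T * H2 pq - H1 pq)" using i1 i2 by auto
    fix pq :: "(((real ^ 'd) \<times> real) \<times> real) \<times> (((real ^ 'd) \<times> real) \<times> real)"
    obtain p q where pq: "pq = (p, q)" by (cases pq)
    let ?t = "snd (fst p)"
    let ?k = "\<bar>snd p - snd q\<bar> * (\<omega> (snd (fst q) - ?t) * \<rho> (fst (fst p) - fst (fst q)))"
    have "\<eta>' ?t * ?k \<le> (B / T * indicator {..2 * T} ?t - bump (?t - \<tau>)) * ?k"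
      by (rule mult_right_mono[OF cd]) (use \<omega>0 \<rho>0 in simp)
    then show "main_integrand pq \<le> B / T * H2 pq - H1 pq"
      by (simp add: pq main_integrand_def H1_def H2_def b1_def b2_def bd_def algebra_simps)
  qed
  also have "\<dots> = B / T * (\<integral>pq. H2 pq \<partial>(J1 \<Otimes>\<^sub>M J2)) - (\<integral>pq. H1 pq \<partial>(J1 \<Otimes>\<^sub>M J2))" using i1 i2 by simp
  finally have X1: "(\<integral>pq. main_integrand pq \<partial>(J1 \<Otimes>\<^sub>M J2)) \<le> \<dots>" .
  have ib: "integrable m1 (\<lambda>z. bump (snd z - \<tau>))" by (rule integrable_radon_time[OF S1.radon bc bt])
  have "(\<integral>z. \<eta>' (snd z) \<partial>m1) \<le> (\<integral>z. B / T * indicator {..2 * T} (snd z) - bump (snd z - \<tau>) \<partial>m1)"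
  proof (rule integral_mono)
    show "integrable m1 (\<lambda>z. \<eta>' (snd z))"
      by (rule integrable_radon_time[OF S1.radon continuous_cutoff_deriv, of T "\<tau> + 1"]) (use cutoff_deriv_zero[OF T] in auto)
    show "integrable m1 (\<lambda>z. B / T * indicator {..2 * T} (snd z) - bump (snd z - \<tau>))"
      using ib radon_measure_integrable_indicator[OF S1.radon, of "2 * T"] by auto
  qed (rule cd)
  also have "\<dots> = B / T * measure m1 (torus \<times> {0..2 * T}) - (\<integral>z. bump (snd z - \<tau>) \<partial>m1)"
    using ib radon_measure_integrable_indicator[OF S1.radon, of "2 * T"] by (simp add: measure_slab(1)[OF S1.radon])
  finally have X2: "(\<integral>z. \<eta>' (snd z) \<partial>m1) \<le> \<dots>" .
  have "(\<integral>t. bd t s * indicator {0..} t \<partial>lborel) \<le> B / T * indicator {..3 * T} s" for s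
  proof (cases "s \<le> 3 * T")
    case True
    have "(\<integral>t. bd t s * indicator {0..} t \<partial>lborel) \<le> (\<integral>t. B / T * (\<omega> (s - t) * indicator {0..} t) \<partial>lborel)"
    proof (rule integral_mono[OF time_integrals_left(4)])
      show "integrable lborel (\<lambda>t. B / T * (\<omega> (s - t) * indicator {0..} t))"
        by (intro integrable_mult_right time_kernel_left_real)
      fix t
      have "0 \<le> B / T" using B T by simp
      then have "\<eta>' t \<le> B / T" using cd[of t] bump_nonneg[of "t - \<tau>"] by (cases "t \<le> 2 * T") auto
      then have "\<eta>' t * (\<omega> (s - t) * indicator {0..} t) \<le> B / T * (\<omega> (s - t) * indicator {0..} t)"
        by (rule mult_right_mono) (use \<omega>0 in simp)
      then show "bd t s * indicator {0..} t \<le> B / T * (\<omega> (s - t) * indicator {0..} t)" by (simp add: bd_def mult.assoc)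
    qed
    also have "\<dots> = B / T * (\<integral>t. \<omega> (s - t) * indicator {0..} t \<partial>lborel)" by simp
    also have "\<dots> \<le> B / T * 1" using B T by (intro mult_left_mono time_kernel_left_real) auto
    finally show ?thesis using True by simp
  next
    case False
    have "bd t s * indicator {0..} t \<le> 0" for t
    proof (cases "\<omega> (s - t) = 0")
      case nz: False
      then have "t > 2 * T" using \<omega>z[OF nz] False by linarith
      then have "\<eta>' t \<le> 0" using cd[of t] bump_nonneg[of "t - \<tau>"] by simp
      then have "\<eta>' t * (\<omega> (s - t) * indicator {0..} t) \<le> 0" using \<omega>0 by (intro mult_nonpos_nonneg) auto
      then show ?thesis by (simp add: bd_def mult.assoc)
    qed (simp add: bd_def)
    then have "(\<integral>t. bd t s * indicator {0..} t \<partial>lborel) \<le> integral\<^sup>L lborel (\<lambda>t :: real. 0)"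
      by (intro integral_mono[OF time_integrals_left(4)]) auto
    with False show ?thesis by simp
  qed
  then have "(\<integral>z. (\<integral>t. bd t (snd z) * indicator {0..} t \<partial>lborel) \<partial>m1') \<le> (\<integral>z. B / T * indicator {..3 * T} (snd z) \<partial>m1')"
    using radon_measure_integrable_indicator[OF S2.radon, of "3 * T"] B T by (intro integral_mono') auto
  also have "\<dots> = B / T * measure m1' (torus \<times> {0..3 * T})"
    by (simp add: measure_slab(1)[OF S2.radon])
  finally have X3: "(\<integral>z. (\<integral>t. bd t (snd z) * indicator {0..} t \<partial>lborel) \<partial>m1') \<le> \<dots>" .
  have main: "(\<integral>pq. H1 pq \<partial>(J1 \<Otimes>\<^sub>M J2)) + (\<integral>z. bump (snd z - \<tau>) \<partial>m1)
      \<le> B / T * ((\<integral>pq. H2 pq \<partial>(J1 \<Otimes>\<^sub>M J2)) + measure m1 (torus \<times> {0..2 * T}) + measure m1' (torus \<times> {0..3 * T}))"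
    using doubling X1 X2 X3 unfolding distrib_left by linarith
  have H0: "0 \<le> H1 pq" "0 \<le> H2 pq" for pq
    using \<omega>0 \<rho>0 bump_nonneg by (auto simp: H1_def H2_def b1_def b2_def split: prod.split)
  have e1: "(\<integral>\<^sup>+pq. (case pq of (p, q) \<Rightarrow> ennreal \<bar>snd p - snd q\<bar> * ennreal (bump (snd (fst p) - \<tau>)) * moll_kernel (fst p) (fst q)) \<partial>(J1 \<Otimes>\<^sub>M J2))
      = ennreal (\<integral>pq. H1 pq \<partial>(J1 \<Otimes>\<^sub>M J2))"
  proof -
    have "(case pq of (p, q) \<Rightarrow> ennreal \<bar>snd p - snd q\<bar> * ennreal (bump (snd (fst p) - \<tau>)) * moll_kernel (fst p) (fst q)) = ennreal (H1 pq)" for pq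
      using \<omega>0 \<rho>0 bump_nonneg
      by (auto simp: H1_def b1_def moll_kernel_def ennreal_mult[symmetric] mult_ac split: prod.split)
    then show ?thesis using i1 H0 by (simp add: nn_integral_eq_integral)
  qed
  have e2: "(\<integral>\<^sup>+pq. (case pq of (p, q) \<Rightarrow> ennreal \<bar>snd p - snd q\<bar> * indicator {..2 * T} (snd (fst p)) * moll_kernel (fst p) (fst q)) \<partial>(J1 \<Otimes>\<^sub>M J2))
      = ennreal (\<integral>pq. H2 pq \<partial>(J1 \<Otimes>\<^sub>M J2))"
  proof -
    have "(case pq of (p, q) \<Rightarrow> ennreal \<bar>snd p - snd q\<bar> * indicator {..2 * T} (snd (fst p)) * moll_kernel (fst p) (fst q)) = ennreal (H2 pq)" for pq
      using \<omega>0 \<rho>0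
      by (auto simp: H2_def b2_def moll_kernel_def ennreal_mult[symmetric] mult_ac split: prod.split split_indicator)
    then show ?thesis using i2 H0 by (simp add: nn_integral_eq_integral)
  qed
  have e3: "(\<integral>\<^sup>+z. ennreal (bump (snd z - \<tau>)) \<partial>m1) = ennreal (\<integral>z. bump (snd z - \<tau>) \<partial>m1)"
    using ib bump_nonneg by (simp add: nn_integral_eq_integral)
  have n: "0 \<le> (\<integral>pq. H1 pq \<partial>(J1 \<Otimes>\<^sub>M J2))" "0 \<le> (\<integral>pq. H2 pq \<partial>(J1 \<Otimes>\<^sub>M J2))" "0 \<le> (\<integral>z. bump (snd z - \<tau>) \<partial>m1)"
    using H0 bump_nonneg by (auto intro!: Bochner_Integration.integral_nonneg)
  have "ennreal (\<integral>pq. H1 pq \<partial>(J1 \<Otimes>\<^sub>M J2)) + ennreal (\<integral>z. bump (snd z - \<tau>) \<partial>m1)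
     \<le> ennreal (B / T * ((\<integral>pq. H2 pq \<partial>(J1 \<Otimes>\<^sub>M J2)) + measure m1 (torus \<times> {0..2 * T}) + measure m1' (torus \<times> {0..3 * T})))"
    using ennreal_leI[OF main] n by simp
  also have "\<dots> = ennreal (B / T) * ennreal ((\<integral>pq. H2 pq \<partial>(J1 \<Otimes>\<^sub>M J2)) + measure m1 (torus \<times> {0..2 * T}) + measure m1' (torus \<times> {0..3 * T}))"
    using B T n by (intro ennreal_mult) auto
  also have "ennreal ((\<integral>pq. H2 pq \<partial>(J1 \<Otimes>\<^sub>M J2)) + measure m1 (torus \<times> {0..2 * T}) + measure m1' (torus \<times> {0..3 * T}))
     = ennreal (\<integral>pq. H2 pq \<partial>(J1 \<Otimes>\<^sub>M J2)) + emeasure m1 (torus \<times> {0..2 * T}) + emeasure m1' (torus \<times> {0..3 * T})"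
    using n by (simp add: measure_slab(2)[OF S1.radon, symmetric] measure_slab(2)[OF S2.radon, symmetric])
  also have "ennreal (B / T) * (ennreal (\<integral>pq. H2 pq \<partial>(J1 \<Otimes>\<^sub>M J2)) + emeasure m1 (torus \<times> {0..2 * T}) + emeasure m1' (torus \<times> {0..3 * T}))
     \<le> ennreal (B / T) * (((\<integral>\<^sup>+p. ennreal \<bar>snd p - v0 (fst (fst p))\<bar> * indicator {..2 * T} (snd (fst p)) \<partial>J1)
      + (\<integral>\<^sup>+q. ennreal \<bar>snd q - v0 (fst (fst q))\<bar> * indicator {..3 * T} (snd (fst q)) \<partial>J2)
      + ennreal (2 * T) * (\<integral>\<^sup>+x. \<integral>\<^sup>+y. ennreal (\<rho> (x - y)) * ennreal \<bar>v0 x - v0 y\<bar> \<partial>lebesgue_on torus \<partial>lebesgue_on torus))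
      + emeasure m1 (torus \<times> {0..2 * T}) + emeasure m1' (torus \<times> {0..3 * T}))"
    by (intro mult_left_mono add_right_mono initial_layer_bound[OF v0, unfolded e2]) simp
  finally show ?thesis unfolding e1 e3 by (simp add: add.assoc)
qed

end

section \<open>Passage to the limit in the contraction estimate\<close>

text \<open>
  For \<open>a\<close> in the open interval, \<open>cos (a - u) = 1\<close> with \<open>u\<close> in \<open>[0, 2\<pi>]\<close> is possible for \<open>u = a\<close> only, and compactness
  makes this quantitative.
\<close>

lemma cos_concentration:
  assumes a: "0 < a" "a < 2 * pi" and r: "r > 0"
  shows "\<exists>\<eta>>0. \<forall>u\<in>{0..2 * pi}. 1 - cos (a - u) < \<eta> \<longrightarrow> \<bar>a - u\<bar> < r"
proof -
  define C where "C = {0..2 * pi} - ball a r"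
  have C: "compact C" unfolding C_def by (intro compact_diff) auto
  have pos: "1 - cos (a - u) > 0" if "u \<in> C" for u
  proof -
    have u: "0 \<le> u" "u \<le> 2 * pi" "\<bar>a - u\<bar> \<ge> r" using that by (auto simp: C_def dist_real_def)
    have "cos (a - u) \<noteq> 1"
    proof
      assume "cos (a - u) = 1"
      then obtain n :: int where n: "a - u = of_int n * 2 * pi" by (auto simp: cos_one_2pi_int)
      have "\<bar>a - u\<bar> < 2 * pi" using a u by (auto simp: abs_less_iff)
      then have "\<bar>of_int n :: real\<bar> * (2 * pi) < 1 * (2 * pi)" unfolding n by (simp add: abs_mult)
      then have "\<bar>of_int n :: real\<bar> < 1" by (subst (asm) mult_less_cancel_right) auto
      then have "n = 0" by linarith
      with n u r show False by simp
    qed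
    then show ?thesis using cos_le_one[of "a - u"] by linarith
  qed
  show ?thesis
  proof (cases "C = {}")
    case True
    then show ?thesis by (intro exI[of _ 1]) (auto simp: C_def dist_real_def subset_iff)
  next
    case False
    have "continuous_on C (\<lambda>u. 1 - cos (a - u))" by (intro continuous_intros)
    from continuous_attains_inf[OF C False this] obtain v
      where v: "v \<in> C" "\<And>u. u \<in> C \<Longrightarrow> 1 - cos (a - v) \<le> 1 - cos (a - u)" by blast
    show ?thesis
    proof (intro exI[of _ "1 - cos (a - v)"] conjI ballI impI)
      fix u assume u: "u \<in> {0..2 * pi}" "1 - cos (a - u) < 1 - cos (a - v)"
      then have "u \<notin> C" using v(2)[of u] by linarith
      with u show "\<bar>a - u\<bar> < r" by (auto simp: C_def dist_real_def)
    qed (rule pos[OF v(1)])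
  qed
qed

lemma mollifier_concentration:
  fixes x :: "real ^ 'd"
  assumes x: "\<And>i. 0 < x $ i" "\<And>i. x $ i < 2 * pi" and r: "r > 0"
  shows "\<exists>\<eta>>0. \<forall>\<delta>\<le>\<eta>. \<forall>y\<in>torus. mollifier \<delta> (x - y) \<noteq> 0 \<longrightarrow> dist x y < r"
proof -
  let ?c = "r / real CARD('d)"
  have c: "?c > 0" using r by simp
  have "\<forall>i. \<exists>\<eta>>0. \<forall>u\<in>{0..2 * pi}. 1 - cos (x $ i - u) < \<eta> \<longrightarrow> \<bar>x $ i - u\<bar> < ?c"
    using cos_concentration[OF x c] by blast
  then obtain \<eta> where \<eta>: "\<And>i. \<eta> i > 0" "\<And>i u. u \<in> {0..2 * pi} \<Longrightarrow> 1 - cos (x $ i - u) < \<eta> i \<Longrightarrow> \<bar>x $ i - u\<bar> < ?c"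
    by metis
  have fin: "finite (range \<eta>)" "range \<eta> \<noteq> {}" by auto
  show ?thesis
  proof (intro exI[of _ "Min (range \<eta>)"] conjI allI ballI impI)
    show "0 < Min (range \<eta>)" using fin \<eta>(1) by (simp add: Min_gr_iff)
    fix \<delta> and y :: "real ^ 'd"
    assume d: "\<delta> \<le> Min (range \<eta>)" and y: "y \<in> torus" and m: "mollifier \<delta> (x - y) \<noteq> 0"
    have "\<bar>(x - y) $ i\<bar> < ?c" for i
    proof -
      have "1 - cos (x $ i - y $ i) < \<delta>" using mollifier_support[OF m, of i] by simp
      moreover have "\<delta> \<le> \<eta> i" using d fin(1) by (meson Min_le order_trans rangeI)
      ultimately have "\<bar>x $ i - y $ i\<bar> < ?c" using y by (intro \<eta>(2)) (auto simp: torus_def less_imp_le)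
      then show ?thesis by simp
    qed
    then have "(\<Sum>i\<in>UNIV. \<bar>(x - y) $ i\<bar>) < (\<Sum>i\<in>(UNIV :: 'd set). ?c)" by (intro sum_strict_mono) auto
    then have "(\<Sum>i\<in>UNIV. \<bar>(x - y) $ i\<bar>) < r" by simp
    then show "dist x y < r" using norm_le_l1_cart[of "x - y"] by (simp add: dist_norm)
  qed
qed

lemma AE_torus_interior:
  "AE x in lebesgue_on torus. \<forall>i. 0 < (x :: real ^ 'd) $ i \<and> x $ i < 2 * pi"
proof -
  have "AE x in lebesgue. (x :: real ^ 'd) $ i \<noteq> 0" for i
  proof -
    have "negligible {x :: real ^ 'd. x $ i = 0}" by (rule negligible_standard_hyperplane_cart)
    then have "{x :: real ^ 'd. x $ i = 0} \<in> null_sets lebesgue"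
      by (simp add: negligible_iff_null_sets)
    then have "AE x in lebesgue. x \<notin> {x :: real ^ 'd. x $ i = 0}" by (rule AE_not_in)
    then show ?thesis by simp
  qed
  then have "AE x in lebesgue. \<forall>i. (x :: real ^ 'd) $ i \<noteq> 0" by (subst AE_all_countable) auto
  then show ?thesis
    by (subst AE_restrict_space_iff) (auto simp: torus_def less_le elim!: eventually_mono)
qed

lemma AE_spacetime_fst:
  fixes P :: "real ^ 'd \<Rightarrow> bool"
  assumes "AE x in lebesgue_on torus. P x"
  shows "AE z in lebesgue_on spacetime. P (fst z)"
proof -
  have "AE x in lebesgue. x \<in> torus \<longrightarrow> P x" using assms by (simp add: AE_restrict_space_iff)
  then have "AE x in lborel. x \<in> torus \<longrightarrow> P x" by (simp add: AE_completion_iff)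
  then obtain N where N: "{x. \<not> (x \<in> torus \<longrightarrow> P x)} \<subseteq> N" "N \<in> sets lborel" "emeasure lborel N = 0"
    by (elim AE_E) auto
  have "N \<times> (UNIV :: real set) \<in> null_sets (lborel \<Otimes>\<^sub>M lborel)"
    using N lborel.emeasure_pair_measure_Times[of N "lborel :: (real ^ 'd) measure" "UNIV :: real set"]
    by (auto simp: null_sets_def simp del: lborel_prod)
  then have "AE z in lborel. z \<notin> N \<times> (UNIV :: real set)" unfolding lborel_prod by (rule AE_not_in)
  then have "AE z in lebesgue. z \<in> spacetime \<longrightarrow> P (fst z)"
    unfolding AE_completion_iff by eventually_elim (use N(1) in \<open>auto simp: spacetime_def\<close>)
  then show ?thesis by (simp add: AE_restrict_space_iff)
qed

text \<open>
  Both summands in the initial condition are nonnegative. The Lebesgue measurable datum \<open>u0\<close> is replaced by a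
  Borel representative \<open>v0\<close>, which is measurable as a function on space-time.
\<close>

lemma (in entropy_solution) initial_decay:
  assumes init: "initial_condition u0 \<nu> m1"
    and v0: "v0 \<in> borel_measurable borel" "integrable lborel (\<lambda>x. v0 x * indicator torus x)"
    and ae: "AE x in lebesgue_on torus. u0 x = v0 x" and e: "e > 0"
  shows "\<forall>\<^sub>F T in at_right 0. (\<integral>\<^sup>+p. ennreal \<bar>snd p - v0 (fst (fst p))\<bar> * indicator {..T} (snd (fst p)) \<partial>joint)
      + emeasure m1 (torus \<times> {0..T}) \<le> ennreal (e * T)"
proof -
  note [measurable] = v0(1)
  define F where "F T p = \<bar>snd p - v0 (fst (fst p))\<bar> * indicator {..T} (snd (fst p))" for T and p :: "((real ^ 'd) \<times> real) \<times> real"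
  have F0: "F T p \<ge> 0" for T p by (simp add: F_def)
  have iF: "integrable joint (F T)" for T
  proof -
    have "integrable lborel (\<lambda>t. indicator {..T} t * indicator {0..} t :: real)"
    proof -
      have "(\<lambda>t. indicator {..T} t * indicator {0..} t :: real) = indicator {0..T}"
        by (auto simp: fun_eq_iff split: split_indicator)
      moreover have "integrable lborel (indicator {0..T} :: real \<Rightarrow> real)"
        by (intro integrable_real_indicator emeasure_bounded_finite) auto
      ultimately show ?thesis by simp
    qed
    then have "integrable \<Lambda> (\<lambda>z. v0 (fst z) * indicator {..T} (snd z))"
      by (intro integral_spacetime_product(2) v0) auto
    then have 1: "integrable joint (\<lambda>p. v0 (fst (fst p)) * indicator {..T} (snd (fst p)))"
      by (rule integrable_joint_fst(1))
    show ?thesis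
    proof (rule Bochner_Integration.integrable_bound)
      show "integrable joint (\<lambda>p. weight T p + \<bar>v0 (fst (fst p)) * indicator {..T} (snd (fst p))\<bar>)"
        by (intro Bochner_Integration.integrable_add integrable_abs weight_integrable 1)
      show "F T \<in> borel_measurable joint" unfolding F_def[abs_def] by measurable
      show "AE p in joint. norm (F T p) \<le> norm (weight T p + \<bar>v0 (fst (fst p)) * indicator {..T} (snd (fst p))\<bar>)"
        by (rule AE_I2) (auto simp: F_def weight_def split: split_indicator)
    qed
  qed
  have I: "(LINT z:torus \<times> {0..T}|lebesgue. (\<integral>l. \<bar>l - u0 (fst z)\<bar> \<partial>\<nu> z)) = (\<integral>p. F T p \<partial>joint)" for T
  proof -
    have ind: "indicator (torus \<times> {0..T}) z = (indicator spacetime z * indicator {..T} (snd z) :: real)" for z :: "(real ^ 'd) \<times> real"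
      by (auto simp: spacetime_def mem_Times_iff split: split_indicator)
    have "(LINT z:torus \<times> {0..T}|lebesgue. (\<integral>l. \<bar>l - u0 (fst z)\<bar> \<partial>\<nu> z))
       = (\<integral>z. indicator spacetime z *\<^sub>R (indicator {..T} (snd z) * (\<integral>l. \<bar>l - u0 (fst z)\<bar> \<partial>\<nu> z)) \<partial>lebesgue)"
      unfolding set_lebesgue_integral_def ind by (simp add: mult.assoc)
    also have "\<dots> = (\<integral>z. indicator {..T} (snd z) * (\<integral>l. \<bar>l - u0 (fst z)\<bar> \<partial>\<nu> z) \<partial>\<Lambda>)"
      by (subst integral_restrict_space) auto
    also have "\<dots> = (\<integral>z. \<integral>l. F T (z, l) \<partial>\<nu> z \<partial>\<Lambda>)"
    proof -
      have ae': "AE z in \<Lambda>. indicator {..T} (snd z) * (\<integral>l. \<bar>l - u0 (fst z)\<bar> \<partial>\<nu> z) = (\<integral>l. F T (z, l) \<partial>\<nu> z)"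
        using AE_spacetime_fst[OF ae] by eventually_elim (simp add: F_def mult.commute)
      have m: "(\<lambda>z. \<integral>l. F T (z, l) \<partial>\<nu> z) \<in> borel_measurable \<Lambda>"
        by (rule borel_measurable_integrable[OF integrable_integral_joint[OF iF]])
      have "(\<lambda>z. indicator {..T} (snd z) * (\<integral>l. \<bar>l - u0 (fst z)\<bar> \<partial>\<nu> z)) \<in> borel_measurable \<Lambda>"
        by (rule lebesgue_on_AE_measurable[OF _ ae' m]) auto
      from integral_cong_AE[OF this m ae'] show ?thesis .
    qed
    also have "\<dots> = (\<integral>p. F T p \<partial>joint)" by (rule integral_joint[OF iF, symmetric])
    finally show ?thesis .
  qed
  have "((\<lambda>T. 1 / T * (\<integral>p. F T p \<partial>joint) + 1 / T * measure m1 (torus \<times> {0..T})) \<longlongrightarrow> 0) (at_right 0)"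
    using init unfolding initial_condition_def I .
  then have "\<forall>\<^sub>F T in at_right 0. 1 / T * (\<integral>p. F T p \<partial>joint) + 1 / T * measure m1 (torus \<times> {0..T}) < e"
    by (rule order_tendstoD) (rule e)
  moreover have "\<forall>\<^sub>F T in at_right (0 :: real). T > 0" by (rule eventually_at_right_less)
  ultimately show ?thesis
  proof eventually_elim
    case (elim T)
    have "(\<integral>p. F T p \<partial>joint) + measure m1 (torus \<times> {0..T}) < e * T"
      using elim by (simp add: field_simps)
    moreover have "(\<integral>\<^sup>+p. ennreal \<bar>snd p - v0 (fst (fst p))\<bar> * indicator {..T} (snd (fst p)) \<partial>joint) = ennreal (\<integral>p. F T p \<partial>joint)"
    proof -
      have "ennreal \<bar>snd p - v0 (fst (fst p))\<bar> * indicator {..T} (snd (fst p)) = ennreal (F T p)" for p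
        by (auto simp: F_def split: split_indicator)
      then show ?thesis using iF F0 by (simp add: nn_integral_eq_integral)
    qed
    moreover have "emeasure m1 (torus \<times> {0..T}) = ennreal (measure m1 (torus \<times> {0..T}))"
      using radon by (subst emeasure_eq_ennreal_measure) (auto simp: radon_measure_def less_top[symmetric])
    moreover have "0 \<le> (\<integral>p. F T p \<partial>joint)" by (rule Bochner_Integration.integral_nonneg) (rule F0)
    ultimately show ?case by (simp add: ennreal_plus[symmetric] less_imp_le ennreal_leI del: ennreal_plus)
  qed
qed

locale common_datum =
  S1: entropy_solution f \<nu> m1 m2 + S2: entropy_solution f \<sigma> m1' m2'
  for f :: "real \<Rightarrow> real ^ 'd" and \<nu> m1 m2 \<sigma> m1' m2' +
  fixes u0 v0 :: "real ^ 'd \<Rightarrow> real"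
  assumes init1: "initial_condition u0 \<nu> m1" and init2: "initial_condition u0 \<sigma> m1'"
    and v0: "v0 \<in> borel_measurable borel" "integrable lborel (\<lambda>x. v0 x * indicator torus x)"
    and u0_v0: "AE x in lebesgue_on torus. u0 x = v0 x"
begin

lemma translation_continuity:
  "(\<lambda>n. \<integral>\<^sup>+x. \<integral>\<^sup>+y. ennreal (mollifier (1 / real (Suc n)) (x - y)) * ennreal \<bar>v0 x - v0 y\<bar>
      \<partial>lebesgue_on torus \<partial>lebesgue_on torus) \<longlonglongrightarrow> 0"
proof (rule approximate_identity_L1)
  show "torus \<in> sets lebesgue" by simp
  show "emeasure lebesgue torus < \<infinity>" by (rule torus_finite)
  have [measurable]: "(\<lambda>z. z) \<in> borel_measurable (lebesgue_on (torus :: (real ^ 'd) set))"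
    by (rule borel_measurable_lebesgue_on) simp
  show "(\<lambda>(x, y). ennreal (mollifier (1 / real (Suc n)) (x - y)))
      \<in> borel_measurable (lebesgue_on (torus :: (real ^ 'd) set) \<Otimes>\<^sub>M lebesgue_on torus)" for n
    by measurable
  show "(\<integral>\<^sup>+y. ennreal (mollifier (1 / real (Suc n)) (x - y)) \<partial>lebesgue_on torus) \<le> 1" if "x \<in> torus" for n and x :: "real ^ 'd"
    using mollifier_mass(2)[OF _ that, of "1 / real (Suc n)"] by (simp add: nn_integral_lebesgue_on)
  show "(\<integral>\<^sup>+x. ennreal (mollifier (1 / real (Suc n)) (x - y)) \<partial>lebesgue_on torus) \<le> 1" if "y \<in> torus" for n and y :: "real ^ 'd"
    using mollifier_mass(1)[OF _ that, of "1 / real (Suc n)"] by (simp add: nn_integral_lebesgue_on)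
  show "integrable (lebesgue_on torus) v0" using v0 by (simp add: integral_lebesgue_on_borel)
  show "AE x in lebesgue_on torus. \<forall>r>0. \<forall>\<^sub>F n in sequentially. \<forall>y\<in>torus. ennreal (mollifier (1 / real (Suc n)) (x - y)) \<noteq> 0 \<longrightarrow> dist (x :: real ^ 'd) y < r"
    using AE_torus_interior
  proof eventually_elim
    case (elim x)
    show ?case
    proof (intro allI impI)
      fix r :: real assume "r > 0"
      with mollifier_concentration[of x r] elim obtain \<eta>
        where \<eta>: "\<eta> > 0" "\<And>\<delta> y. \<delta> \<le> \<eta> \<Longrightarrow> y \<in> torus \<Longrightarrow> mollifier \<delta> (x - y) \<noteq> 0 \<Longrightarrow> dist x y < r" by blast
      have "\<forall>\<^sub>F n in sequentially. 1 / real (Suc n) < \<eta>"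
        using order_tendstoD(2)[OF lim_1_over_n[THEN LIMSEQ_Suc] \<eta>(1)] by simp
      then show "\<forall>\<^sub>F n in sequentially. \<forall>y\<in>torus. ennreal (mollifier (1 / real (Suc n)) (x - y)) \<noteq> 0 \<longrightarrow> dist x y < r"
        by eventually_elim (use \<eta>(2) in \<open>metis ennreal_0 less_imp_le\<close>)
    qed
  qed
qed

text \<open>
  The time scale \<open>T n\<close> is chosen after the width \<open>1/(n+1)\<close> of the mollifier, small enough for both initial conditions to hold
  with error \<open>1/(n+1)\<close>. The mass of \<open>m1\<close> near \<open>\<tau>\<close> involves neither parameter, so it is zero and not merely small.
\<close>

lemma contraction_limit:
  assumes \<tau>: "\<tau> > 0"
  obtains T where "\<And>n. T n > 0" "\<And>n. T n \<le> 1 / real (Suc n)"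
    "(\<lambda>n. \<integral>\<^sup>+pq. (case pq of (p, q) \<Rightarrow> ennreal \<bar>snd p - snd q\<bar> * ennreal (bump (snd (fst p) - \<tau>))
        * ennreal (time_kernel (T n) (snd (fst q) - snd (fst p)) * mollifier (1 / real (Suc n)) (fst (fst p) - fst (fst q))))
        \<partial>(S1.joint \<Otimes>\<^sub>M S2.joint)) \<longlonglongrightarrow> 0"
    "(\<integral>\<^sup>+z. ennreal (bump (snd z - \<tau>)) \<partial>m1) = 0"
proof -
  obtain B where B: "B > 0" "\<And>x. bump x \<le> B" using bump_bounded by metis
  define W where "W n = (\<integral>\<^sup>+x. \<integral>\<^sup>+y. ennreal (mollifier (1 / real (Suc n)) (x - y)) * ennreal \<bar>v0 x - v0 y\<bar>
      \<partial>lebesgue_on torus \<partial>lebesgue_on torus)" for n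
  define L where "L n T = (\<integral>\<^sup>+pq. (case pq of (p, q) \<Rightarrow> ennreal \<bar>snd p - snd q\<bar> * ennreal (bump (snd (fst p) - \<tau>))
        * ennreal (time_kernel T (snd (fst q) - snd (fst p)) * mollifier (1 / real (Suc n)) (fst (fst p) - fst (fst q))))
        \<partial>(S1.joint \<Otimes>\<^sub>M S2.joint))" for n T
  define m where "m = (\<integral>\<^sup>+z. ennreal (bump (snd z - \<tau>)) \<partial>m1)"
  define r where "r n = ennreal B * (ennreal (5 / real (Suc n)) + 2 * W n)" for n
  have "\<exists>T>0. T \<le> 1 / real (Suc n) \<and> L n T + m \<le> r n" for n
  proof -
    let ?e = "1 / real (Suc n)"
    have e: "?e > 0" by simp
    have f2: "filterlim (\<lambda>T :: real. 2 * T) (at_right 0) (at_right 0)"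
      and f3: "filterlim (\<lambda>T :: real. 3 * T) (at_right 0) (at_right 0)"
      by real_asymp+
    have 1: "\<forall>\<^sub>F T in at_right 0. (\<integral>\<^sup>+p. ennreal \<bar>snd p - v0 (fst (fst p))\<bar> * indicator {..2 * T} (snd (fst p)) \<partial>S1.joint)
      + emeasure m1 (torus \<times> {0..2 * T}) \<le> ennreal (?e * (2 * T))"
      by (rule eventually_compose_filterlim[OF S1.initial_decay[OF init1 v0 u0_v0 e] f2])
    have 2: "\<forall>\<^sub>F T in at_right 0. (\<integral>\<^sup>+p. ennreal \<bar>snd p - v0 (fst (fst p))\<bar> * indicator {..3 * T} (snd (fst p)) \<partial>S2.joint)
      + emeasure m1' (torus \<times> {0..3 * T}) \<le> ennreal (?e * (3 * T))"
      by (rule eventually_compose_filterlim[OF S2.initial_decay[OF init2 v0 u0_v0 e] f3])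
    have 3: "\<forall>\<^sub>F T in at_right (0 :: real). 0 < T \<and> T < min ?e (\<tau> / 2)"
      using \<tau> by (intro eventually_at_rightI[of 0 "min ?e (\<tau> / 2)"]) auto
    from eventually_conj[OF 1 eventually_conj[OF 2 3]]
    have "\<exists>T. (\<integral>\<^sup>+p. ennreal \<bar>snd p - v0 (fst (fst p))\<bar> * indicator {..2 * T} (snd (fst p)) \<partial>S1.joint)
      + emeasure m1 (torus \<times> {0..2 * T}) \<le> ennreal (?e * (2 * T))
      \<and> (\<integral>\<^sup>+p. ennreal \<bar>snd p - v0 (fst (fst p))\<bar> * indicator {..3 * T} (snd (fst p)) \<partial>S2.joint)
      + emeasure m1' (torus \<times> {0..3 * T}) \<le> ennreal (?e * (3 * T)) \<and> 0 < T \<and> T < min ?e (\<tau> / 2)"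
      by (rule eventually_happens'[OF trivial_limit_at_right_real])
    then obtain T where T1: "(\<integral>\<^sup>+p. ennreal \<bar>snd p - v0 (fst (fst p))\<bar> * indicator {..2 * T} (snd (fst p)) \<partial>S1.joint)
      + emeasure m1 (torus \<times> {0..2 * T}) \<le> ennreal (?e * (2 * T))"
      and T2: "(\<integral>\<^sup>+p. ennreal \<bar>snd p - v0 (fst (fst p))\<bar> * indicator {..3 * T} (snd (fst p)) \<partial>S2.joint)
      + emeasure m1' (torus \<times> {0..3 * T}) \<le> ennreal (?e * (3 * T))"
      and T: "0 < T" "T < ?e" "2 * T \<le> \<tau>" by auto
    have loc: "two_solutions f \<nu> m1 m2 \<sigma> m1' m2' ?e T \<tau>"
      using T \<tau> by unfold_locales auto
    have "L n T + m \<le> ennreal (B / T) * ((\<integral>\<^sup>+p. ennreal \<bar>snd p - v0 (fst (fst p))\<bar> * indicator {..2 * T} (snd (fst p)) \<partial>S1.joint)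
      + (\<integral>\<^sup>+q. ennreal \<bar>snd q - v0 (fst (fst q))\<bar> * indicator {..3 * T} (snd (fst q)) \<partial>S2.joint)
      + ennreal (2 * T) * W n + emeasure m1 (torus \<times> {0..2 * T}) + emeasure m1' (torus \<times> {0..3 * T}))"
      using two_solutions.energy_estimate[OF loc T(3) B v0(1)]
      unfolding two_solutions.moll_kernel_def[OF loc] L_def m_def W_def .
    also have "\<dots> = ennreal (B / T) * (((\<integral>\<^sup>+p. ennreal \<bar>snd p - v0 (fst (fst p))\<bar> * indicator {..2 * T} (snd (fst p)) \<partial>S1.joint)
      + emeasure m1 (torus \<times> {0..2 * T})) + ((\<integral>\<^sup>+q. ennreal \<bar>snd q - v0 (fst (fst q))\<bar> * indicator {..3 * T} (snd (fst q)) \<partial>S2.joint)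
      + emeasure m1' (torus \<times> {0..3 * T})) + ennreal (2 * T) * W n)"
      by (simp add: add_ac)
    also have "\<dots> \<le> ennreal (B / T) * (ennreal (?e * (2 * T)) + ennreal (?e * (3 * T)) + ennreal (2 * T) * W n)"
      by (intro mult_left_mono add_mono T1 T2 order_refl) auto
    also have "ennreal (?e * (2 * T)) + ennreal (?e * (3 * T)) = ennreal T * ennreal (5 / real (Suc n))"
      using T(1) by (simp add: ennreal_plus[symmetric] ennreal_mult[symmetric] add_divide_distrib[symmetric] del: ennreal_plus)
    also have "ennreal (2 * T) = ennreal T * 2" using T(1) by (simp add: ennreal_mult' mult.commute)
    also have "ennreal (B / T) * (ennreal T * ennreal (5 / real (Suc n)) + ennreal T * 2 * W n)
       = (ennreal (B / T) * ennreal T) * (ennreal (5 / real (Suc n)) + 2 * W n)"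
      by (simp add: distrib_left mult.assoc)
    also have "ennreal (B / T) * ennreal T = ennreal B" using T(1) B by (simp add: ennreal_mult[symmetric])
    finally show ?thesis using T by (auto simp: r_def less_imp_le)
  qed
  then obtain T where T: "\<And>n. T n > 0" "\<And>n. T n \<le> 1 / real (Suc n)" "\<And>n. L n (T n) + m \<le> r n" by metis
  have "(\<lambda>n. ennreal B * (ennreal (5 / real (Suc n)) + 2 * W n)) \<longlonglongrightarrow> ennreal B * (ennreal 0 + 2 * 0)"
  proof (intro tendsto_add ennreal_tendsto_cmult tendsto_ennrealI)
    show "(\<lambda>n. 5 / real (Suc n)) \<longlonglongrightarrow> 0" by real_asymp
    show "W \<longlonglongrightarrow> 0" unfolding W_def by (rule translation_continuity)
  qed auto
  then have r: "r \<longlonglongrightarrow> 0" unfolding r_def[abs_def] by simp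
  have le: "m \<le> r n" "L n (T n) \<le> r n" for n
    by (rule order_trans[OF _ T(3)]; simp add: add_increasing add_increasing2)+
  have "(\<lambda>n. m) \<longlonglongrightarrow> 0"
    by (rule tendsto_sandwich[OF _ _ tendsto_const r]) (simp_all add: le)
  then have "m = 0" by (simp add: LIMSEQ_const_iff)
  moreover have "(\<lambda>n. L n (T n)) \<longlonglongrightarrow> 0"
    by (rule tendsto_sandwich[OF _ _ tendsto_const r]) (simp_all add: le)
  ultimately show ?thesis using T by (intro that[of T]) (auto simp: L_def m_def)
qed

end

section \<open>Absence of concentration\<close>

lemma positive_time_rational:
  assumes "t > (0 :: real)"
  obtains q :: rat where "real_of_rat q > 0" "bump (t - real_of_rat q) > 0"
proof -
  have "max 0 (t - 1) < t" using assms by simp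
  then obtain q where "max 0 (t - 1) < real_of_rat q" "real_of_rat q < t" using of_rat_dense by blast
  then show ?thesis by (intro that[of q] bump_pos) auto
qed

context common_datum
begin

lemma no_mass_at_initial_time: "emeasure m1 (torus \<times> {0..0}) = 0"
proof -
  have "emeasure m1 (torus \<times> {0..0}) \<le> 0 + ennreal e" if e: "e > 0" for e
  proof -
    have "\<forall>\<^sub>F T in at_right (0 :: real). 0 < T \<and> T < 1" by (intro eventually_at_rightI[of 0 1]) auto
    from eventually_happens'[OF trivial_limit_at_right_real eventually_conj[OF S1.initial_decay[OF init1 v0 u0_v0 e] this]]
    obtain T where T: "(\<integral>\<^sup>+p. ennreal \<bar>snd p - v0 (fst (fst p))\<bar> * indicator {..T} (snd (fst p)) \<partial>S1.joint)
      + emeasure m1 (torus \<times> {0..T}) \<le> ennreal (e * T)" "0 < T" "T < 1" by blast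
    have "emeasure m1 (torus \<times> {0..0}) \<le> emeasure m1 (torus \<times> {0..T})"
      using T(2) S1.radon slab_sets by (intro emeasure_mono) (auto simp: radon_measure_def)
    also have "\<dots> \<le> ennreal (e * T)" using T(1) by (rule order_trans[rotated]) (simp add: add_increasing)
    also have "\<dots> \<le> ennreal e" using T(2,3) e by (intro ennreal_leI) (simp add: mult_left_le)
    finally show ?thesis by simp
  qed
  then have "emeasure m1 (torus \<times> {0..0}) \<le> 0" by (rule ennreal_le_epsilon)
  then show ?thesis by simp
qed

text \<open>
  Unit intervals that start at positive rational times cover all positive times.
\<close>

lemma concentration_vanishes: "m1 = null_measure borel_spacetime"
proof -
  have sp: "space m1 = spacetime" by (rule space_radon_measure[OF S1.radon])
  have s: "sets m1 = sets borel_spacetime" using S1.radon by (simp add: radon_measure_def)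
  have [measurable]: "snd \<in> borel_measurable m1"
    by (intro borel_measurable_radon_measure[OF S1.radon] borel_measurable_continuous_onI continuous_intros)
  have "AE z in m1. real_of_rat q > 0 \<longrightarrow> bump (snd z - real_of_rat q) = 0" for q
  proof (cases "real_of_rat q > 0")
    case True
    from contraction_limit[OF this] have "(\<integral>\<^sup>+z. ennreal (bump (snd z - real_of_rat q)) \<partial>m1) = 0" by blast
    then have "AE z in m1. ennreal (bump (snd z - real_of_rat q)) = 0"
      by (subst (asm) nn_integral_0_iff_AE) auto
    then show ?thesis by eventually_elim (use bump_nonneg in \<open>simp add: antisym\<close>)
  qed simp
  then have "AE z in m1. \<forall>q. real_of_rat q > 0 \<longrightarrow> bump (snd z - real_of_rat q) = 0"
    by (subst AE_all_countable) auto
  moreover have "torus \<times> {0..0} \<in> null_sets m1"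
    by (rule null_setsI[OF no_mass_at_initial_time]) (unfold s, rule slab_sets)
  then have "AE z in m1. z \<notin> torus \<times> {0..0}" by (rule AE_not_in)
  ultimately have "AE z in m1. z \<notin> space m1"
  proof eventually_elim
    case (elim z)
    show ?case
    proof
      assume "z \<in> space m1"
      then have z: "fst z \<in> torus" "snd z \<ge> 0" by (auto simp: sp spacetime_def)
      with elim(2) have "snd z > 0" by (cases z) (auto simp: less_le)
      then obtain q :: rat where "real_of_rat q > 0" "bump (snd z - real_of_rat q) > 0"
        using positive_time_rational by blast
      with elim(1) show False by force
    qed
  qed
  then have "space m1 \<in> null_sets m1" by (subst AE_iff_null_sets) auto
  then have z: "emeasure m1 (space m1) = 0" by auto
  show ?thesis
  proof (rule measure_eqI)
    fix A assume "A \<in> sets m1"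
    then have "emeasure m1 A \<le> emeasure m1 (space m1)" by (intro emeasure_mono sets.sets_into_space) auto
    then show "emeasure m1 A = emeasure (null_measure borel_spacetime) A" using z by simp
  qed (simp add: s)
qed

lemma flux_concentration_vanishes:
  assumes A: "A \<in> bounded_borel" shows "m2 A = 0"
proof -
  obtain C where C: "C > 0" "\<And>A. A \<in> sets borel \<Longrightarrow> A \<subseteq> {0..} \<Longrightarrow>
      total_variation m2 (torus \<times> A) \<le> ennreal C * emeasure m1 (torus \<times> A)"
    using S1.variation by blast
  have "A \<subseteq> torus \<times> {0..}" using A by (auto simp: bounded_borel_def)
  then have "ennreal (norm (m2 A)) \<le> total_variation m2 (torus \<times> {0..})" by (rule norm_le_total_variation[OF A])
  also have "\<dots> \<le> ennreal C * emeasure m1 (torus \<times> {0..})" by (rule C) auto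
  also have "\<dots> = 0" by (simp add: concentration_vanishes)
  finally show ?thesis by simp
qed

end

section \<open>The Young measures are Dirac masses\<close>

text \<open>
  Together with a constant, these are affine coordinates of the inverse stereographic projection of the line to the circle:
  they vanish at infinity and jointly separate points.
\<close>

definition stereo1 :: "real \<Rightarrow> real" where "stereo1 l = 1 / (1 + l\<^sup>2)"
definition stereo2 :: "real \<Rightarrow> real" where "stereo2 l = l / (1 + l\<^sup>2)"
text \<open>
  A multiple of the squared distance on the circle. It vanishes on the diagonal only, and it is bilinear in quantities for which
  a Young measure is controlled.
\<close>

definition chord :: "real \<Rightarrow> real \<Rightarrow> real" where
  "chord l k = stereo1 l + stereo1 k - 2 * stereo1 l * stereo1 k - 2 * stereo2 l * stereo2 k"

lemma one_plus_square_pos: "0 < 1 + (l :: real)\<^sup>2"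
  by (rule add_pos_nonneg) auto

lemma chord_eq: "chord l k = (l - k)\<^sup>2 / ((1 + l\<^sup>2) * (1 + k\<^sup>2))"
proof -
  have "1 + l\<^sup>2 \<noteq> 0" "1 + k\<^sup>2 \<noteq> 0" using one_plus_square_pos[of l] one_plus_square_pos[of k] by auto
  then show ?thesis
    unfolding chord_def stereo1_def stereo2_def by (simp add: divide_simps) (simp add: power2_eq_square algebra_simps)
qed

lemma chord_nonneg: "0 \<le> chord l k"
  unfolding chord_eq using one_plus_square_pos[of l] one_plus_square_pos[of k] by simp

lemma chord_eq_0_iff: "chord l k = 0 \<longleftrightarrow> l = k"
  unfolding chord_eq using one_plus_square_pos[of l] one_plus_square_pos[of k] by auto

lemma chord_le: "chord l k \<le> \<bar>l - k\<bar>"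
proof -
  have sq: "2 * \<bar>x\<bar> \<le> 1 + x\<^sup>2" for x :: real
    using zero_le_power2[of "\<bar>x\<bar> - 1"] by (simp add: power2_diff)
  have "\<bar>l - k\<bar> \<le> (1 + l\<^sup>2) * (1 + k\<^sup>2)"
  proof -
    have "\<bar>l - k\<bar> \<le> \<bar>l\<bar> + \<bar>k\<bar>" by (rule abs_triangle_ineq4)
    also have "\<dots> \<le> 1 + l\<^sup>2 + k\<^sup>2 + l\<^sup>2 * k\<^sup>2"
      using sq[of l] sq[of k] mult_nonneg_nonneg[OF zero_le_power2[of l] zero_le_power2[of k]]
        zero_le_power2[of l] zero_le_power2[of k] by linarith
    also have "\<dots> = (1 + l\<^sup>2) * (1 + k\<^sup>2)" by (simp add: algebra_simps)
    finally show ?thesis .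
  qed
  then have "\<bar>l - k\<bar> * \<bar>l - k\<bar> \<le> \<bar>l - k\<bar> * ((1 + l\<^sup>2) * (1 + k\<^sup>2))" by (rule mult_left_mono) simp
  then have "(l - k)\<^sup>2 \<le> \<bar>l - k\<bar> * ((1 + l\<^sup>2) * (1 + k\<^sup>2))" by (simp add: power2_eq_square flip: abs_mult)
  then show ?thesis unfolding chord_eq
    using one_plus_square_pos[of l] one_plus_square_pos[of k] by (simp add: divide_le_eq)
qed

lemma stereo_bounds: "0 < stereo1 l" "stereo1 l \<le> 1" "\<bar>stereo2 l\<bar> \<le> 1 / 2" "stereo2 l / stereo1 l = l"
proof -
  have p: "1 + l\<^sup>2 > 0" by (rule one_plus_square_pos)
  show "0 < stereo1 l" "stereo1 l \<le> 1" using p by (auto simp: stereo1_def)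
  have "2 * \<bar>l\<bar> \<le> 1 + l\<^sup>2" using zero_le_power2[of "\<bar>l\<bar> - 1"] by (simp add: power2_diff)
  then show "\<bar>stereo2 l\<bar> \<le> 1 / 2" using p by (simp add: stereo2_def abs_divide divide_le_eq)
  show "stereo2 l / stereo1 l = l" using p by (simp add: stereo1_def stereo2_def)
qed

lemma stereo_C0: "stereo1 \<in> C0_real" "stereo2 \<in> C0_real"
proof -
  have n: "1 + l\<^sup>2 \<noteq> 0" for l :: real using one_plus_square_pos[of l] by simp
  have "continuous_on UNIV stereo1" "continuous_on UNIV stereo2"
    unfolding stereo1_def[abs_def] stereo2_def[abs_def] by (intro continuous_intros; simp add: n)+
  moreover have "(stereo1 \<longlongrightarrow> 0) at_infinity" "(stereo2 \<longlongrightarrow> 0) at_infinity"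
    unfolding at_infinity_eq_at_top_bot stereo1_def[abs_def] stereo2_def[abs_def]
    by (intro filterlim_sup; real_asymp)+
  ultimately show "stereo1 \<in> C0_real" "stereo2 \<in> C0_real" by (auto simp: C0_real_def)
qed

lemma stereo_borel [measurable]: "stereo1 \<in> borel_measurable borel" "stereo2 \<in> borel_measurable borel"
  using stereo_C0 by (auto simp: C0_real_def intro: borel_measurable_continuous_onI)

lemma return_if_AE_eq:
  assumes "prob_space M" and s: "sets M = sets borel" and ae: "AE x in M. x = (a :: real)"
  shows "M = return borel a"
proof -
  interpret prob_space M by fact
  show ?thesis
  proof (rule measure_eqI)
    fix A assume A: "A \<in> sets M"
    have "emeasure M A = (\<integral>\<^sup>+x. indicator A x \<partial>M)" using A by simp
    also have "\<dots> = (\<integral>\<^sup>+x. indicator A a \<partial>M)" using ae by (intro nn_integral_cong_AE) auto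
    also have "\<dots> = indicator A a" by (simp add: emeasure_space_1)
    finally show "emeasure M A = emeasure (return borel a) A" using A s by simp
  qed (simp add: s)
qed

lemma AE_positive_time: "AE z in lebesgue_on spacetime. snd (z :: (real ^ 'd) \<times> real) > 0"
proof -
  have "negligible {z :: (real ^ 'd) \<times> real. z \<bullet> (0, 1) = 0}"
    by (rule negligible_standard_hyperplane) (simp add: Basis_prod_def)
  then have "{z :: (real ^ 'd) \<times> real. snd z = 0} \<in> null_sets lebesgue"
    by (simp add: negligible_iff_null_sets inner_prod_def)
  then have "AE z in lebesgue. z \<notin> {z :: (real ^ 'd) \<times> real. snd z = 0}" by (rule AE_not_in)
  then have "AE z in lebesgue. (z :: (real ^ 'd) \<times> real) \<in> spacetime \<longrightarrow> snd z > 0"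
    by eventually_elim (auto simp: spacetime_def)
  then show ?thesis by (simp add: AE_restrict_space_iff)
qed

context common_datum
begin

definition "mean1 w = (\<integral>k. stereo1 k \<partial>\<sigma> w)"
definition "mean2 w = (\<integral>k. stereo2 k \<partial>\<sigma> w)"
text \<open>
  The integral of \<open>chord l\<close> against \<open>\<sigma> w\<close>, written out so that its dependence on \<open>w\<close> is through two bounded measurable functions.
\<close>

definition "mean_chord l w = stereo1 l + mean1 w - 2 * stereo1 l * mean1 w - 2 * stereo2 l * mean2 w"

lemma mean_measurable [measurable]: "mean1 \<in> borel_measurable S1.\<Lambda>" "mean2 \<in> borel_measurable S1.\<Lambda>"
  using S2.young stereo_C0 unfolding young_measure_def mean1_def[abs_def] mean2_def[abs_def] by auto

lemma mean_properties:
  assumes w: "w \<in> spacetime"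
  shows "ennreal (mean_chord l w) = (\<integral>\<^sup>+k. ennreal (chord l k) \<partial>\<sigma> w)" "0 \<le> mean_chord l w"
    and "\<bar>mean1 w\<bar> \<le> 1" "\<bar>mean2 w\<bar> \<le> 1"
proof -
  interpret prob_space "\<sigma> w" using S2.kernel_prob w by simp
  have s: "sets (\<sigma> w) = sets borel" using S2.kernel_sets w by simp
  have [measurable]: "stereo1 \<in> borel_measurable (\<sigma> w)" "stereo2 \<in> borel_measurable (\<sigma> w)"
    by (simp_all cong: measurable_cong_sets[OF s refl])
  have i1: "integrable (\<sigma> w) stereo1"
    by (rule integrable_const_bound[where B=1]) (use stereo_bounds(1,2) in \<open>auto simp: less_imp_le\<close>)
  have i2: "integrable (\<sigma> w) stereo2"
    by (rule integrable_const_bound[where B=1]) (use order_trans[OF stereo_bounds(3), of 1] in auto)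
  have e: "(\<integral>k. chord l k \<partial>\<sigma> w) = mean_chord l w"
    unfolding chord_def mean_chord_def mean1_def mean2_def using i1 i2 prob_space by simp
  have ic: "integrable (\<sigma> w) (chord l)" unfolding chord_def[abs_def] using i1 i2 by auto
  show "ennreal (mean_chord l w) = (\<integral>\<^sup>+k. ennreal (chord l k) \<partial>\<sigma> w)"
    unfolding e[symmetric] using ic chord_nonneg by (intro nn_integral_eq_integral[symmetric]) auto
  show "0 \<le> mean_chord l w" unfolding e[symmetric] by (rule Bochner_Integration.integral_nonneg) (rule chord_nonneg)
  have "\<bar>\<integral>k. stereo1 k \<partial>\<sigma> w\<bar> \<le> (\<integral>k. \<bar>stereo1 k\<bar> \<partial>\<sigma> w)" by (rule integral_abs_bound)
  also have "\<dots> \<le> (\<integral>k. 1 \<partial>\<sigma> w)" using i1 stereo_bounds(1,2) by (intro integral_mono) (auto simp: less_imp_le abs_of_pos)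
  finally show "\<bar>mean1 w\<bar> \<le> 1" by (simp add: mean1_def prob_space)
  have "\<bar>\<integral>k. stereo2 k \<partial>\<sigma> w\<bar> \<le> (\<integral>k. \<bar>stereo2 k\<bar> \<partial>\<sigma> w)" by (rule integral_abs_bound)
  also have "\<dots> \<le> (\<integral>k. 1 \<partial>\<sigma> w)" using i2 by (intro integral_mono) (use order_trans[OF stereo_bounds(3), of 1] in auto)
  finally show "\<bar>mean2 w\<bar> \<le> 1" by (simp add: mean2_def prob_space)
qed

lemma mean_chord_continuity:
  "mean_chord l z \<le> mean_chord l w + (\<bar>mean1 z - mean1 w\<bar> + \<bar>mean2 z - mean2 w\<bar>)"
proof -
  have "mean_chord l z - mean_chord l w = (1 - 2 * stereo1 l) * (mean1 z - mean1 w) - (2 * stereo2 l) * (mean2 z - mean2 w)"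
    by (simp add: mean_chord_def algebra_simps)
  also have "\<dots> \<le> \<bar>1 - 2 * stereo1 l\<bar> * \<bar>mean1 z - mean1 w\<bar> + \<bar>2 * stereo2 l\<bar> * \<bar>mean2 z - mean2 w\<bar>"
    unfolding abs_mult[symmetric] by linarith
  also have "\<dots> \<le> 1 * \<bar>mean1 z - mean1 w\<bar> + 1 * \<bar>mean2 z - mean2 w\<bar>"
    using stereo_bounds[of l] by (intro add_mono mult_right_mono) (auto simp: abs_le_iff)
  finally show ?thesis by simp
qed

lemma spacetime_approximate_identity:
  assumes \<tau>: "\<tau> > 0" and T: "\<And>n. T n > 0" "\<And>n. T n \<le> 1 / real (Suc n)"
    and b: "b \<in> borel_measurable S1.\<Lambda>" "\<And>z. z \<in> spacetime \<Longrightarrow> \<bar>b z\<bar> \<le> 1"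
  defines "X \<equiv> (torus :: (real ^ 'd) set) \<times> {0..\<tau> + 2}"
  shows "(\<lambda>n. \<integral>\<^sup>+z. \<integral>\<^sup>+w. ennreal (time_kernel (T n) (snd w - snd z) * mollifier (1 / real (Suc n)) (fst z - fst w))
      * ennreal \<bar>b z - b w\<bar> \<partial>lebesgue_on X \<partial>lebesgue_on X) \<longlonglongrightarrow> 0"
proof (rule approximate_identity_L1)
  have XS: "X \<subseteq> spacetime" by (auto simp: X_def spacetime_def)
  show Xl: "X \<in> sets lebesgue" unfolding X_def using slab_borel by simp
  have "emeasure lborel X < \<infinity>"
    unfolding X_def by (intro emeasure_bounded_finite bounded_Times torus_bounded(1) bounded_closed_interval)
  then show Xf: "emeasure lebesgue X < \<infinity>" unfolding X_def by simp
  have loc: "two_solutions f \<nu> m1 m2 \<sigma> m1' m2' (1 / real (Suc n)) (T n) \<tau>" for n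
    using T \<tau> by unfold_locales auto
  have sub: "(\<integral>\<^sup>+z. g z \<partial>lebesgue_on X) \<le> (\<integral>\<^sup>+z. g z \<partial>lebesgue_on spacetime)" for g
    using Xl XS by (simp add: nn_integral_restrict_space) (intro nn_integral_mono, auto split: split_indicator)
  show "(\<lambda>(z, w). ennreal (time_kernel (T n) (snd w - snd z) * mollifier (1 / real (Suc n)) (fst z - fst w)))
      \<in> borel_measurable (lebesgue_on X \<Otimes>\<^sub>M lebesgue_on X)" for n
    by measurable
  show "(\<integral>\<^sup>+w. ennreal (time_kernel (T n) (snd w - snd z) * mollifier (1 / real (Suc n)) (fst z - fst w)) \<partial>lebesgue_on X) \<le> 1"
    if "z \<in> X" for n z
    using order_trans[OF sub eq_refl[OF two_solutions.kernel_mass(1)[OF loc]], of z n] that XS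
    unfolding two_solutions.moll_kernel_def[OF loc] by blast
  show "(\<integral>\<^sup>+z. ennreal (time_kernel (T n) (snd w - snd z) * mollifier (1 / real (Suc n)) (fst z - fst w)) \<partial>lebesgue_on X) \<le> 1"
    if "w \<in> X" for n w
    using order_trans[OF sub two_solutions.kernel_mass(2)[OF loc], of w n] that XS
    unfolding two_solutions.moll_kernel_def[OF loc] by blast
  have bm: "b \<in> borel_measurable (lebesgue_on X)" by (rule measurable_restrict_mono[OF b(1) XS])
  show "integrable (lebesgue_on X) b"
  proof (rule finite_measure.integrable_const_bound[where B=1])
    show "finite_measure (lebesgue_on X)" using Xl Xf by (intro finite_measureI) (simp add: emeasure_restrict_space)
    show "AE x in lebesgue_on X. norm (b x) \<le> 1" using XS b(2) by (intro AE_I2) auto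
  qed (rule bm)
  have "AE z in lebesgue_on spacetime. \<forall>i. 0 < fst (z :: (real ^ 'd) \<times> real) $ i \<and> fst z $ i < 2 * pi"
    by (rule AE_spacetime_fst[OF AE_torus_interior])
  then have "AE z in lebesgue. z \<in> spacetime \<longrightarrow> (\<forall>i. 0 < fst (z :: (real ^ 'd) \<times> real) $ i \<and> fst z $ i < 2 * pi)"
    by (simp add: AE_restrict_space_iff)
  then have "AE z in lebesgue. z \<in> X \<longrightarrow> (\<forall>i. 0 < fst z $ i \<and> fst z $ i < 2 * pi)"
    by eventually_elim (use XS in blast)
  then have "AE z in lebesgue_on X. \<forall>i. 0 < fst z $ i \<and> fst z $ i < 2 * pi"
    using Xl by (simp add: AE_restrict_space_iff)
  then show "AE z in lebesgue_on X. \<forall>r>0. \<forall>\<^sub>F n in sequentially. \<forall>w\<in>X.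
      ennreal (time_kernel (T n) (snd w - snd z) * mollifier (1 / real (Suc n)) (fst z - fst w)) \<noteq> 0 \<longrightarrow> dist z w < r"
  proof eventually_elim
    case (elim z)
    show ?case
    proof (intro allI impI)
      fix r :: real assume r: "r > 0"
      with mollifier_concentration[of "fst z" "r / 2"] elim obtain \<eta>
        where \<eta>: "\<eta> > 0" "\<And>\<delta> y. \<delta> \<le> \<eta> \<Longrightarrow> y \<in> torus \<Longrightarrow> mollifier \<delta> (fst z - y) \<noteq> 0 \<Longrightarrow> dist (fst z) y < r / 2"
        by (metis half_gt_zero)
      have "\<forall>\<^sub>F n in sequentially. 1 / real (Suc n) < min \<eta> (r / 2)"
        using order_tendstoD(2)[OF lim_1_over_n[THEN LIMSEQ_Suc], of "min \<eta> (r / 2)"] \<eta>(1) r by simp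
      then show "\<forall>\<^sub>F n in sequentially. \<forall>w\<in>X.
        ennreal (time_kernel (T n) (snd w - snd z) * mollifier (1 / real (Suc n)) (fst z - fst w)) \<noteq> 0 \<longrightarrow> dist z w < r"
      proof (eventually_elim, intro ballI impI)
        fix n w assume n: "1 / real (Suc n) < min \<eta> (r / 2)" and w: "w \<in> X"
          and nz: "ennreal (time_kernel (T n) (snd w - snd z) * mollifier (1 / real (Suc n)) (fst z - fst w)) \<noteq> 0"
        have 1: "mollifier (1 / real (Suc n)) (fst z - fst w) \<noteq> 0" "time_kernel (T n) (snd w - snd z) \<noteq> 0"
          using nz by auto
        have "dist (fst z) (fst w) < r / 2"
          by (rule \<eta>(2)[OF _ _ 1(1)]) (use n w in \<open>auto simp: X_def\<close>)
        moreover have "0 < snd w - snd z" "snd w - snd z < T n"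
          using time_kernel_zero[OF T(1)[of n], of "snd w - snd z"] 1(2) by force+
        then have "dist (snd z) (snd w) < r / 2" using T(2)[of n] n by (simp add: dist_real_def)
        moreover have "dist z w \<le> dist (fst z) (fst w) + dist (snd z) (snd w)"
          unfolding dist_prod_def by (rule sqrt_sum_squares_le_sum) auto
        ultimately show "dist z w < r" by linarith
      qed
    qed
  qed
qed

end

context common_datum
begin

text \<open>
  The value at \<open>z\<close> is the average over \<open>w\<close> against the kernel. Replacing \<open>mean_chord l z\<close> by \<open>mean_chord l w\<close> there costs
  the mollification errors of two bounded functions, and what remains is dominated by the smoothed distance of the two solutions.
\<close>

lemma diagonal_limit:
  assumes \<tau>: "\<tau> > 0"
  shows "(\<integral>\<^sup>+p. ennreal (bump (snd (fst p) - \<tau>)) * ennreal (mean_chord (snd p) (fst p)) \<partial>S1.joint) = 0"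
proof -
  obtain B where B: "B > 0" "\<And>x. bump x \<le> B" using bump_bounded by metis
  obtain T where T: "\<And>n. T n > 0" "\<And>n. T n \<le> 1 / real (Suc n)"
    and lim: "(\<lambda>n. \<integral>\<^sup>+pq. (case pq of (p, q) \<Rightarrow> ennreal \<bar>snd p - snd q\<bar> * ennreal (bump (snd (fst p) - \<tau>))
        * ennreal (time_kernel (T n) (snd (fst q) - snd (fst p)) * mollifier (1 / real (Suc n)) (fst (fst p) - fst (fst q))))
        \<partial>(S1.joint \<Otimes>\<^sub>M S2.joint)) \<longlonglongrightarrow> 0"
    by (rule contraction_limit[OF \<tau>]) (rule that)
  define k where "k n z w = ennreal (time_kernel (T n) (snd w - snd z) * mollifier (1 / real (Suc n)) (fst z - fst w))" for n z and w :: "(real ^ 'd) \<times> real"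
  define X where "X = (torus :: (real ^ 'd) set) \<times> {0..\<tau> + 2}"
  have XS: "X \<subseteq> spacetime" by (auto simp: X_def spacetime_def)
  have Xl: "X \<in> sets lebesgue" unfolding X_def using slab_borel by simp
  define L where "L n = (\<integral>\<^sup>+pq. (case pq of (p, q) \<Rightarrow> ennreal \<bar>snd p - snd q\<bar> * ennreal (bump (snd (fst p) - \<tau>)) * k n (fst p) (fst q)) \<partial>(S1.joint \<Otimes>\<^sub>M S2.joint))" for n
  define E where "E b n = (\<integral>\<^sup>+z. \<integral>\<^sup>+w. k n z w * ennreal \<bar>b z - b w\<bar> \<partial>lebesgue_on X \<partial>lebesgue_on X)" for b :: "_ \<Rightarrow> real" and n
  define A where "A = (\<integral>\<^sup>+p. ennreal (bump (snd (fst p) - \<tau>)) * ennreal (mean_chord (snd p) (fst p)) \<partial>S1.joint)"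
  have L0: "L \<longlonglongrightarrow> 0" using lim unfolding L_def[abs_def] k_def .
  have E1: "E mean1 \<longlonglongrightarrow> 0" "E mean2 \<longlonglongrightarrow> 0"
    unfolding E_def[abs_def] k_def X_def using mean_properties(3,4)
    by (intro spacetime_approximate_identity \<tau> T mean_measurable; simp)+
  note [measurable] = S1.coordinates_measurable S2.coordinates_measurable
  have km: "(\<lambda>x. k n (g x) (h x)) \<in> borel_measurable N"
    if [measurable]: "(\<lambda>x. fst (g x)) \<in> borel_measurable N" "(\<lambda>x. snd (g x)) \<in> borel_measurable N"
    "(\<lambda>x. fst (h x)) \<in> borel_measurable N" "(\<lambda>x. snd (h x)) \<in> borel_measurable N" for n g h and N :: "'z measure"
    unfolding k_def by measurable
  have km1 [measurable]: "(\<lambda>w. k n z w) \<in> borel_measurable S1.\<Lambda>" for n z by (rule km) measurable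
  have km2 [measurable]: "(\<lambda>p. k n (fst (fst p)) (snd p)) \<in> borel_measurable (S1.joint \<Otimes>\<^sub>M S1.\<Lambda>)" for n by (rule km) measurable
  have km3 [measurable]: "(\<lambda>p. k n (fst p) (snd p)) \<in> borel_measurable (S1.\<Lambda> \<Otimes>\<^sub>M S1.\<Lambda>)" for n by (rule km) measurable
  have bound: "A \<le> L n + ennreal B * (E mean1 n + E mean2 n)" for n
  proof -
    have loc: "two_solutions f \<nu> m1 m2 \<sigma> m1' m2' (1 / real (Suc n)) (T n) \<tau>"
      using T \<tau> by unfold_locales auto
    have mass: "(\<integral>\<^sup>+w. k n z w \<partial>S1.\<Lambda>) = 1" if "z \<in> spacetime" for z
      using two_solutions.kernel_mass(1)[OF loc that] unfolding two_solutions.moll_kernel_def[OF loc] k_def .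
    have kz: "k n z w = 0" if "snd w \<le> snd z \<or> snd w \<ge> snd z + T n" for z w
      using two_solutions.kernel_zero[OF loc that] unfolding two_solutions.moll_kernel_def[OF loc] k_def .
    let ?\<beta> = "\<lambda>z. ennreal (bump (snd z - \<tau>))"
    define D where "D z w = ennreal \<bar>mean1 z - mean1 w\<bar> + ennreal \<bar>mean2 z - mean2 w\<bar>" for z w
    have Dm [measurable]: "(\<lambda>w. D z w) \<in> borel_measurable S1.\<Lambda>" for z unfolding D_def by measurable
    have cm [measurable]: "(\<lambda>w. mean_chord l w) \<in> borel_measurable S1.\<Lambda>" for l unfolding mean_chord_def by measurable
    have step: "?\<beta> (fst p) * ennreal (mean_chord (snd p) (fst p))
        \<le> (\<integral>\<^sup>+w. ?\<beta> (fst p) * k n (fst p) w * ennreal (mean_chord (snd p) w) \<partial>S1.\<Lambda>)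
          + (\<integral>\<^sup>+w. ?\<beta> (fst p) * (k n (fst p) w * D (fst p) w) \<partial>S1.\<Lambda>)" if p: "p \<in> space S1.joint" for p
    proof -
      have z: "fst p \<in> spacetime" using p by (auto simp: S1.space_joint)
      have "?\<beta> (fst p) * ennreal (mean_chord (snd p) (fst p))
         = (\<integral>\<^sup>+w. ?\<beta> (fst p) * ennreal (mean_chord (snd p) (fst p)) * k n (fst p) w \<partial>S1.\<Lambda>)"
        by (subst nn_integral_cmult) (simp_all add: mass[OF z])
      also have "\<dots> \<le> (\<integral>\<^sup>+w. ?\<beta> (fst p) * k n (fst p) w * ennreal (mean_chord (snd p) w) + ?\<beta> (fst p) * (k n (fst p) w * D (fst p) w) \<partial>S1.\<Lambda>)"
      proof (rule nn_integral_mono)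
        fix w assume "w \<in> space S1.\<Lambda>"
        then have w: "w \<in> spacetime" by simp
        have "ennreal (mean_chord (snd p) (fst p)) \<le> ennreal (mean_chord (snd p) w) + D (fst p) w"
          unfolding D_def using mean_properties(2)[OF w, of "snd p"] mean_chord_continuity[of "snd p" "fst p" w]
          by (simp add: ennreal_plus[symmetric] ennreal_leI del: ennreal_plus)
        then have "?\<beta> (fst p) * k n (fst p) w * ennreal (mean_chord (snd p) (fst p))
          \<le> ?\<beta> (fst p) * k n (fst p) w * (ennreal (mean_chord (snd p) w) + D (fst p) w)"
          by (rule mult_left_mono) simp
        then show "?\<beta> (fst p) * ennreal (mean_chord (snd p) (fst p)) * k n (fst p) w
          \<le> ?\<beta> (fst p) * k n (fst p) w * ennreal (mean_chord (snd p) w) + ?\<beta> (fst p) * (k n (fst p) w * D (fst p) w)"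
          by (simp add: distrib_left mult_ac)
      qed
      also have "\<dots> = (\<integral>\<^sup>+w. ?\<beta> (fst p) * k n (fst p) w * ennreal (mean_chord (snd p) w) \<partial>S1.\<Lambda>)
          + (\<integral>\<^sup>+w. ?\<beta> (fst p) * (k n (fst p) w * D (fst p) w) \<partial>S1.\<Lambda>)"
        by (rule nn_integral_add) measurable
      finally show ?thesis .
    qed
    have "A \<le> (\<integral>\<^sup>+p. (\<integral>\<^sup>+w. ?\<beta> (fst p) * k n (fst p) w * ennreal (mean_chord (snd p) w) \<partial>S1.\<Lambda>)
          + (\<integral>\<^sup>+w. ?\<beta> (fst p) * (k n (fst p) w * D (fst p) w) \<partial>S1.\<Lambda>) \<partial>S1.joint)"
      unfolding A_def by (rule nn_integral_mono) (rule step)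
    also have "\<dots> = (\<integral>\<^sup>+p. \<integral>\<^sup>+w. ?\<beta> (fst p) * k n (fst p) w * ennreal (mean_chord (snd p) w) \<partial>S1.\<Lambda> \<partial>S1.joint)
        + (\<integral>\<^sup>+p. \<integral>\<^sup>+w. ?\<beta> (fst p) * (k n (fst p) w * D (fst p) w) \<partial>S1.\<Lambda> \<partial>S1.joint)"
    proof (rule nn_integral_add)
      show "(\<lambda>p. \<integral>\<^sup>+w. ?\<beta> (fst p) * k n (fst p) w * ennreal (mean_chord (snd p) w) \<partial>S1.\<Lambda>) \<in> borel_measurable S1.joint"
        unfolding mean_chord_def by measurable
      show "(\<lambda>p. \<integral>\<^sup>+w. ?\<beta> (fst p) * (k n (fst p) w * D (fst p) w) \<partial>S1.\<Lambda>) \<in> borel_measurable S1.joint"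
        unfolding D_def by measurable
    qed
    also have "(\<integral>\<^sup>+p. \<integral>\<^sup>+w. ?\<beta> (fst p) * k n (fst p) w * ennreal (mean_chord (snd p) w) \<partial>S1.\<Lambda> \<partial>S1.joint) \<le> L n"
    proof -
      interpret P: pair_sigma_finite S1.joint S2.joint by (rule two_solutions.pair_J[OF loc])
      have chm [measurable]: "(\<lambda>p. chord l (snd p)) \<in> borel_measurable S2.joint" for l unfolding chord_def by measurable
      have kj [measurable]: "(\<lambda>q. k n z (fst q)) \<in> borel_measurable S2.joint" for z by (rule km) measurable
      have kp [measurable]: "(\<lambda>pq. k n (fst (fst pq)) (fst (snd pq))) \<in> borel_measurable (S1.joint \<Otimes>\<^sub>M S2.joint)" by (rule km) measurable
      have "(\<integral>\<^sup>+w. ?\<beta> (fst p) * k n (fst p) w * ennreal (mean_chord (snd p) w) \<partial>S1.\<Lambda>)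
          \<le> (\<integral>\<^sup>+q. ennreal \<bar>snd p - snd q\<bar> * ?\<beta> (fst p) * k n (fst p) (fst q) \<partial>S2.joint)" for p
      proof -
        have "(\<integral>\<^sup>+w. ?\<beta> (fst p) * k n (fst p) w * ennreal (mean_chord (snd p) w) \<partial>S1.\<Lambda>)
          = (\<integral>\<^sup>+w. \<integral>\<^sup>+l. ?\<beta> (fst p) * k n (fst p) w * ennreal (chord (snd p) l) \<partial>\<sigma> w \<partial>S1.\<Lambda>)"
        proof (rule nn_integral_cong)
          fix w assume "w \<in> space S1.\<Lambda>"
          then have w: "w \<in> spacetime" by simp
          have "(\<lambda>l. ennreal (chord (snd p) l)) \<in> borel_measurable borel" unfolding chord_def by measurable
          then have "(\<lambda>l. ennreal (chord (snd p) l)) \<in> borel_measurable (\<sigma> w)"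
            using S2.kernel_sets w by (simp cong: measurable_cong_sets)
          then show "?\<beta> (fst p) * k n (fst p) w * ennreal (mean_chord (snd p) w)
            = (\<integral>\<^sup>+l. ?\<beta> (fst p) * k n (fst p) w * ennreal (chord (snd p) l) \<partial>\<sigma> w)"
            by (subst nn_integral_cmult) (simp_all add: mean_properties(1)[OF w])
        qed
        also have "\<dots> = (\<integral>\<^sup>+q. ?\<beta> (fst p) * k n (fst p) (fst q) * ennreal (chord (snd p) (snd q)) \<partial>S2.joint)"
        proof -
          have "(\<lambda>q. ?\<beta> (fst p) * k n (fst p) (fst q) * ennreal (chord (snd p) (snd q))) \<in> borel_measurable (S2.\<Lambda> \<Otimes>\<^sub>M borel)"
            using kj chm by (simp cong: measurable_cong_sets[OF S2.sets_joint refl])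
          from S2.nn_integral_joint[OF this] show ?thesis by simp
        qed
        also have "\<dots> \<le> (\<integral>\<^sup>+q. ennreal \<bar>snd p - snd q\<bar> * ?\<beta> (fst p) * k n (fst p) (fst q) \<partial>S2.joint)"
        proof (rule nn_integral_mono)
          fix q
          have "?\<beta> (fst p) * k n (fst p) (fst q) * ennreal (chord (snd p) (snd q)) \<le> ?\<beta> (fst p) * k n (fst p) (fst q) * ennreal \<bar>snd p - snd q\<bar>"
            by (intro mult_left_mono ennreal_leI chord_le) simp
          then show "?\<beta> (fst p) * k n (fst p) (fst q) * ennreal (chord (snd p) (snd q)) \<le> ennreal \<bar>snd p - snd q\<bar> * ?\<beta> (fst p) * k n (fst p) (fst q)"
            by (simp add: mult_ac)
        qed
        finally show ?thesis .
      qed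
      then have "(\<integral>\<^sup>+p. \<integral>\<^sup>+w. ?\<beta> (fst p) * k n (fst p) w * ennreal (mean_chord (snd p) w) \<partial>S1.\<Lambda> \<partial>S1.joint)
         \<le> (\<integral>\<^sup>+p. \<integral>\<^sup>+q. ennreal \<bar>snd p - snd q\<bar> * ?\<beta> (fst p) * k n (fst p) (fst q) \<partial>S2.joint \<partial>S1.joint)"
        by (rule nn_integral_mono)
      also have "\<dots> = L n"
        unfolding L_def by (subst P.M2.nn_integral_fst[symmetric]) (simp_all add: case_prod_beta')
      finally show ?thesis .
    qed
    also have "(\<integral>\<^sup>+p. \<integral>\<^sup>+w. ?\<beta> (fst p) * (k n (fst p) w * D (fst p) w) \<partial>S1.\<Lambda> \<partial>S1.joint)
        = (\<integral>\<^sup>+z. \<integral>\<^sup>+w. ?\<beta> z * (k n z w * D z w) \<partial>S1.\<Lambda> \<partial>S1.\<Lambda>)"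
    proof (rule S1.nn_integral_joint_fst)
      show "(\<lambda>z. \<integral>\<^sup>+w. ?\<beta> z * (k n z w * D z w) \<partial>S1.\<Lambda>) \<in> borel_measurable S1.\<Lambda>"
        unfolding D_def by measurable
    qed
    also have "\<dots> \<le> (\<integral>\<^sup>+z. \<integral>\<^sup>+w. (ennreal B * (k n z w * D z w) * indicator X w) * indicator X z \<partial>S1.\<Lambda> \<partial>S1.\<Lambda>)"
    proof (intro nn_integral_mono)
      fix z w assume z: "z \<in> space S1.\<Lambda>" and w: "w \<in> space S1.\<Lambda>"
      show "?\<beta> z * (k n z w * D z w) \<le> (ennreal B * (k n z w * D z w) * indicator X w) * indicator X z"
      proof (cases "bump (snd z - \<tau>) = 0 \<or> k n z w = 0")
        case False
        then have "0 < snd z - \<tau>" "snd z - \<tau> < 1" using bump_eq_0[of "snd z - \<tau>"] by linarith+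
        moreover have "snd w > snd z" "snd w < snd z + T n" using kz[of w z] False by force+
        moreover have "T n \<le> 1" using T(2)[of n] by (rule order_trans) simp
        ultimately have "z \<in> X" "w \<in> X" using z w \<tau> by (auto simp: X_def spacetime_def)
        then show ?thesis using B(2) by (simp add: mult_right_mono ennreal_leI)
      qed auto
    qed
    also have "\<dots> = (\<integral>\<^sup>+z. (\<integral>\<^sup>+w. ennreal B * (k n z w * D z w) * indicator X w \<partial>S1.\<Lambda>) * indicator X z \<partial>S1.\<Lambda>)"
    proof (rule nn_integral_cong)
      have [measurable]: "X \<in> sets S1.\<Lambda>" using Xl XS by (simp add: sets_restrict_space_iff)
      fix z
      show "(\<integral>\<^sup>+w. ennreal B * (k n z w * D z w) * indicator X w * indicator X z \<partial>S1.\<Lambda>) = (\<integral>\<^sup>+w. ennreal B * (k n z w * D z w) * indicator X w \<partial>S1.\<Lambda>) * indicator X z"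
        by (rule nn_integral_multc) measurable
    qed
    also have "\<dots> = (\<integral>\<^sup>+z. \<integral>\<^sup>+w. ennreal B * (k n z w * D z w) \<partial>lebesgue_on X \<partial>lebesgue_on X)"
    proof -
      have sub: "(\<integral>\<^sup>+z. g z * indicator X z \<partial>S1.\<Lambda>) = (\<integral>\<^sup>+z. g z \<partial>lebesgue_on X)" for g
      proof -
        have "(\<integral>\<^sup>+z. g z * indicator X z \<partial>S1.\<Lambda>) = (\<integral>\<^sup>+z. g z * indicator X z * indicator spacetime z \<partial>lebesgue)"
          by (rule nn_integral_restrict_space) simp
        also have "\<dots> = (\<integral>\<^sup>+z. g z * indicator X z \<partial>lebesgue)"
          using XS by (intro nn_integral_cong) (auto split: split_indicator)
        also have "\<dots> = (\<integral>\<^sup>+z. g z \<partial>lebesgue_on X)"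
          by (rule nn_integral_restrict_space[symmetric]) (use Xl in simp)
        finally show ?thesis .
      qed
      show ?thesis unfolding sub ..
    qed
    also have "\<dots> = ennreal B * (E mean1 n + E mean2 n)"
    proof -
      have mX [measurable]: "mean1 \<in> borel_measurable (lebesgue_on X)" "mean2 \<in> borel_measurable (lebesgue_on X)"
        by (rule measurable_restrict_mono[OF mean_measurable(1) XS] measurable_restrict_mono[OF mean_measurable(2) XS])+
      have kX [measurable]: "(\<lambda>w. k n z w) \<in> borel_measurable (lebesgue_on X)" for z by (rule km) measurable
      have kX2 [measurable]: "(\<lambda>p. k n (fst p) (snd p)) \<in> borel_measurable (lebesgue_on X \<Otimes>\<^sub>M lebesgue_on X)" by (rule km) measurable
      have sfX: "sigma_finite_measure (lebesgue_on X)" by (rule sigma_finite_lebesgue_on[OF Xl])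
      interpret X: sigma_finite_measure "lebesgue_on X" by (rule sfX)
      have "(\<integral>\<^sup>+z. \<integral>\<^sup>+w. ennreal B * (k n z w * D z w) \<partial>lebesgue_on X \<partial>lebesgue_on X)
         = (\<integral>\<^sup>+z. ennreal B * ((\<integral>\<^sup>+w. k n z w * ennreal \<bar>mean1 z - mean1 w\<bar> \<partial>lebesgue_on X) + (\<integral>\<^sup>+w. k n z w * ennreal \<bar>mean2 z - mean2 w\<bar> \<partial>lebesgue_on X)) \<partial>lebesgue_on X)"
        unfolding D_def by (simp add: nn_integral_cmult distrib_left nn_integral_add)
      also have "\<dots> = ennreal B * ((\<integral>\<^sup>+z. \<integral>\<^sup>+w. k n z w * ennreal \<bar>mean1 z - mean1 w\<bar> \<partial>lebesgue_on X \<partial>lebesgue_on X)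
          + (\<integral>\<^sup>+z. \<integral>\<^sup>+w. k n z w * ennreal \<bar>mean2 z - mean2 w\<bar> \<partial>lebesgue_on X \<partial>lebesgue_on X))"
        by (simp add: nn_integral_cmult nn_integral_add)
      finally show ?thesis by (simp add: E_def)
    qed
    finally show ?thesis by (simp add: add_left_mono add_right_mono)
  qed
  have "(\<lambda>n. L n + ennreal B * (E mean1 n + E mean2 n)) \<longlonglongrightarrow> 0 + ennreal B * (0 + 0)"
    by (intro tendsto_add ennreal_tendsto_cmult L0 E1) simp
  then have r: "(\<lambda>n. L n + ennreal B * (E mean1 n + E mean2 n)) \<longlonglongrightarrow> 0" by simp
  have "(\<lambda>n. A) \<longlonglongrightarrow> 0"
    by (rule tendsto_sandwich[OF _ _ tendsto_const r]) (simp_all add: bound)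
  then show ?thesis unfolding A_def[symmetric] by (simp add: LIMSEQ_const_iff)
qed

text \<open>
  At almost every \<open>z\<close>, the integral of \<open>chord\<close> against the product of \<open>\<nu> z\<close> and \<open>\<sigma> z\<close> is zero. Some \<open>a\<close> then
  satisfies \<open>chord a k = 0\<close> for almost all \<open>k\<close>, so \<open>\<sigma> z\<close> is concentrated at \<open>a\<close>, and consequently so is \<open>\<nu> z\<close>. The quotient of
  the two coordinates recovers \<open>a\<close> and is a measurable function of \<open>z\<close>.
\<close>

lemma dirac:
  "AE z in S1.\<Lambda>. \<nu> z = return borel (mean2 z / mean1 z) \<and> \<sigma> z = return borel (mean2 z / mean1 z)"
proof -
  note [measurable] = S1.coordinates_measurable
  have mcm [measurable]: "(\<lambda>p. mean_chord (snd p) (fst p)) \<in> borel_measurable S1.joint"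
    unfolding mean_chord_def by measurable
  have "AE p in S1.joint. real_of_rat q > 0 \<longrightarrow> ennreal (bump (snd (fst p) - real_of_rat q)) * ennreal (mean_chord (snd p) (fst p)) = 0" for q
  proof (cases "real_of_rat q > 0")
    case True
    show ?thesis using diagonal_limit[OF True] by (subst (asm) nn_integral_0_iff_AE) auto
  qed simp
  then have "AE p in S1.joint. \<forall>q. real_of_rat q > 0 \<longrightarrow> ennreal (bump (snd (fst p) - real_of_rat q)) * ennreal (mean_chord (snd p) (fst p)) = 0"
    by (subst AE_all_countable) auto
  then have "AE p in S1.joint. ennreal (mean_chord (snd p) (fst p)) * indicator {0<..} (snd (fst p)) = 0"
  proof eventually_elim
    case (elim p)
    show ?case
    proof (cases "snd (fst p) > 0")
      case True
      then obtain q :: rat where q: "real_of_rat q > 0" "bump (snd (fst p) - real_of_rat q) > 0"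
        using positive_time_rational by blast
      with elim have "ennreal (mean_chord (snd p) (fst p)) = 0" by fastforce
      then show ?thesis by simp
    qed simp
  qed
  then have "(\<integral>\<^sup>+p. ennreal (mean_chord (snd p) (fst p)) * indicator {0<..} (snd (fst p)) \<partial>S1.joint) = 0"
    by (subst nn_integral_0_iff_AE) auto
  moreover have m: "(\<lambda>p. ennreal (mean_chord (snd p) (fst p)) * indicator {0<..} (snd (fst p))) \<in> borel_measurable (S1.\<Lambda> \<Otimes>\<^sub>M borel)"
    unfolding mean_chord_def by measurable
  ultimately have "(\<integral>\<^sup>+z. \<integral>\<^sup>+l. ennreal (mean_chord l z) * indicator {0<..} (snd z) \<partial>\<nu> z \<partial>S1.\<Lambda>) = 0"
    using S1.nn_integral_joint[OF m] by simp
  moreover have "(\<lambda>z. \<integral>\<^sup>+l. ennreal (mean_chord l z) * indicator {0<..} (snd z) \<partial>\<nu> z) \<in> borel_measurable S1.\<Lambda>"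
    using S1.nn_integral_kernel_measurable[OF m] by simp
  ultimately have "AE z in S1.\<Lambda>. (\<integral>\<^sup>+l. ennreal (mean_chord l z) * indicator {0<..} (snd z) \<partial>\<nu> z) = 0"
    by (subst (asm) nn_integral_0_iff_AE) auto
  then show ?thesis
    using AE_positive_time AE_space
  proof eventually_elim
    case (elim z)
    then have z: "z \<in> spacetime" by simp
    interpret N: prob_space "\<nu> z" using S1.kernel_prob elim(3) .
    interpret S: prob_space "\<sigma> z" using S2.kernel_prob elim(3) .
    have sN: "sets (\<nu> z) = sets borel" and sS: "sets (\<sigma> z) = sets borel" using S1.kernel_sets S2.kernel_sets elim(3) by auto
    have mN: "(\<lambda>l. ennreal (mean_chord l z)) \<in> borel_measurable (\<nu> z)"
      unfolding measurable_cong_sets[OF sN refl] mean_chord_def by measurable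
    have "(\<integral>\<^sup>+l. ennreal (mean_chord l z) \<partial>\<nu> z) = 0" using elim(1,2) by simp
    then have aeN: "AE l in \<nu> z. ennreal (mean_chord l z) = 0" using mN by (subst (asm) nn_integral_0_iff_AE) auto
    then obtain a where a: "ennreal (mean_chord a z) = 0"
      using eventually_happens'[OF N.ae_filter_bot aeN] by blast
    have mS: "(\<lambda>k. ennreal (chord a k)) \<in> borel_measurable (\<sigma> z)"
      unfolding measurable_cong_sets[OF sS refl] chord_def by measurable
    have "(\<integral>\<^sup>+k. ennreal (chord a k) \<partial>\<sigma> z) = 0" using a mean_properties(1)[OF z, of a] by simp
    then have "AE k in \<sigma> z. ennreal (chord a k) = 0" using mS by (subst (asm) nn_integral_0_iff_AE) auto
    then have "AE k in \<sigma> z. k = a"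
      by eventually_elim (use chord_nonneg chord_eq_0_iff in \<open>metis ennreal_eq_0_iff order_antisym\<close>)
    then have S: "\<sigma> z = return borel a" by (rule return_if_AE_eq[OF S.prob_space_axioms sS])
    have mean: "mean1 z = stereo1 a" "mean2 z = stereo2 a" by (simp_all add: mean1_def mean2_def S integral_return)
    then have "mean_chord l z = chord l a" for l by (simp add: mean_chord_def chord_def)
    with aeN have "AE l in \<nu> z. ennreal (chord l a) = 0" by simp
    then have "AE l in \<nu> z. l = a"
      by eventually_elim (use chord_nonneg chord_eq_0_iff in \<open>metis ennreal_eq_0_iff order_antisym\<close>)
    then have "\<nu> z = return borel a" by (rule return_if_AE_eq[OF N.prob_space_axioms sN])
    with S show ?case by (simp add: mean stereo_bounds(4))
  qed
qed

end

section \<open>The limit is bounded in time with values in the integrable functions\<close>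

lemma borel_representative:
  fixes u :: "'a::euclidean_space \<Rightarrow> real"
  assumes S: "S \<in> sets lebesgue" and u: "u \<in> borel_measurable (lebesgue_on S)"
  obtains v where "v \<in> borel_measurable borel" "AE x in lebesgue_on S. u x = v x"
proof -
  have "(\<lambda>x. indicator S x *\<^sub>R u x) \<in> borel_measurable lebesgue"
    using u S by (simp add: borel_measurable_restrict_space_iff)
  from completion_ex_borel_measurable_real[OF this] obtain v
    where v: "v \<in> borel_measurable lborel" "AE x in lborel. indicator S x *\<^sub>R u x = v x" by blast
  have "AE x in lebesgue. indicator S x *\<^sub>R u x = v x" using v(2) by (simp add: AE_completion_iff)
  then have "AE x in lebesgue. x \<in> S \<longrightarrow> u x = v x" by eventually_elim (auto split: split_indicator_asm)
  then have "AE x in lebesgue_on S. u x = v x" using S by (simp add: AE_restrict_space_iff)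
  then show ?thesis using v(1) by (intro that[of v]) simp_all
qed

lemma nn_integral_spacetime_slices:
  fixes g :: "(real ^ 'd) \<times> real \<Rightarrow> ennreal"
  assumes [measurable]: "g \<in> borel_measurable borel"
  shows "(\<integral>\<^sup>+z. g z \<partial>lebesgue_on spacetime)
    = (\<integral>\<^sup>+t. (\<integral>\<^sup>+x. g (x, t) * indicator torus x \<partial>lborel) * indicator {0..} t \<partial>lborel)"
    and "(\<lambda>t. \<integral>\<^sup>+x. g (x, t) * indicator torus x \<partial>lborel) \<in> borel_measurable borel"
proof -
  have gm [measurable]: "g \<in> borel_measurable (borel \<Otimes>\<^sub>M borel)" using assms by (simp add: borel_prod)
  have m: "(\<lambda>z. g z * indicator spacetime z) \<in> borel_measurable (lborel \<Otimes>\<^sub>M lborel)"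
    unfolding lborel_prod by simp
  have "(\<integral>\<^sup>+z. g z \<partial>lebesgue_on spacetime) = (\<integral>\<^sup>+z. g z * indicator spacetime z \<partial>(lborel \<Otimes>\<^sub>M lborel))"
    unfolding lborel_prod by (rule nn_integral_lebesgue_on) simp
  also have "\<dots> = (\<integral>\<^sup>+t. \<integral>\<^sup>+x. g (x, t) * indicator spacetime (x, t) \<partial>lborel \<partial>lborel)"
    by (rule lborel_pair.nn_integral_snd[OF m, symmetric])
  also have "\<dots> = (\<integral>\<^sup>+t. \<integral>\<^sup>+x. g (x, t) * indicator torus x * indicator {0..} t \<partial>lborel \<partial>lborel)"
    by (intro nn_integral_cong) (auto simp: spacetime_def split: split_indicator)
  also have "\<dots> = (\<integral>\<^sup>+t. (\<integral>\<^sup>+x. g (x, t) * indicator torus x \<partial>lborel) * indicator {0..} t \<partial>lborel)"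
    by (intro nn_integral_cong nn_integral_multc) measurable
  finally show "(\<integral>\<^sup>+z. g z \<partial>lebesgue_on spacetime)
    = (\<integral>\<^sup>+t. (\<integral>\<^sup>+x. g (x, t) * indicator torus x \<partial>lborel) * indicator {0..} t \<partial>lborel)" .
  show "(\<lambda>t. \<integral>\<^sup>+x. g (x, t) * indicator torus x \<partial>lborel) \<in> borel_measurable borel"
    by measurable
qed

lemma AE_spacetime_slices:
  fixes P :: "(real ^ 'd) \<times> real \<Rightarrow> bool"
  assumes "AE z in lebesgue_on spacetime. P z"
  shows "AE t in lebesgue_on {0..}. AE x in lebesgue_on torus. P (x, t)"
proof -
  have "AE z in lebesgue. z \<in> spacetime \<longrightarrow> P z" using assms by (simp add: AE_restrict_space_iff)
  then have "AE z in lborel. z \<in> spacetime \<longrightarrow> P z" by (simp add: AE_completion_iff)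
  then obtain N where N: "{z. \<not> (z \<in> spacetime \<longrightarrow> P z)} \<subseteq> N" "N \<in> sets borel" "emeasure lborel N = 0"
    by (elim AE_E) auto
  have "(\<integral>\<^sup>+z. indicator N z \<partial>lebesgue_on spacetime) \<le> (\<integral>\<^sup>+z. indicator N z \<partial>lborel)"
    by (subst nn_integral_lebesgue_on) (auto intro!: nn_integral_mono split: split_indicator)
  also have "\<dots> = 0" using N by simp
  finally have "(\<integral>\<^sup>+t. (\<integral>\<^sup>+x. indicator N (x, t) * indicator torus x \<partial>lborel) * indicator {0..} t \<partial>lborel) = 0"
    using N(2) by (subst (asm) nn_integral_spacetime_slices(1)) auto
  moreover have nm: "(\<lambda>t. \<integral>\<^sup>+x. indicator N (x, t) * indicator torus x \<partial>lborel) \<in> borel_measurable borel"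
    using N(2) by (intro nn_integral_spacetime_slices(2)) simp
  ultimately have "AE t in lborel. (\<integral>\<^sup>+x. indicator N (x, t) * indicator torus x \<partial>lborel) * indicator {0..} t = 0"
    by (subst (asm) nn_integral_0_iff_AE) auto
  then have "AE t in lborel. t \<in> {0..} \<longrightarrow> (AE x in lebesgue_on torus. P (x, t))"
  proof eventually_elim
    case (elim t)
    show ?case
    proof
      assume t: "t \<in> {0..}"
      with elim have z: "(\<integral>\<^sup>+x. indicator N (x, t) * indicator torus x \<partial>lborel) = 0" by simp
      have "(\<lambda>x. indicator N (x, t) * indicator torus x :: ennreal) \<in> borel_measurable lborel"
      proof -
        have "N \<in> sets (borel \<Otimes>\<^sub>M borel)" unfolding borel_prod by (rule N(2))
        then show ?thesis by measurable
      qed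
      with z have "AE x in lborel. indicator N (x, t) * indicator torus x = (0 :: ennreal)"
        by (subst (asm) nn_integral_0_iff_AE) auto
      then have "AE x in lborel. x \<in> torus \<longrightarrow> P (x, t)"
        by eventually_elim (use N(1) t in \<open>auto simp: spacetime_def split: split_indicator_asm\<close>)
      then show "AE x in lebesgue_on torus. P (x, t)"
        by (simp add: AE_restrict_space_iff AE_completion_iff)
    qed
  qed
  then show ?thesis by (simp add: AE_restrict_space_iff AE_completion_iff)
qed

text \<open>
  The indicator of a bounded Borel set is almost everywhere the limit of continuous functions with values between \<open>0\<close> and a fixed
  cutoff, so the inequality for continuous functions passes to it. For the set where \<open>V\<close> exceeds \<open>C\<close> it forces measure zero.
\<close>

lemma density_bound_from_tests:
  fixes V :: "real \<Rightarrow> ennreal"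
  assumes V [measurable]: "V \<in> borel_measurable borel" and C: "C \<ge> 0"
    and test: "\<And>\<psi> R. continuous_on UNIV \<psi> \<Longrightarrow> (\<And>t. 0 \<le> \<psi> t \<and> \<psi> t \<le> 1) \<Longrightarrow> (\<And>t. t > R \<Longrightarrow> \<psi> t = 0) \<Longrightarrow>
      (\<integral>\<^sup>+t. ennreal (\<psi> t) * V t * indicator {0..} t \<partial>lborel) \<le> ennreal C * (\<integral>\<^sup>+t. ennreal (\<psi> t) * indicator {0..} t \<partial>lborel)"
  shows "AE t in lborel. t \<ge> 0 \<longrightarrow> V t \<le> ennreal C"
proof -
  have "AE t in lborel. t \<in> {0..real n} \<longrightarrow> V t \<le> ennreal C" for n
  proof -
    define cut where "cut t = max 0 (min 1 (real n + 1 - t))" for t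
    define A where "A = {t. 0 \<le> t \<and> t \<le> real n \<and> V t > ennreal C}"
    have Am [measurable]: "A \<in> sets borel" unfolding A_def by measurable
    have cut: "continuous_on UNIV cut" "\<And>t. 0 \<le> cut t \<and> cut t \<le> 1" "\<And>t. t > real n + 1 \<Longrightarrow> cut t = 0"
      unfolding cut_def by (auto intro!: continuous_intros)
    have [measurable]: "cut \<in> borel_measurable borel" by (rule borel_measurable_continuous_onI[OF cut(1)])
    have cutfin: "(\<integral>\<^sup>+t. ennreal (cut t) * indicator {0..} t \<partial>lborel) < \<infinity>"
    proof -
      have "(\<integral>\<^sup>+t. ennreal (cut t) * indicator {0..} t \<partial>lborel) \<le> (\<integral>\<^sup>+t. indicator {0..real n + 1} t \<partial>lborel)"
      proof (rule nn_integral_mono)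
        fix t :: real
        show "ennreal (cut t) * indicator {0..} t \<le> indicator {0..real n + 1} t"
          using cut(2)[of t] cut(3)[of t] by (auto split: split_indicator simp: ennreal_le_1)
      qed
      also have "\<dots> < \<infinity>" by simp
      finally show ?thesis .
    qed
    have "(indicator A :: real \<Rightarrow> real) measurable_on UNIV"
      by (intro lebesgue_measurable_imp_measurable_on_real measurable_completion) simp_all
    then obtain N g where N: "negligible N" and g': "\<forall>k. continuous_on UNIV (g k)"
      "\<forall>t. t \<notin> N \<longrightarrow> (\<lambda>k. g k t) \<longlonglongrightarrow> (if t \<in> UNIV then indicator A t else 0 :: real)"
      unfolding measurable_on_def by blast
    then have g: "continuous_on UNIV (g k)" "t \<notin> N \<Longrightarrow> (\<lambda>k. g k t) \<longlonglongrightarrow> (indicator A t :: real)" for k t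
      by simp_all
    define \<psi> where "\<psi> k t = max 0 (min 1 (g k t)) * cut t" for k t
    have \<psi>: "continuous_on UNIV (\<psi> k)" "0 \<le> \<psi> k t \<and> \<psi> k t \<le> cut t" for k t
    proof -
      show "continuous_on UNIV (\<psi> k)" unfolding \<psi>_def
        by (intro continuous_on_mult continuous_on_max continuous_on_min continuous_on_const g cut)
      show "0 \<le> \<psi> k t \<and> \<psi> k t \<le> cut t" unfolding \<psi>_def using cut(2)[of t] by (auto intro: mult_left_le_one_le)
    qed
    have [measurable]: "\<psi> k \<in> borel_measurable borel" for k by (rule borel_measurable_continuous_onI[OF \<psi>(1)])
    have "N \<in> null_sets lebesgue" using N by (simp add: negligible_iff_null_sets)
    then have "AE t in lebesgue. t \<notin> N" by (rule AE_not_in)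
    then have aeN: "AE t in lborel. t \<notin> N" by (simp add: AE_completion_iff)
    have lim: "AE t in lborel. (\<lambda>k. ennreal (\<psi> k t)) \<longlonglongrightarrow> indicator A t"
      using aeN
    proof eventually_elim
      case (elim t)
      have "(\<lambda>k. \<psi> k t) \<longlonglongrightarrow> max 0 (min 1 (indicator A t)) * cut t"
        unfolding \<psi>_def by (intro tendsto_intros g(2) elim)
      also have "max 0 (min 1 (indicator A t)) * cut t = indicator A t"
        by (auto simp: A_def cut_def split: split_indicator)
      finally have "(\<lambda>k. ennreal (\<psi> k t)) \<longlonglongrightarrow> ennreal (indicator A t)" by (rule tendsto_ennrealI)
      then show ?case by (simp add: ennreal_indicator)
    qed
    have "(\<integral>\<^sup>+t. ennreal (cut t) * V t * indicator {0..} t \<partial>lborel) < \<infinity>"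
      using le_less_trans[OF test[OF cut(1,2,3)], of "real n + 1"] cutfin by (simp add: ennreal_mult_less_top)
    note Vfin = this
    have dV: "(\<lambda>k. \<integral>\<^sup>+t. ennreal (\<psi> k t) * V t * indicator {0..} t \<partial>lborel) \<longlonglongrightarrow> (\<integral>\<^sup>+t. indicator A t * V t * indicator {0..} t \<partial>lborel)"
    proof (rule nn_integral_dominated_convergence[where w="\<lambda>t. ennreal (cut t) * V t * indicator {0..} t"])
      show "AE t in lborel. ennreal (\<psi> k t) * V t * indicator {0..} t \<le> ennreal (cut t) * V t * indicator {0..} t" for k
        using \<psi>(2) by (intro AE_I2 mult_right_mono ennreal_leI) auto
      have "AE t in lborel. ennreal (cut t) * V t * indicator {0..} t \<noteq> \<infinity>"
        by (rule nn_integral_PInf_AE) (use Vfin in auto)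
      then show "AE t in lborel. (\<lambda>k. ennreal (\<psi> k t) * V t * indicator {0..} t) \<longlonglongrightarrow> indicator A t * V t * indicator {0..} t"
        using lim
      proof eventually_elim
        case (elim t)
        show ?case
        proof (cases "t \<ge> 0 \<and> cut t > 0")
          case True
          with elim(1) have "V t < top" by (cases "V t = top") (auto simp: ennreal_mult_top top.not_eq_extremum)
          then have "(\<lambda>k. V t * ennreal (\<psi> k t)) \<longlonglongrightarrow> V t * indicator A t"
            by (intro ennreal_tendsto_cmult elim)
          with True show ?thesis by (simp add: mult.commute)
        next
          case False
          have z1: "ennreal (\<psi> k t) * V t * indicator {0..} t = 0" for k
            using False \<psi>(2)[of k t] cut(2)[of t] by (auto split: split_indicator)
          have z2: "indicator A t * V t * indicator {0..} t = 0"
            using False by (auto simp: A_def cut_def split: split_indicator)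
          show ?thesis unfolding z1 z2 by (rule tendsto_const)
        qed
      qed
    qed (use Vfin in auto)
    have d1: "(\<lambda>k. \<integral>\<^sup>+t. ennreal (\<psi> k t) * indicator {0..} t \<partial>lborel) \<longlonglongrightarrow> (\<integral>\<^sup>+t. indicator A t * indicator {0..} t \<partial>lborel)"
    proof (rule nn_integral_dominated_convergence[where w="\<lambda>t. ennreal (cut t) * indicator {0..} t"])
      show "AE t in lborel. ennreal (\<psi> k t) * indicator {0..} t \<le> ennreal (cut t) * indicator {0..} t" for k
        using \<psi>(2) by (intro AE_I2 mult_right_mono ennreal_leI) auto
      show "AE t in lborel. (\<lambda>k. ennreal (\<psi> k t) * indicator {0..} t) \<longlonglongrightarrow> indicator A t * indicator {0..} t"
        using lim by eventually_elim (auto split: split_indicator)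
    qed (use cutfin in auto)
    have "(\<integral>\<^sup>+t. ennreal (\<psi> k t) * V t * indicator {0..} t \<partial>lborel) \<le> ennreal C * (\<integral>\<^sup>+t. ennreal (\<psi> k t) * indicator {0..} t \<partial>lborel)" for k
    proof (rule test[OF \<psi>(1), where R="real n + 1"])
      show "0 \<le> \<psi> k t \<and> \<psi> k t \<le> 1" for t using \<psi>(2)[of k t] cut(2)[of t] by linarith
      show "\<psi> k t = 0" if "t > real n + 1" for t using cut(3)[OF that] by (simp add: \<psi>_def)
    qed
    then have "(\<integral>\<^sup>+t. indicator A t * V t * indicator {0..} t \<partial>lborel) \<le> ennreal C * (\<integral>\<^sup>+t. indicator A t * indicator {0..} t \<partial>lborel)"
      by (intro LIMSEQ_le[OF dV ennreal_tendsto_cmult[OF _ d1]]) auto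
    moreover have "(\<integral>\<^sup>+t. indicator A t * V t * indicator {0..} t \<partial>lborel) = (\<integral>\<^sup>+t. V t * indicator A t \<partial>lborel)"
      by (rule nn_integral_cong) (auto simp: A_def split: split_indicator)
    moreover have "(\<integral>\<^sup>+t. indicator A t * indicator {0..} t \<partial>lborel) = (\<integral>\<^sup>+t. indicator A t \<partial>lborel)"
      by (rule nn_integral_cong) (auto simp: A_def split: split_indicator)
    ultimately have le: "(\<integral>\<^sup>+t. V t * indicator A t \<partial>lborel) \<le> (\<integral>\<^sup>+t. ennreal C * indicator A t \<partial>lborel)"
      by (simp add: nn_integral_cmult)
    have "emeasure lborel A \<le> emeasure lborel {0..real n}" by (rule emeasure_mono) (auto simp: A_def)
    then have Afin: "emeasure lborel A < \<infinity>" using le_less_trans by fastforce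
    have "(\<integral>\<^sup>+t. V t * indicator A t - ennreal C * indicator A t \<partial>lborel) = (\<integral>\<^sup>+t. V t * indicator A t \<partial>lborel) - (\<integral>\<^sup>+t. ennreal C * indicator A t \<partial>lborel)"
    proof (rule nn_integral_diff)
      show "(\<integral>\<^sup>+t. ennreal C * indicator A t \<partial>lborel) \<noteq> \<infinity>"
        using Afin by (simp add: nn_integral_cmult ennreal_mult_eq_top_iff less_top)
      show "AE t in lborel. ennreal C * indicator A t \<le> V t * indicator A t"
        by (rule AE_I2) (auto simp: A_def split: split_indicator)
    qed auto
    also have "\<dots> = 0"
    proof (rule diff_eq_0_ennreal[OF le_less_trans[OF le] le])
      show "(\<integral>\<^sup>+t. ennreal C * indicator A t \<partial>lborel) < top"
        using Afin by (simp add: nn_integral_cmult ennreal_mult_less_top)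
    qed
    finally have "AE t in lborel. V t * indicator A t - ennreal C * indicator A t = 0"
      by (subst (asm) nn_integral_0_iff_AE) auto
    then show ?thesis
    proof eventually_elim
      case (elim t)
      show ?case
      proof (rule impI, rule ccontr)
        assume "t \<in> {0..real n}" "\<not> V t \<le> ennreal C"
        then have "t \<in> A" by (auto simp: A_def)
        with elim have "V t - ennreal C = 0" by simp
        then show False using \<open>\<not> V t \<le> ennreal C\<close> by (simp add: ennreal_minus_eq_0)
      qed
    qed
  qed
  then have "AE t in lborel. \<forall>n :: nat. t \<in> {0..real n} \<longrightarrow> V t \<le> ennreal C" by (subst AE_all_countable) auto
  then show ?thesis
    by eventually_elim (use real_arch_simple in fastforce)
qed

text \<open>
  For a test function of time only, the integral of \<open>|u\<^sub>j|\<close> is at most \<open>C\<close> times the integral of the test function. In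
  the limit \<open>m1\<close> contributes a nonnegative term, so the same bound holds for \<open>|w|\<close>, first in the mean over time and then for
  almost every time.
\<close>

lemma (in entropy_solution) dirac_bounded:
  fixes w :: "(real ^ 'd) \<times> real \<Rightarrow> real"
  assumes gen: "generates f u \<nu> m1 m2"
    and w: "w \<in> borel_measurable \<Lambda>" and dirac: "AE z in \<Lambda>. \<nu> z = return borel (w z)"
  shows "w \<in> Linf_L1"
proof -
  obtain C0 where C0: "Linf_L1_bounded u C0" using gen by (auto simp: generates_def)
  define C where "C = max 0 C0"
  have C: "C \<ge> 0" by (simp add: C_def)
  have um: "u j \<in> borel_measurable \<Lambda>" for j using C0 by (simp add: Linf_L1_bounded_def)
  obtain v where v [measurable]: "v \<in> borel_measurable borel" and wv: "AE z in \<Lambda>. w z = v z"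
    using borel_representative[OF _ w] by auto
  define V where "V t = (\<integral>\<^sup>+x. ennreal \<bar>v (x, t)\<bar> * indicator torus x \<partial>lborel)" for t
  have Vm: "V \<in> borel_measurable borel" unfolding V_def
    by (rule nn_integral_spacetime_slices(2)[of "\<lambda>z. ennreal \<bar>v z\<bar>"]) measurable
  have "AE t in lborel. t \<ge> 0 \<longrightarrow> V t \<le> ennreal C"
  proof (rule density_bound_from_tests[OF Vm C])
    fix \<psi> :: "real \<Rightarrow> real" and R
    assume \<psi>: "continuous_on UNIV \<psi>" "\<And>t. 0 \<le> \<psi> t \<and> \<psi> t \<le> 1" "\<And>t. t > R \<Longrightarrow> \<psi> t = 0"
    have \<psi>m [measurable]: "\<psi> \<in> borel_measurable borel" by (rule borel_measurable_continuous_onI[OF \<psi>(1)])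
    define \<phi> where "\<phi> = (\<lambda>z :: (real ^ 'd) \<times> real. \<psi> (snd z))"
    have "continuous_on (UNIV \<times> {0..}) \<phi>"
      unfolding \<phi>_def by (rule continuous_on_compose2[OF \<psi>(1)]) (auto intro!: continuous_on_snd continuous_on_id)
    then have \<phi>: "\<phi> \<in> Cc_spacetime" using \<psi>(3) by (auto simp: Cc_spacetime_def x_periodic_def \<phi>_def)
    have \<psi>fin: "(\<integral>\<^sup>+t. ennreal (\<psi> t) * indicator {0..} t \<partial>lborel) < \<infinity>"
    proof -
      have "(\<integral>\<^sup>+t. ennreal (\<psi> t) * indicator {0..} t \<partial>lborel) \<le> (\<integral>\<^sup>+t. indicator {0..R} t \<partial>lborel)"
      proof (rule nn_integral_mono)
        fix t :: real
        show "ennreal (\<psi> t) * indicator {0..} t \<le> indicator {0..R} t"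
          using \<psi>(2)[of t] \<psi>(3)[of t] by (auto split: split_indicator simp: ennreal_le_1)
      qed
      also have "\<dots> < \<infinity>" using emeasure_bounded_finite[of "{0..R}"] by simp
      finally show ?thesis .
    qed
    define I where "I = enn2real (\<integral>\<^sup>+t. ennreal (\<psi> t) * indicator {0..} t \<partial>lborel)"
    have I: "ennreal I = (\<integral>\<^sup>+t. ennreal (\<psi> t) * indicator {0..} t \<partial>lborel)" using \<psi>fin by (simp add: I_def)
    have I0: "I \<ge> 0" by (simp add: I_def)
    have bound: "(\<integral>z. \<bar>u j z - 0\<bar> * \<phi> z \<partial>\<Lambda>) \<le> C * I" for j
    proof -
      obtain v' where v' [measurable]: "v' \<in> borel_measurable borel" and uv: "AE z in \<Lambda>. u j z = v' z"
        using borel_representative[OF _ um[of j]] by auto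
      have [measurable]: "\<phi> \<in> borel_measurable borel"
        unfolding \<phi>_def by (intro borel_measurable_continuous_onI continuous_on_compose2[OF \<psi>(1)] continuous_on_snd continuous_on_id) auto
      have "(\<integral>\<^sup>+z. ennreal (\<bar>u j z - 0\<bar> * \<phi> z) \<partial>\<Lambda>) = (\<integral>\<^sup>+z. ennreal (\<bar>v' z\<bar> * \<phi> z) \<partial>\<Lambda>)"
        using uv by (intro nn_integral_cong_AE) (auto elim: eventually_mono)
      also have "\<dots> = (\<integral>\<^sup>+t. (\<integral>\<^sup>+x. ennreal (\<bar>v' (x, t)\<bar> * \<phi> (x, t)) * indicator torus x \<partial>lborel) * indicator {0..} t \<partial>lborel)"
        by (rule nn_integral_spacetime_slices) measurable
      also have "\<dots> \<le> (\<integral>\<^sup>+t. ennreal C * (ennreal (\<psi> t) * indicator {0..} t) \<partial>lborel)"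
      proof (rule nn_integral_mono_AE)
        have "AE t in lebesgue_on {0..}. \<forall>j. integrable (lebesgue_on torus) (\<lambda>x. u j (x, t)) \<and> (\<integral>x. \<bar>u j (x, t)\<bar> \<partial>lebesgue_on torus) \<le> C0"
          using C0 by (simp add: Linf_L1_bounded_def)
        then have "AE t in lebesgue_on {0..}. (\<integral>\<^sup>+x. ennreal \<bar>v' (x, t)\<bar> \<partial>lebesgue_on torus) \<le> ennreal C"
          using AE_spacetime_slices[OF uv]
        proof eventually_elim
          case (elim t)
          have "(\<integral>\<^sup>+x. ennreal \<bar>v' (x, t)\<bar> \<partial>lebesgue_on torus) = (\<integral>\<^sup>+x. ennreal \<bar>u j (x, t)\<bar> \<partial>lebesgue_on torus)"
            using elim(2) by (intro nn_integral_cong_AE) (auto elim: eventually_mono)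
          also have "\<dots> = ennreal (\<integral>x. \<bar>u j (x, t)\<bar> \<partial>lebesgue_on torus)"
            using elim(1) by (intro nn_integral_eq_integral) auto
          also have "\<dots> \<le> ennreal C" using elim(1) by (intro ennreal_leI) (auto simp: C_def intro: max.coboundedI2)
          finally show ?case .
        qed
        then have "AE t in lborel. t \<in> {0..} \<longrightarrow> (\<integral>\<^sup>+x. ennreal \<bar>v' (x, t)\<bar> * indicator torus x \<partial>lborel) \<le> ennreal C"
          by (simp add: AE_restrict_space_iff AE_completion_iff nn_integral_lebesgue_on)
        then show "AE t in lborel. (\<integral>\<^sup>+x. ennreal (\<bar>v' (x, t)\<bar> * \<phi> (x, t)) * indicator torus x \<partial>lborel) * indicator {0..} t
           \<le> ennreal C * (ennreal (\<psi> t) * indicator {0..} t)"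
        proof eventually_elim
          case (elim t)
          have [measurable]: "(\<lambda>x. v' (x, t)) \<in> borel_measurable borel"
            using v' by (auto intro: measurable_compose[OF _ v'] borel_measurable_continuous_onI continuous_intros)
          have "(\<integral>\<^sup>+x. ennreal (\<bar>v' (x, t)\<bar> * \<phi> (x, t)) * indicator torus x \<partial>lborel) = (\<integral>\<^sup>+x. ennreal (\<psi> t) * (ennreal \<bar>v' (x, t)\<bar> * indicator torus x) \<partial>lborel)"
            using \<psi>(2)[of t] by (intro nn_integral_cong) (simp add: \<phi>_def ennreal_mult mult_ac)
          also have "\<dots> = ennreal (\<psi> t) * (\<integral>\<^sup>+x. ennreal \<bar>v' (x, t)\<bar> * indicator torus x \<partial>lborel)"
            by (rule nn_integral_cmult) measurable
          finally have eq: "(\<integral>\<^sup>+x. ennreal (\<bar>v' (x, t)\<bar> * \<phi> (x, t)) * indicator torus x \<partial>lborel) = \<dots>" .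
          show ?case
          proof (cases "t \<in> {0..}")
            case True
            with elim have "ennreal (\<psi> t) * (\<integral>\<^sup>+x. ennreal \<bar>v' (x, t)\<bar> * indicator torus x \<partial>lborel) \<le> ennreal (\<psi> t) * ennreal C"
              by (intro mult_left_mono) auto
            with True show ?thesis unfolding eq by (simp add: mult.commute)
          qed simp
        qed
      qed
      also have "\<dots> = ennreal C * ennreal I" unfolding I by (rule nn_integral_cmult) measurable
      also have "\<dots> = ennreal (C * I)" using C I0 by (simp add: ennreal_mult)
      finally have le: "(\<integral>\<^sup>+z. ennreal (\<bar>u j z - 0\<bar> * \<phi> z) \<partial>\<Lambda>) \<le> ennreal (C * I)" .
      have "(\<integral>z. \<bar>u j z - 0\<bar> * \<phi> z \<partial>\<Lambda>) = enn2real (\<integral>\<^sup>+z. ennreal (\<bar>u j z - 0\<bar> * \<phi> z) \<partial>\<Lambda>)"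
      proof (rule integral_eq_nn_integral)
        have "\<phi> \<in> borel_measurable \<Lambda>" by (rule borel_measurable_lebesgue_on) measurable
        then show "(\<lambda>z. \<bar>u j z - 0\<bar> * \<phi> z) \<in> borel_measurable \<Lambda>" using um[of j] by measurable
        show "AE z in \<Lambda>. 0 \<le> \<bar>u j z - 0\<bar> * \<phi> z" using \<psi>(2) by (intro AE_I2) (simp add: \<phi>_def)
      qed
      also have "\<dots> \<le> enn2real (ennreal (C * I))" by (rule enn2real_mono[OF le]) simp
      also have "\<dots> = C * I" using C I0 by simp
      finally show ?thesis .
    qed
    have lim: "(\<lambda>j. \<integral>z. \<bar>u j z - 0\<bar> * \<phi> z \<partial>\<Lambda>) \<longlonglongrightarrow> (\<integral>z. (\<integral>l. \<bar>l - 0\<bar> \<partial>\<nu> z) * \<phi> z \<partial>\<Lambda>) + (\<integral>z. \<phi> z \<partial>m1)"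
      using gen \<phi> unfolding generates_def by blast
    have "(\<integral>z. (\<integral>l. \<bar>l - 0\<bar> \<partial>\<nu> z) * \<phi> z \<partial>\<Lambda>) + (\<integral>z. \<phi> z \<partial>m1) \<le> C * I"
      by (rule LIMSEQ_le_const2[OF lim]) (use bound in blast)
    moreover have "(\<integral>z. \<phi> z \<partial>m1) \<ge> 0" using \<psi>(2) by (intro Bochner_Integration.integral_nonneg) (simp add: \<phi>_def)
    ultimately have le: "(\<integral>z. (\<integral>l. \<bar>l - 0\<bar> \<partial>\<nu> z) * \<phi> z \<partial>\<Lambda>) \<le> C * I" by linarith
    have ij: "integrable joint (\<lambda>p. \<bar>snd p\<bar> * \<psi> (snd (fst p)))"
    proof (rule joint_integrable_bound[where c=1 and R=R])
      fix p :: "((real ^ 'd) \<times> real) \<times> real"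
      show "\<bar>\<bar>snd p\<bar> * \<psi> (snd (fst p))\<bar> \<le> 1 * weight R p"
        using \<psi>(2)[of "snd (fst p)"] \<psi>(3)[of "snd (fst p)"] mult_left_le[of "\<psi> (snd (fst p))" "\<bar>snd p\<bar>"]
        by (auto simp: weight_def abs_mult split: split_indicator)
    qed measurable
    have intg: "integrable \<Lambda> (\<lambda>z. (\<integral>l. \<bar>l - 0\<bar> \<partial>\<nu> z) * \<phi> z)"
      using integrable_integral_joint[OF ij] by (simp add: \<phi>_def)
    have "(\<integral>\<^sup>+z. ennreal (\<bar>v z\<bar> * \<phi> z) \<partial>\<Lambda>) = (\<integral>\<^sup>+z. ennreal ((\<integral>l. \<bar>l - 0\<bar> \<partial>\<nu> z) * \<phi> z) \<partial>\<Lambda>)"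
    proof (rule nn_integral_cong_AE)
      show "AE z in \<Lambda>. ennreal (\<bar>v z\<bar> * \<phi> z) = ennreal ((\<integral>l. \<bar>l - 0\<bar> \<partial>\<nu> z) * \<phi> z)"
        using dirac wv by eventually_elim (simp add: integral_return)
    qed
    also have "\<dots> = ennreal (\<integral>z. (\<integral>l. \<bar>l - 0\<bar> \<partial>\<nu> z) * \<phi> z \<partial>\<Lambda>)"
      using \<psi>(2) by (intro nn_integral_eq_integral intg AE_I2) (simp add: \<phi>_def)
    also have "\<dots> \<le> ennreal (C * I)" by (rule ennreal_leI[OF le])
    also have "\<dots> = ennreal C * (\<integral>\<^sup>+t. ennreal (\<psi> t) * indicator {0..} t \<partial>lborel)" using C I0 by (simp add: ennreal_mult I)
    finally have fin: "(\<integral>\<^sup>+z. ennreal (\<bar>v z\<bar> * \<phi> z) \<partial>\<Lambda>) \<le> ennreal C * (\<integral>\<^sup>+t. ennreal (\<psi> t) * indicator {0..} t \<partial>lborel)" .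
    have [measurable]: "\<phi> \<in> borel_measurable borel"
      unfolding \<phi>_def by (intro borel_measurable_continuous_onI continuous_on_compose2[OF \<psi>(1)] continuous_on_snd continuous_on_id) auto
    have "(\<integral>\<^sup>+z. ennreal (\<bar>v z\<bar> * \<phi> z) \<partial>\<Lambda>) = (\<integral>\<^sup>+t. (\<integral>\<^sup>+x. ennreal (\<bar>v (x, t)\<bar> * \<phi> (x, t)) * indicator torus x \<partial>lborel) * indicator {0..} t \<partial>lborel)"
      by (rule nn_integral_spacetime_slices) measurable
    also have "\<dots> = (\<integral>\<^sup>+t. ennreal (\<psi> t) * V t * indicator {0..} t \<partial>lborel)"
    proof (rule nn_integral_cong)
      fix t :: real
      have [measurable]: "(\<lambda>x. v (x, t)) \<in> borel_measurable borel"
        using v by (auto intro: measurable_compose[OF _ v] borel_measurable_continuous_onI continuous_intros)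
      have "(\<integral>\<^sup>+x. ennreal (\<bar>v (x, t)\<bar> * \<phi> (x, t)) * indicator torus x \<partial>lborel) = (\<integral>\<^sup>+x. ennreal (\<psi> t) * (ennreal \<bar>v (x, t)\<bar> * indicator torus x) \<partial>lborel)"
        using \<psi>(2)[of t] by (intro nn_integral_cong) (simp add: \<phi>_def ennreal_mult mult_ac)
      also have "\<dots> = ennreal (\<psi> t) * V t" unfolding V_def by (rule nn_integral_cmult) measurable
      finally show "(\<integral>\<^sup>+x. ennreal (\<bar>v (x, t)\<bar> * \<phi> (x, t)) * indicator torus x \<partial>lborel) * indicator {0..} t = ennreal (\<psi> t) * V t * indicator {0..} t"
        by simp
    qed
    finally show "(\<integral>\<^sup>+t. ennreal (\<psi> t) * V t * indicator {0..} t \<partial>lborel) \<le> ennreal C * (\<integral>\<^sup>+t. ennreal (\<psi> t) * indicator {0..} t \<partial>lborel)"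
      using fin by simp
  qed
  then have "AE t in lebesgue_on {0..}. (\<integral>\<^sup>+x. ennreal \<bar>v (x, t)\<bar> \<partial>lebesgue_on torus) \<le> ennreal C"
    by (simp add: AE_restrict_space_iff AE_completion_iff nn_integral_lebesgue_on V_def)
  then have "AE t in lebesgue_on {0..}. \<forall>j :: unit. integrable (lebesgue_on torus) (\<lambda>x. w (x, t)) \<and> (\<integral>x. \<bar>w (x, t)\<bar> \<partial>lebesgue_on torus) \<le> C"
    using AE_spacetime_slices[OF wv]
  proof eventually_elim
    case (elim t)
    have "(\<lambda>x. v (x, t)) \<in> borel_measurable borel"
      using v by (auto intro: measurable_compose[OF _ v] borel_measurable_continuous_onI continuous_intros)
    then have vm: "(\<lambda>x. v (x, t)) \<in> borel_measurable (lebesgue_on torus)" by (rule borel_measurable_lebesgue_on)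
    have wm: "(\<lambda>x. w (x, t)) \<in> borel_measurable (lebesgue_on torus)"
      by (rule lebesgue_on_AE_measurable[OF _ elim(2) vm]) auto
    have "(\<integral>\<^sup>+x. ennreal \<bar>w (x, t)\<bar> \<partial>lebesgue_on torus) = (\<integral>\<^sup>+x. ennreal \<bar>v (x, t)\<bar> \<partial>lebesgue_on torus)"
      using elim(2) by (intro nn_integral_cong_AE) (auto elim: eventually_mono)
    with elim(1) have le: "(\<integral>\<^sup>+x. ennreal \<bar>w (x, t)\<bar> \<partial>lebesgue_on torus) \<le> ennreal C" by simp
    then have i: "integrable (lebesgue_on torus) (\<lambda>x. w (x, t))"
      using wm by (intro integrableI_bounded) (auto intro: le_less_trans)
    have "ennreal (\<integral>x. \<bar>w (x, t)\<bar> \<partial>lebesgue_on torus) \<le> ennreal C"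
      using le i by (subst nn_integral_eq_integral[symmetric]) auto
    then have "(\<integral>x. \<bar>w (x, t)\<bar> \<partial>lebesgue_on torus) \<le> C" using C by simp
    with i show ?case by simp
  qed
  then show ?thesis using w unfolding Linf_L1_def Linf_L1_bounded_def by blast
qed

section \<open>Uniqueness\<close>

lemma mv_entropy_solution_entropy_solution:
  assumes "continuous_on UNIV f" "\<exists>C>0. \<forall>l. norm (f l) \<le> C * (1 + \<bar>l\<bar>)" "mv_entropy_solution f u0 \<nu> m1 m2"
  shows "entropy_solution f \<nu> m1 m2"
proof
  from assms(3) obtain u where "generates f u \<nu> m1 m2" by (auto simp: mv_entropy_solution_def)
  then have "\<forall>k T. (\<integral>\<^sup>+z\<in>torus \<times> {0..T}. (\<integral>\<^sup>+l. ennreal \<bar>l - k\<bar> \<partial>\<nu> z) \<partial>lebesgue) < \<infinity>"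
    by (simp add: generates_def)
  from this[rule_format, where k=0]
  show "(\<integral>\<^sup>+z\<in>torus \<times> {0..T}. (\<integral>\<^sup>+l. ennreal \<bar>l\<bar> \<partial>\<nu> z) \<partial>lebesgue) < \<infinity>" for T by simp
qed (use assms in \<open>auto simp: mv_entropy_solution_def\<close>)

theorem theorem2p2:
  fixes f :: "real \<Rightarrow> real ^ 'd"
    and u0 :: "real ^ 'd \<Rightarrow> real"
    and \<nu> \<sigma> :: "(real ^ 'd) \<times> real \<Rightarrow> real measure"
    and m1 m1' :: "((real ^ 'd) \<times> real) measure"
    and m2 m2' :: "((real ^ 'd) \<times> real) set \<Rightarrow> real ^ 'd"
  assumes "continuous_on UNIV f"
    and "\<exists>C>0. \<forall>l. norm (f l) \<le> C * (1 + \<bar>l\<bar>)"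
    and "integrable (lebesgue_on torus) u0"
    and "mv_entropy_solution f u0 \<nu> m1 m2"
    and "mv_entropy_solution f u0 \<sigma> m1' m2'"
  shows "(\<exists>w\<in>Linf_L1. AE z in lebesgue_on spacetime.
            \<nu> z = return borel (w z) \<and> \<sigma> z = return borel (w z))
         \<and> m1 = null_measure borel_spacetime \<and> m1' = null_measure borel_spacetime
         \<and> (\<forall>A\<in>bounded_borel. m2 A = 0) \<and> (\<forall>A\<in>bounded_borel. m2' A = 0)"
proof -
  obtain v0 where v0: "v0 \<in> borel_measurable borel" and ae: "AE x in lebesgue_on torus. u0 x = v0 x"
    using borel_representative[OF _ borel_measurable_integrable[OF assms(3)]] by auto
  have "integrable (lebesgue_on torus) v0"
    using assms(3) by (rule integrable_cong_AE_imp) (use ae v0 in \<open>auto intro: borel_measurable_lebesgue_on elim: eventually_mono\<close>)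
  then have v0i: "integrable lborel (\<lambda>x. v0 x * indicator torus x)"
    using v0 by (simp add: integral_lebesgue_on_borel)
  note sol1 = mv_entropy_solution_entropy_solution[OF assms(1,2,4)]
    and sol2 = mv_entropy_solution_entropy_solution[OF assms(1,2,5)]
  have init: "initial_condition u0 \<nu> m1" "initial_condition u0 \<sigma> m1'"
    using assms(4,5) by (auto simp: mv_entropy_solution_def)
  interpret A: common_datum f \<nu> m1 m2 \<sigma> m1' m2' u0 v0
    by (intro common_datum.intro common_datum_axioms.intro sol1 sol2 init v0 v0i ae)
  have B: "common_datum f \<sigma> m1' m2' \<nu> m1 m2 u0 v0"
    by (intro common_datum.intro common_datum_axioms.intro sol1 sol2 init v0 v0i ae)
  define w where "w z = A.mean2 z / A.mean1 z" for z
  have wm: "w \<in> borel_measurable (lebesgue_on spacetime)"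
    unfolding w_def by (intro borel_measurable_divide A.mean_measurable)
  have dirac: "AE z in lebesgue_on spacetime. \<nu> z = return borel (w z) \<and> \<sigma> z = return borel (w z)"
    unfolding w_def by (rule A.dirac)
  obtain u where "generates f u \<nu> m1 m2" using assms(4) by (auto simp: mv_entropy_solution_def)
  then have "w \<in> Linf_L1"
    by (rule A.S1.dirac_bounded[OF _ wm]) (use dirac in \<open>auto elim: eventually_mono\<close>)
  with dirac show ?thesis
    using A.concentration_vanishes common_datum.concentration_vanishes[OF B]
      A.flux_concentration_vanishes common_datum.flux_concentration_vanishes[OF B] by blast
qed

end
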